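(* Let $0<\alpha<1$. Among all $k$-uniform hypertrees with $m$ hyperedges, $S_m^{(k)}$ (resp. $S^{(k)}_{1,2,1,\ldots,1}$) has the largest (resp. the second largest) $2$-nd order $\mathcal{A}_\alpha$-spectral moment for $k\ge2$, and $P_m^{(k)}$ (resp. $F_{m,k}$) has the smallest (resp. the second smallest) $(k+2)$-nd order $\mathcal{A}_\alpha$-spectral moment for $k\ge3$.
   Context: Hypergraphs are finite; $k$-uniform means every hyperedge has exactly $k$ vertices; a hypertree is a connected hypergraph without cycles; a cored vertex is a vertex of degree one. The hyperpath $P_r^{(k)}$ of length $r$ is obtained from the path graph with consecutive edges $e_1,\dots,e_r$ by inserting $k-2$ new (cored) vertices into each edge, giving consecutive hyperedges $e_1^{(k)},\dots,e_r^{(k)}$. The starlike hypertree $S^{(k)}_{n_1,\dots,n_p}$ ($p\ge1$, $n_i\ge1$) is obtained from $p$ hyperpaths of lengths $n_1,\dots,n_p$ by sharing a common (end) vertex; the hyperstar $S_m^{(k)}$ is $S^{(k)}_{1,\dots,1}$ with $m$ ones. $S^{(k)}_{1,2,1,\dots,1}$ denotes the starlike hypertree of this form with $m$ hyperedges in total. $F_{m,k}$ is obtained from $P_{m-1}^{(k)}$ by attaching a pendant hyperedge (a new hyperedge consisting of the attachment vertex and $k-1$ new vertices) to a cored vertex on the hyperedge $e_2^{(k)}$. For a $k$-uniform hypergraph $\mathcal{H}$ on $[n]$, $\mathcal{A}(\mathcal{H})$ is the $k$-order $n$-dimensional tensor with entry $\frac1{(k-1)!}$ at $(i_1,\dots,i_k)$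 if $\{i_1,\dots,i_k\}\in E(\mathcal{H})$ and $0$ otherwise; $\mathcal{D}(\mathcal{H})$ is the diagonal tensor of vertex degrees; $\mathcal{A}_\alpha(\mathcal{H})=\alpha\mathcal{D}(\mathcal{H})+(1-\alpha)\mathcal{A}(\mathcal{H})$. The $d$-th order $\mathcal{A}_\alpha$-spectral moment of $\mathcal{H}$ is the sum of the $d$-th powers of all $n(k-1)^{n-1}$ eigenvalues of $\mathcal{A}_\alpha(\mathcal{H})$; it equals the $d$-th order trace $\mathrm{Tr}_d(\mathcal{A}_\alpha(\mathcal{H}))$, where for a $k$-order $n$-dimensional tensor $\mathcal{T}$ and $d\ge1$, $$\mathrm{Tr}_{d}(\mathcal{T})=(k-1)^{n-1}\sum_{d_1+\cdots+d_n=d}\ \prod_{i=1}^{n}\frac{1}{(d_i(k-1))!}\Big(\sum_{\gamma\in[n]^{k-1}}(\mathcal{T})_{i\gamma}\frac{\partial}{\partial a_{i\gamma}}\Big)^{d_i}\mathrm{tr}\big(A^{d(k-1)}\big),$$ with $A=(a_{ij})$ an $n\times n$ matrix of indeterminates, $d_i\ge0$ integers, $\frac{\partial}{\partial a_{i\gamma}}=\frac{\partial}{\partial a_{i i_2}}\cdots\frac{\partial}{\partial a_{i i_k}}$ for $\gamma=i_2\cdots i_k$.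
   Formalization: The second-largest claim is stated for m≥3, where S_{1,2,1,…,1} exists, and the second-smallest claim for m≥4, since F_{3,k} is P_3 itself and so not second; the spectral moment is taken as the trace Tr_d. *)

theory Defs
  imports
    "HOL-Library.Poly_Mapping"
    "Jordan_Normal_Form.Matrix"
begin

section \<open>Hypergraphs\<close>

text \<open>The vertex set is \<open>{..<nverts H}\<close>, i.e. the set [n] shifted to start at 0.\<close>

record hypergraph =
  nverts :: nat
  edges :: "nat set set"

definition uniform :: "nat \<Rightarrow> hypergraph \<Rightarrow> bool" where
  "uniform k H \<longleftrightarrow> (\<forall>e\<in>edges H. e \<subseteq> {..<nverts H} \<and> card e = k)"

definition degree :: "hypergraph \<Rightarrow> nat \<Rightarrow> nat" where
  "degree H v = card {e \<in> edges H. v \<in> e}"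

definition connected :: "hypergraph \<Rightarrow> bool" where
  "connected H \<longleftrightarrow>
    (\<forall>u<nverts H. \<forall>v<nverts H. (u, v) \<in> {(x, y). \<exists>e\<in>edges H. x \<in> e \<and> y \<in> e}\<^sup>*)"

text \<open>Berge cycles: the closed alternating sequence \<open>vs!0, es!0, vs!1, es!1, \<dots>\<close> with distinct
  vertices and distinct hyperedges. In particular, two hyperedges with two common vertices form a
  cycle of length 2.\<close>

definition is_cycle :: "hypergraph \<Rightarrow> nat list \<Rightarrow> nat set list \<Rightarrow> bool" where
  "is_cycle H vs es \<longleftrightarrow>
    length vs = length es \<and> length es \<ge> 2 \<and> distinct vs \<and> distinct es \<and> set es \<subseteq> edges H \<and>
    (\<forall>i<length es. vs ! i \<in> es ! i \<and> vs ! (Suc i mod length es) \<in> es ! i)"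

definition hypertree :: "hypergraph \<Rightarrow> bool" where
  "hypertree H \<longleftrightarrow> connected H \<and> (\<nexists>vs es. is_cycle H vs es)"

definition uniform_hypertrees :: "nat \<Rightarrow> nat \<Rightarrow> hypergraph set" where
  "uniform_hypertrees k m = {H. uniform k H \<and> hypertree H \<and> card (edges H) = m}"

definition isomorphic :: "hypergraph \<Rightarrow> hypergraph \<Rightarrow> bool" where
  "isomorphic G H \<longleftrightarrow>
    (\<exists>\<pi>. bij_betw \<pi> {..<nverts G} {..<nverts H} \<and> (\<lambda>e. \<pi> ` e) ` edges G = edges H)"


section \<open>Special hypertrees\<close>

text \<open>The vertices \<open>i * (k - 1)\<close>, \<open>i \<le> r\<close>, are those of the underlying path graph; the \<open>k - 2\<close>
  numbers strictly between two consecutive ones are the cored vertices inserted into that edge.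
  The hyperedge \<open>e\<^sub>i\<close> (numbered from 1) is the one with index \<open>i - 1\<close>.\<close>

definition hyperpath :: "nat \<Rightarrow> nat \<Rightarrow> hypergraph" where
  "hyperpath k r =
    \<lparr>nverts = r * (k - 1) + 1, edges = (\<lambda>i. {i * (k - 1) .. (i + 1) * (k - 1)}) ` {..<r}\<rparr>"

text \<open>The shared end vertex is 0. In the \<open>i\<close>-th hyperpath, vertex 0 is identified with it, and
  the other vertices are shifted past those of the preceding hyperpaths.\<close>

definition leg_vertex :: "nat \<Rightarrow> nat list \<Rightarrow> nat \<Rightarrow> nat \<Rightarrow> nat" where
  "leg_vertex k ns i t = (if t = 0 then 0 else sum_list (take i ns) * (k - 1) + t)"

definition starlike :: "nat \<Rightarrow> nat list \<Rightarrow> hypergraph" where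
  "starlike k ns =
    \<lparr>nverts = sum_list ns * (k - 1) + 1,
     edges = (\<Union>i<length ns. (\<lambda>e. leg_vertex k ns i ` e) ` edges (hyperpath k (ns ! i)))\<rparr>"

definition hyperstar :: "nat \<Rightarrow> nat \<Rightarrow> hypergraph" where
  "hyperstar k m = starlike k (replicate m 1)"

text \<open>\<open>S\<^sub>1\<^sub>,\<^sub>2\<^sub>,\<^sub>1\<^sub>,\<^sub>\<dots>\<^sub>,\<^sub>1\<close> with \<open>m \<ge> 3\<close> hyperedges in total.\<close>

definition starlike_12 :: "nat \<Rightarrow> nat \<Rightarrow> hypergraph" where
  "starlike_12 k m = starlike k ([1, 2] @ replicate (m - 3) 1)"

definition attach_pendant :: "nat \<Rightarrow> hypergraph \<Rightarrow> nat \<Rightarrow> hypergraph" where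
  "attach_pendant k H v =
    \<lparr>nverts = nverts H + (k - 1),
     edges = insert (insert v {nverts H ..< nverts H + (k - 1)}) (edges H)\<rparr>"

text \<open>The second hyperedge of the hyperpath is \<open>{k - 1 .. 2 * (k - 1)}\<close>; for \<open>k \<ge> 3\<close>, \<open>k\<close> is the
  first of its cored vertices.\<close>

definition F_tree :: "nat \<Rightarrow> nat \<Rightarrow> hypergraph" where
  "F_tree m k = attach_pendant k (hyperpath k (m - 1)) k"


section \<open>Tensors of a hypergraph\<close>

text \<open>A tensor of order \<open>k\<close> and dimension \<open>n\<close> is a function on index lists of length \<open>k\<close> over
  \<open>{..<n}\<close>; its values on other lists are irrelevant.\<close>

type_synonym tensor = "nat list \<Rightarrow> real"

definition adjacency_tensor :: "nat \<Rightarrow> hypergraph \<Rightarrow> tensor" where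
  "adjacency_tensor k H is = (if set is \<in> edges H then 1 / fact (k - 1) else 0)"

definition degree_tensor :: "nat \<Rightarrow> hypergraph \<Rightarrow> tensor" where
  "degree_tensor k H is = (if is = replicate k (hd is) then real (degree H (hd is)) else 0)"

definition A_alpha :: "real \<Rightarrow> nat \<Rightarrow> hypergraph \<Rightarrow> tensor" where
  "A_alpha \<alpha> k H is = \<alpha> * degree_tensor k H is + (1 - \<alpha>) * adjacency_tensor k H is"


section \<open>Traces of tensors\<close>

text \<open>Real polynomials in indeterminates \<open>a\<^sub>i\<^sub>j\<close>: the keys of the outer mapping are monomials, its
  values the coefficients.\<close>

type_synonym mpoly = "((nat \<times> nat) \<Rightarrow>\<^sub>0 nat) \<Rightarrow>\<^sub>0 real"

definition Const :: "real \<Rightarrow> mpoly" where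
  "Const c = Poly_Mapping.single 0 c"

definition Var :: "nat \<times> nat \<Rightarrow> mpoly" where
  "Var x = Poly_Mapping.single (Poly_Mapping.single x 1) 1"

definition pdiff :: "nat \<times> nat \<Rightarrow> mpoly \<Rightarrow> mpoly" where
  "pdiff x p = (\<Sum>\<mu>\<in>Poly_Mapping.keys p.
    Poly_Mapping.single (\<mu> - Poly_Mapping.single x 1)
      (real (Poly_Mapping.lookup \<mu> x) * Poly_Mapping.lookup p \<mu>))"

definition index_lists :: "nat \<Rightarrow> nat \<Rightarrow> nat list set" where
  "index_lists n l = {\<gamma>. length \<gamma> = l \<and> set \<gamma> \<subseteq> {..<n}}"

definition row_operator :: "nat \<Rightarrow> nat \<Rightarrow> tensor \<Rightarrow> nat \<Rightarrow> mpoly \<Rightarrow> mpoly" where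
  "row_operator k n T i p =
    (\<Sum>\<gamma>\<in>index_lists n (k - 1). Const (T (i # \<gamma>)) * fold (\<lambda>j. pdiff (i, j)) \<gamma> p)"

definition trace_power :: "nat \<Rightarrow> nat \<Rightarrow> mpoly" where
  "trace_power n l = (\<Sum>i<n. (mat n n Var ^\<^sub>m l) $$ (i, i))"

definition compositions :: "nat \<Rightarrow> nat \<Rightarrow> nat list set" where
  "compositions n d = {ds. length ds = n \<and> sum_list ds = d}"

text \<open>The operators in the product over \<open>i\<close> have constant coefficients, hence commute. As
  \<open>trace_power n (d * (k - 1))\<close> is homogeneous of degree \<open>d * (k - 1)\<close>, which is also the order of
  the differential operator, the result of the differentiation is a constant polynomial;
  it is turned into a real number by taking its constant coefficient.\<close>

definition tensor_trace :: "nat \<Rightarrow> nat \<Rightarrow> nat \<Rightarrow> tensor \<Rightarrow> real" where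
  "tensor_trace k n d T = real ((k - 1) ^ (n - 1)) *
    Poly_Mapping.lookup
      (\<Sum>ds\<in>compositions n d.
        foldr (\<lambda>i q. Const (1 / fact (ds ! i * (k - 1))) * (row_operator k n T i ^^ (ds ! i)) q)
          [0..<n] (trace_power n (d * (k - 1)))) 0"

text \<open>The sum of the \<open>d\<close>-th powers of all \<open>n(k-1)\<^sup>n\<^sup>-\<^sup>1\<close> eigenvalues (the roots, with multiplicity,
  of the characteristic polynomial) is the \<open>d\<close>-th order trace (Morozov and Shakirov), which is
  how it is defined here, since no multivariate resultants are available.\<close>

definition spectral_moment :: "real \<Rightarrow> nat \<Rightarrow> nat \<Rightarrow> hypergraph \<Rightarrow> real" where
  "spectral_moment \<alpha> k d H = tensor_trace k (nverts H) d (A_alpha \<alpha> k H)"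

end

theory Submission
  imports Defs
    "HOL-Library.FuncSet"
    "HOL-Library.Multiset"
    "HOL-Combinatorics.Transposition"
    "HOL-Combinatorics.Permutations"
begin

text \<open>Expanding the differential operators, the trace of order d becomes a sum, with nonnegative
  coefficients, over arrangements of d tensor entries whose arcs form a closed walk. On a hypertree
  the balance of in- and out-arcs is a flow problem on a forest, so every hyperedge occurs equally
  often at each of its vertices. Hence for d < 2k an arrangement either consists of diagonal
  entries at one vertex, or uses a single hyperedge once at each of its vertices, together with
  d - k diagonal entries at these vertices. By symmetry under relabelling, the moment of order 2 is
  an increasing affine function of the sum of squared degrees, and the moment of order k + 2 is a
  combination of the degree sums of order k + 2 and 3 and of the sum of products of degrees over
  pairs of vertices in a common hyperedge, with coefficients that depend only on k, m and alpha;
  the coefficient of the latter is positive. Each of these quantities is then optimised separately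
  in terms of the excesses deg(v) - 1, whose sum is m - 1.\<close>

section \<open>Traces of tensors as weighted sums over closed walks\<close>

text \<open>Order \<open>k + 2\<close> is the smallest one that separates the two hypertrees at the
  bottom. The hyperpath and \<open>F_tree\<close> have the same degree sequence, so power sums of
  degrees cannot tell them apart. One diagonal entry beside a hyperedge only yields squared degrees;
  two entries are the fewest that see two vertices of a hyperedge at once. The condition
  \<open>k + 2 < 2 * k\<close>, that is \<open>k \<ge> 3\<close>, excludes arrangements with two
  hyperedges or with one used twice.

  The coefficients are never evaluated. All competitors have the same number of vertices, so
  symmetry makes the coefficients equal for them, and nonnegativity is enough for the weak
  inequalities. Among the weights only that of the pair sum must be positive, for strictness; a
  single explicit arrangement with a closed walk shows it.\<close>

definition monomial_fact :: "('a \<Rightarrow>\<^sub>0 nat) \<Rightarrow> real" where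
  "monomial_fact \<mu> = (\<Prod>x\<in>Poly_Mapping.keys \<mu>. fact (Poly_Mapping.lookup \<mu> x))"

text \<open>With this normalisation of the coefficients, differentiation becomes a shift of monomials.\<close>

definition scaled_coeff :: "mpoly \<Rightarrow> ((nat \<times> nat) \<Rightarrow>\<^sub>0 nat) \<Rightarrow> real" where
  "scaled_coeff p \<mu> = monomial_fact \<mu> * Poly_Mapping.lookup p \<mu>"

definition mono_of :: "'a list \<Rightarrow> ('a \<Rightarrow>\<^sub>0 nat)" where
  "mono_of xs = (\<Sum>x\<leftarrow>xs. Poly_Mapping.single x 1)"

lemma mono_of_simps [simp]:
  "mono_of [] = 0"
  "mono_of (x # xs) = Poly_Mapping.single x 1 + mono_of xs"
  "mono_of (xs @ ys) = mono_of xs + mono_of ys"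
  by (simp_all add: mono_of_def)

lemma lookup_mono_of: "Poly_Mapping.lookup (mono_of xs) x = count (mset xs) x"
  by (induction xs) (auto simp: lookup_add lookup_single when_def)

lemma mono_of_eq_iff: "mono_of xs = mono_of ys \<longleftrightarrow> mset xs = mset ys"
  by (metis lookup_mono_of multiset_eqI poly_mapping_eqI)

lemma monomial_fact_superset:
  assumes "finite S" "Poly_Mapping.keys \<mu> \<subseteq> S"
  shows "monomial_fact \<mu> = (\<Prod>x\<in>S. fact (Poly_Mapping.lookup \<mu> x))"
  unfolding monomial_fact_def using assms
  by (intro prod.mono_neutral_left) (auto simp: in_keys_iff)

lemma monomial_fact_add_single:
  "monomial_fact (\<mu> + Poly_Mapping.single x 1) =
     real (Poly_Mapping.lookup \<mu> x + 1) * monomial_fact \<mu>"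
proof -
  let ?S = "insert x (Poly_Mapping.keys \<mu>)"
  have "monomial_fact (\<mu> + Poly_Mapping.single x 1) =
      (\<Prod>y\<in>?S. fact (Poly_Mapping.lookup (\<mu> + Poly_Mapping.single x 1) y))"
    by (rule monomial_fact_superset) (auto simp: in_keys_iff lookup_add lookup_single when_def split: if_splits)
  also have "\<dots> = fact (Poly_Mapping.lookup \<mu> x + 1) *
      (\<Prod>y\<in>?S - {x}. fact (Poly_Mapping.lookup \<mu> y))"
    by (subst prod.remove[of _ x]) (auto simp: lookup_add lookup_single when_def intro!: prod.cong split: if_splits)
  also have "\<dots> = real (Poly_Mapping.lookup \<mu> x + 1) * (\<Prod>y\<in>?S. fact (Poly_Mapping.lookup \<mu> y))"
    by (subst (2) prod.remove[of _ x]) auto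
  also have "(\<Prod>y\<in>?S. fact (Poly_Mapping.lookup \<mu> y)) = monomial_fact \<mu>"
    by (rule monomial_fact_superset[symmetric]) auto
  finally show ?thesis .
qed

lemma lookup_pdiff:
  "Poly_Mapping.lookup (pdiff x p) \<mu> =
     real (Poly_Mapping.lookup \<mu> x + 1) * Poly_Mapping.lookup p (\<mu> + Poly_Mapping.single x 1)"
proof -
  let ?s = "Poly_Mapping.single x (1::nat)"
  have *: "Poly_Mapping.lookup (Poly_Mapping.single (\<nu> - ?s)
        (real (Poly_Mapping.lookup \<nu> x) * Poly_Mapping.lookup p \<nu>)) \<mu> =
      (if \<nu> = \<mu> + ?s then real (Poly_Mapping.lookup \<mu> x + 1) * Poly_Mapping.lookup p \<nu> else 0)"
    for \<nu>
  \<comment> \<open>If \<open>x\<close> does not occur in \<open>\<nu>\<close>, the truncated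
    difference of monomials is meaningless, but the coefficient is then 0; otherwise the subtraction
    can be undone.\<close>
  proof (cases "Poly_Mapping.lookup \<nu> x = 0")
    case True
    then show ?thesis by (auto simp: lookup_add lookup_single)
  next
    case False
    have "\<nu> - ?s + ?s = \<nu>"
      using False by (intro poly_mapping_eqI)
        (auto simp: lookup_add lookup_minus lookup_single when_def)
    then have "\<nu> - ?s = \<mu> \<longleftrightarrow> \<nu> = \<mu> + ?s"
      by (metis add_diff_cancel_right')
    then show ?thesis by (auto simp: lookup_single when_def lookup_add)
  qed
  have "Poly_Mapping.lookup (pdiff x p) \<mu> = (\<Sum>\<nu>\<in>Poly_Mapping.keys p.
      if \<nu> = \<mu> + ?s then real (Poly_Mapping.lookup \<mu> x + 1) * Poly_Mapping.lookup p \<nu> else 0)"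
    unfolding pdiff_def lookup_sum by (intro sum.cong refl *)
  also have "\<dots> = (if \<mu> + ?s \<in> Poly_Mapping.keys p
      then real (Poly_Mapping.lookup \<mu> x + 1) * Poly_Mapping.lookup p (\<mu> + ?s) else 0)"
    by (subst sum.delta) auto
  finally show ?thesis by (auto simp: in_keys_iff)
qed

lemma scaled_coeff_pdiff:
  "scaled_coeff (pdiff x p) \<mu> = scaled_coeff p (\<mu> + Poly_Mapping.single x 1)"
  unfolding scaled_coeff_def lookup_pdiff monomial_fact_add_single by simp

lemma scaled_coeff_fold_pdiff:
  "scaled_coeff (fold (\<lambda>j. pdiff (i, j)) \<gamma> p) \<mu> = scaled_coeff p (\<mu> + mono_of (map (Pair i) \<gamma>))"
  by (induction \<gamma> arbitrary: p \<mu>) (auto simp: scaled_coeff_pdiff add_ac)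

lemma scaled_coeff_sum:
  "scaled_coeff (\<Sum>x\<in>A. f x) \<mu> = (\<Sum>x\<in>A. scaled_coeff (f x) \<mu>)"
  by (simp add: scaled_coeff_def lookup_sum sum_distrib_left)

lemma lookup_Const_mult:
  "Poly_Mapping.lookup (Const c * p) \<mu> = c * Poly_Mapping.lookup p \<mu>"
proof -
  have "Const c * p = Poly_Mapping.map (\<lambda>x. c * x) p"
    unfolding Const_def by (rule mult_map_scale_conv_mult[symmetric])
  then show ?thesis by (simp add: Poly_Mapping.map.rep_eq when_def)
qed

lemma scaled_coeff_Const_mult: "scaled_coeff (Const c * p) \<mu> = c * scaled_coeff p \<mu>"
  by (simp add: scaled_coeff_def lookup_Const_mult)

lemma finite_index_lists [simp]: "finite (index_lists n l)"
  unfolding index_lists_def by (rule finite_subset[OF _ finite_lists_length_eq[of "{..<n}" l]]) auto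

lemma scaled_coeff_row_operator:
  "scaled_coeff (row_operator k n T i p) \<mu> =
     (\<Sum>\<gamma>\<in>index_lists n (k - 1). T (i # \<gamma>) * scaled_coeff p (\<mu> + mono_of (map (Pair i) \<gamma>)))"
  by (simp add: row_operator_def scaled_coeff_sum scaled_coeff_Const_mult scaled_coeff_fold_pdiff)

text \<open>A term in the expansion of the \<open>r\<close>-th power of a row operator: one index
  list for each factor, in order.\<close>

definition row_choices :: "nat \<Rightarrow> nat \<Rightarrow> nat \<Rightarrow> nat list list set" where
  "row_choices k n r = {gs. length gs = r \<and> set gs \<subseteq> index_lists n (k - 1)}"

lemma finite_row_choices [simp]: "finite (row_choices k n r)"
  unfolding row_choices_def
  by (rule finite_subset[OF _ finite_lists_length_eq[of "index_lists n (k - 1)" r]]) auto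

lemma row_choices_Suc:
  "row_choices k n (Suc r) = (\<lambda>(\<gamma>, gs). \<gamma> # gs) ` (index_lists n (k - 1) \<times> row_choices k n r)"
  unfolding row_choices_def by (auto simp: length_Suc_conv image_iff)

text \<open>The indeterminates differentiated by the chosen lists, read as arcs leaving
  \<open>i\<close>.\<close>

definition row_arcs :: "nat \<Rightarrow> nat list list \<Rightarrow> (nat \<times> nat) list" where
  "row_arcs i gs = concat (map (map (Pair i)) gs)"

definition row_weight :: "tensor \<Rightarrow> nat \<Rightarrow> nat list list \<Rightarrow> real" where
  "row_weight T i gs = (\<Prod>\<gamma>\<leftarrow>gs. T (i # \<gamma>))"

lemma scaled_coeff_row_operator_pow:
  "scaled_coeff ((row_operator k n T i ^^ r) p) \<mu> =
     (\<Sum>gs\<in>row_choices k n r. row_weight T i gs * scaled_coeff p (\<mu> + mono_of (row_arcs i gs)))"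
proof (induction r arbitrary: \<mu>)
  case 0
  have "row_choices k n 0 = {[]}" by (auto simp: row_choices_def)
  then show ?case by (simp add: row_weight_def row_arcs_def)
next
  case (Suc r)
  have inj: "inj_on (\<lambda>(\<gamma>, gs). \<gamma> # gs) (index_lists n (k - 1) \<times> row_choices k n r)"
    by (auto simp: inj_on_def)
  show ?case
    by (simp only: row_choices_Suc sum.reindex[OF inj])
      (simp add: scaled_coeff_row_operator Suc o_def sum.cartesian_product sum_distrib_left row_weight_def row_arcs_def case_prod_unfold mult_ac add_ac)
qed

lemma sum_PiE_insert:
  assumes "i \<notin> I"
  shows "(\<Sum>F\<in>PiE (insert i I) B. f F) = (\<Sum>y\<in>B i. \<Sum>F\<in>PiE I B. f (F(i := y)))"
proof -
  have "(\<Sum>F\<in>PiE (insert i I) B. f F) = (\<Sum>(y, F)\<in>B i \<times> PiE I B. f (F(i := y)))"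
    unfolding PiE_insert_eq using assms
    by (subst sum.reindex[OF inj_combinator]) (auto simp: o_def case_prod_unfold)
  then show ?thesis by (simp add: sum.cartesian_product)
qed

definition arcs_of :: "nat list \<Rightarrow> (nat \<Rightarrow> nat list list) \<Rightarrow> (nat \<times> nat) list" where
  "arcs_of is F = concat (map (\<lambda>i. row_arcs i (F i)) is)"

text \<open>Since the rows are distinct, the choices made in them are independent and can be
  collected in one function on the set of rows.\<close>

lemma scaled_coeff_foldr:
  assumes "distinct is"
  shows "scaled_coeff (foldr (\<lambda>i q. Const (c i) * (row_operator k n T i ^^ r i) q) is p) \<mu> =
    (\<Sum>F\<in>PiE (set is) (\<lambda>i. row_choices k n (r i)).
       (\<Prod>i\<in>set is. c i * row_weight T i (F i)) * scaled_coeff p (\<mu> + mono_of (arcs_of is F)))"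
  using assms
proof (induction "is" arbitrary: \<mu>)
  case Nil
  then show ?case by (simp add: arcs_of_def)
next
  case (Cons i "is")
  have arcs: "arcs_of is (F(i := y)) = arcs_of is F" for F y
    using Cons.prems unfolding arcs_of_def by (auto intro!: arg_cong[where f = concat])
  have w: "(\<Prod>j\<in>set is. c j * row_weight T j ((F(i := y)) j)) =
      (\<Prod>j\<in>set is. c j * row_weight T j (F j))" for F y
    using Cons.prems by (intro prod.cong) auto
  have step: "arcs_of (i # is) F = row_arcs i (F i) @ arcs_of is F" for F
    by (simp add: arcs_of_def)
  have "(\<Sum>F\<in>PiE (set (i # is)) (\<lambda>i. row_choices k n (r i)).
       (\<Prod>i\<in>set (i # is). c i * row_weight T i (F i)) * scaled_coeff p (\<mu> + mono_of (arcs_of (i # is) F)))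
     = (\<Sum>y\<in>row_choices k n (r i). \<Sum>F\<in>PiE (set is) (\<lambda>i. row_choices k n (r i)).
        c i * row_weight T i y * (\<Prod>j\<in>set is. c j * row_weight T j (F j)) *
        scaled_coeff p (\<mu> + (mono_of (row_arcs i y) + mono_of (arcs_of is F))))"
    using Cons.prems
    by (simp add: sum_PiE_insert step arcs w del: fun_upd_apply) (simp add: mult_ac)
  also have "\<dots> = scaled_coeff (foldr (\<lambda>i q. Const (c i) * (row_operator k n T i ^^ r i) q) (i # is) p) \<mu>"
    using Cons by (simp add: scaled_coeff_Const_mult scaled_coeff_row_operator_pow sum_distrib_left mult_ac add_ac)
  finally show ?case by simp
qed

section \<open>Walk expansion of the powers of the generic matrix\<close>

lemma zip_snoc_walk: "zip (i # ws @ [j]) (ws @ [j]) = zip (i # ws) ws @ [(last (i # ws), j)]"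
  by (induction ws arbitrary: i) auto

lemma last_index_lists:
  assumes "ws \<in> index_lists n l" "l > 0"
  shows "last ws < n"
proof -
  have "ws \<noteq> []" using assms by (auto simp: index_lists_def)
  then have "last ws \<in> set ws" by simp
  then show ?thesis using assms by (auto simp: index_lists_def)
qed

lemma index_lists_Suc_snoc:
  assumes "j < n"
  shows "{ws \<in> index_lists n (Suc l). last (i # ws) = j} = (\<lambda>ws. ws @ [j]) ` index_lists n l"
proof -
  have "ws \<in> (\<lambda>ws. ws @ [j]) ` index_lists n l"
    if "ws \<in> index_lists n (Suc l)" "last (i # ws) = j" for ws
    using that by (cases ws rule: rev_cases) (auto simp: index_lists_def)
  then show ?thesis using assms by (auto simp: index_lists_def)
qed

text \<open>The list \<open>ws\<close> omits the start \<open>i\<close>, so its length is the number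
  of steps; \<open>last (i # ws)\<close> also covers the empty walk.\<close>

lemma mat_Var_pow:
  assumes "i < n" "j < n"
  shows "(mat n n Var ^\<^sub>m l) $$ (i, j) =
    (\<Sum>ws\<in>{ws \<in> index_lists n l. last (i # ws) = j}. Poly_Mapping.single (mono_of (zip (i # ws) ws)) 1)"
  using assms
proof (induction l arbitrary: j)
  case 0
  have "{ws \<in> index_lists n 0. last (i # ws) = j} = (if i = j then {[]} else {})"
    by (auto simp: index_lists_def)
  then show ?case using 0 by simp
next
  case (Suc l)
  let ?A = "mat n n Var :: mpoly mat"
  have "(?A ^\<^sub>m Suc l) $$ (i, j) = (\<Sum>v<n. (?A ^\<^sub>m l) $$ (i, v) * Var (v, j))"
    using Suc.prems by (simp add: scalar_prod_def atLeast0LessThan)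
  also have "\<dots> = (\<Sum>v<n. \<Sum>ws\<in>{ws \<in> index_lists n l. last (i # ws) = v}.
      Poly_Mapping.single (mono_of (zip (i # ws) ws)) 1 * Var (last (i # ws), j))"
    using Suc by (intro sum.cong) (simp_all add: sum_distrib_right)
  also have "\<dots> = (\<Sum>ws\<in>index_lists n l.
      Poly_Mapping.single (mono_of (zip (i # ws) ws)) 1 * Var (last (i # ws), j))"
    using assms(1) by (intro sum.group finite_index_lists)
      (auto simp: index_lists_def dest!: subsetD[OF _ last_in_set])
  also have "\<dots> = (\<Sum>ws\<in>index_lists n l.
      Poly_Mapping.single (mono_of (zip (i # ws @ [j]) (ws @ [j]))) 1)"
    by (intro sum.cong refl) (simp only: zip_snoc_walk, simp add: Var_def mult_single)
  also have "\<dots> = (\<Sum>ws\<in>(\<lambda>ws. ws @ [j]) ` index_lists n l.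
      Poly_Mapping.single (mono_of (zip (i # ws) ws)) 1)"
    by (subst sum.reindex) (auto simp: inj_on_def)
  also have "(\<lambda>ws. ws @ [j]) ` index_lists n l = {ws \<in> index_lists n (Suc l). last (i # ws) = j}"
    by (rule index_lists_Suc_snoc[OF Suc.prems(2), symmetric])
  finally show ?case .
qed

text \<open>A closed walk is the list of its \<open>l\<close> successive vertices. It starts where
  it ends, hence \<open>last ws\<close> in front. As in a trace, the starting point belongs to the
  walk, so rotations that differ as lists are counted separately.\<close>

definition closed_walks :: "nat \<Rightarrow> nat \<Rightarrow> (nat \<times> nat) multiset \<Rightarrow> nat list set" where
  "closed_walks n l M = {ws \<in> index_lists n l. mset (zip (last ws # ws) ws) = M}"

lemma lookup_trace_power:
  assumes "l > 0"
  shows "Poly_Mapping.lookup (trace_power n l) (mono_of xs) = real (card (closed_walks n l (mset xs)))"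
proof -
  have "trace_power n l = (\<Sum>i<n. \<Sum>ws\<in>{ws \<in> index_lists n l. last ws = i}.
      Poly_Mapping.single (mono_of (zip (last ws # ws) ws)) 1)"
    unfolding trace_power_def
  proof (intro sum.cong refl)
    fix i assume "i \<in> {..<n}"
    then have "(mat n n Var ^\<^sub>m l) $$ (i, i) = (\<Sum>ws\<in>{ws \<in> index_lists n l. last (i # ws) = i}.
        Poly_Mapping.single (mono_of (zip (i # ws) ws)) 1)"
      by (simp add: mat_Var_pow)
    also have "\<dots> = (\<Sum>ws\<in>{ws \<in> index_lists n l. last ws = i}.
        Poly_Mapping.single (mono_of (zip (last ws # ws) ws)) 1)"
      using assms by (intro sum.cong) (auto simp: index_lists_def)
    finally show "(mat n n Var ^\<^sub>m l) $$ (i, i) = \<dots>" .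
  qed
  also have "\<dots> = (\<Sum>ws\<in>index_lists n l. Poly_Mapping.single (mono_of (zip (last ws # ws) ws)) 1)"
    using assms by (intro sum.group) (auto simp: last_index_lists)
  finally have "Poly_Mapping.lookup (trace_power n l) (mono_of xs) =
      (\<Sum>ws\<in>index_lists n l. if mset (zip (last ws # ws) ws) = mset xs then 1 else 0)"
    by (simp add: lookup_sum lookup_single when_def mono_of_eq_iff)
  also have "\<dots> = real (card (closed_walks n l (mset xs)))"
    by (simp add: sum.If_cases closed_walks_def Int_def)
  finally show ?thesis .
qed

text \<open>An arrangement records, for every row i, the index lists chosen from the factors of the
  power of the i-th row operator.\<close>

definition arrangements :: "nat \<Rightarrow> nat \<Rightarrow> nat \<Rightarrow> (nat \<Rightarrow> nat list list) set" where
  "arrangements k n d =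
    {F \<in> {..<n} \<rightarrow>\<^sub>E lists (index_lists n (k - 1)). (\<Sum>i<n. length (F i)) = d}"

definition arcs :: "nat \<Rightarrow> (nat \<Rightarrow> nat list list) \<Rightarrow> (nat \<times> nat) multiset" where
  "arcs n F = (\<Sum>i<n. mset (row_arcs i (F i)))"

definition multiset_fact :: "'a multiset \<Rightarrow> real" where
  "multiset_fact M = (\<Prod>x\<in>set_mset M. fact (count M x))"

text \<open>The part of a term of the trace that does not depend on the tensor: the prefactors of
  the row operators, and the result of differentiating by the monomial of the arcs, which is its
  coefficient in the trace of the matrix power times the factorials of its exponents.\<close>

definition walk_weight :: "nat \<Rightarrow> nat \<Rightarrow> nat \<Rightarrow> (nat \<Rightarrow> nat list list) \<Rightarrow> real" where
  "walk_weight k n d F = (\<Prod>i<n. 1 / fact (length (F i) * (k - 1))) * multiset_fact (arcs n F) *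
     real (card (closed_walks n (d * (k - 1)) (arcs n F)))"

lemma keys_mono_of: "Poly_Mapping.keys (mono_of xs) = set xs"
  by (auto simp: in_keys_iff lookup_mono_of)

lemma monomial_fact_mono_of: "monomial_fact (mono_of xs) = multiset_fact (mset xs)"
  by (simp add: monomial_fact_def multiset_fact_def keys_mono_of lookup_mono_of)

lemma mset_arcs_of: "mset (arcs_of [0..<n] F) = arcs n F"
  by (simp add: arcs_of_def arcs_def mset_concat o_def sum_list_distinct_conv_sum_set
      atLeast0LessThan flip: interv_sum_list_conv_sum_set_nat)

lemma finite_arrangements [simp]: "finite (arrangements k n d)"
proof (rule finite_subset)
  show "arrangements k n d \<subseteq> {..<n} \<rightarrow>\<^sub>E (\<Union>r\<le>d. row_choices k n r)"
  proof
    fix F assume F: "F \<in> arrangements k n d"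
    have "length (F i) \<le> d" if "i < n" for i
      using F that member_le_sum[of i "{..<n}" "\<lambda>i. length (F i)"] by (auto simp: arrangements_def)
    moreover have "set (F i) \<subseteq> index_lists n (k - 1)" if "i < n" for i
      using F that by (auto simp: arrangements_def PiE_iff)
    ultimately show "F \<in> {..<n} \<rightarrow>\<^sub>E (\<Union>r\<le>d. row_choices k n r)"
      using F by (intro PiE_I) (auto simp: arrangements_def row_choices_def PiE_iff extensional_def)
  qed
qed (auto intro!: finite_PiE)

lemma finite_compositions [simp]: "finite (compositions n d)"
proof (rule finite_subset)
  show "compositions n d \<subseteq> {ds. set ds \<subseteq> {..d} \<and> length ds = n}"
    by (auto simp: compositions_def member_le_sum_list)
qed (rule finite_lists_length_eq, simp)

text \<open>The composition that prescribes the orders of the row operators can be recovered from an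
  arrangement as the lengths of its rows. Grouping by it merges the double sum into a single
  one.\<close>

theorem tensor_trace_expansion:
  assumes "k \<ge> 2" "d \<ge> 1"
  shows "tensor_trace k n d T = real ((k - 1) ^ (n - 1)) *
    (\<Sum>F\<in>arrangements k n d. (\<Prod>i<n. row_weight T i (F i)) * walk_weight k n d F)"
proof -
  let ?S = "\<Sum>ds\<in>compositions n d.
        foldr (\<lambda>i q. Const (1 / fact (ds ! i * (k - 1))) * (row_operator k n T i ^^ (ds ! i)) q)
          [0..<n] (trace_power n (d * (k - 1)))"
  let ?w = "\<lambda>F. (\<Prod>i<n. row_weight T i (F i)) * walk_weight k n d F"
  let ?g = "\<lambda>F. map (\<lambda>i. length (F i)) [0..<n]"
  have l: "d * (k - 1) > 0" using assms by simp
  \<comment> \<open>The empty monomial has normalising factor 1.\<close>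
  have "Poly_Mapping.lookup ?S 0 = scaled_coeff ?S 0"
    by (simp add: scaled_coeff_def monomial_fact_def)
  also have "\<dots> = (\<Sum>ds\<in>compositions n d. \<Sum>F\<in>PiE {..<n} (\<lambda>i. row_choices k n (ds ! i)). ?w F)"
    unfolding scaled_coeff_sum
  proof (intro sum.cong refl)
    fix ds assume "ds \<in> compositions n d"
    let ?B = "PiE {..<n} (\<lambda>i. row_choices k n (ds ! i))"
    have *: "(\<Prod>i<n. 1 / fact (ds ! i * (k - 1)) * row_weight T i (F i)) *
        scaled_coeff (trace_power n (d * (k - 1))) (mono_of (arcs_of [0..<n] F)) = ?w F"
      if "F \<in> ?B" for F
    proof -
      have "length (F i) = ds ! i" if "i < n" for i
        using \<open>F \<in> ?B\<close> that by (auto simp: row_choices_def PiE_iff)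
      then have "(\<Prod>i<n. 1 / fact (ds ! i * (k - 1)) :: real) = (\<Prod>i<n. 1 / fact (length (F i) * (k - 1)))"
        by (intro prod.cong) auto
      then show ?thesis
        unfolding scaled_coeff_def lookup_trace_power[OF l] monomial_fact_mono_of mset_arcs_of
          walk_weight_def prod.distrib by simp
    qed
    have "scaled_coeff (foldr (\<lambda>i q. Const (1 / fact (ds ! i * (k - 1))) * (row_operator k n T i ^^ (ds ! i)) q)
          [0..<n] (trace_power n (d * (k - 1)))) 0 =
        (\<Sum>F\<in>PiE (set [0..<n]) (\<lambda>i. row_choices k n (ds ! i)).
          (\<Prod>i\<in>set [0..<n]. 1 / fact (ds ! i * (k - 1)) * row_weight T i (F i)) *
          scaled_coeff (trace_power n (d * (k - 1))) (0 + mono_of (arcs_of [0..<n] F)))"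
      by (rule scaled_coeff_foldr) simp
    also have "\<dots> = (\<Sum>F\<in>?B. ?w F)"
      unfolding set_upt atLeast0LessThan add_0_left by (intro sum.cong refl *)
    finally show "scaled_coeff (foldr (\<lambda>i q. Const (1 / fact (ds ! i * (k - 1))) * (row_operator k n T i ^^ (ds ! i)) q)
          [0..<n] (trace_power n (d * (k - 1)))) 0 = (\<Sum>F\<in>?B. ?w F)" .
  qed
  also have "\<dots> = (\<Sum>ds\<in>compositions n d. \<Sum>F\<in>{F \<in> arrangements k n d. ?g F = ds}. ?w F)"
  proof (intro sum.cong refl)
    fix ds assume ds: "ds \<in> compositions n d"
    have len: "length ds = n" and sum: "(\<Sum>i<n. ds ! i) = d"
      using ds by (auto simp: compositions_def sum_list_sum_nth atLeast0LessThan)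
    show "PiE {..<n} (\<lambda>i. row_choices k n (ds ! i)) = {F \<in> arrangements k n d. ?g F = ds}"
    proof (intro Set.set_eqI iffI)
      fix F assume F: "F \<in> PiE {..<n} (\<lambda>i. row_choices k n (ds ! i))"
      then have "length (F i) = ds ! i" if "i < n" for i
        using that by (auto simp: row_choices_def PiE_iff)
      then show "F \<in> {F \<in> arrangements k n d. ?g F = ds}"
        using F len sum
        by (auto simp: arrangements_def PiE_iff row_choices_def intro!: nth_equalityI)
    next
      fix F assume F: "F \<in> {F \<in> arrangements k n d. ?g F = ds}"
      then have "length (F i) = ds ! i" if "i < n" for i
        using that by auto
      then show "F \<in> PiE {..<n} (\<lambda>i. row_choices k n (ds ! i))"
        using F by (auto simp: arrangements_def PiE_iff row_choices_def)
    qed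
  qed
  also have "\<dots> = (\<Sum>F\<in>arrangements k n d. ?w F)"
    by (intro sum.group finite_arrangements finite_compositions)
      (auto simp: compositions_def arrangements_def sum_list_distinct_conv_sum_set atLeast0LessThan)
  finally show ?thesis unfolding tensor_trace_def by simp
qed

section \<open>Symmetry and positivity of the weights\<close>

lemma count_image_mset_inj:
  assumes "inj f"
  shows "count (image_mset f M) (f x) = count M x"
proof -
  have "f -` {f x} = {x}" using assms by (auto simp: inj_def)
  moreover have "{x} \<inter> set_mset M = (if x \<in># M then {x} else {})" by auto
  ultimately show ?thesis by (simp add: count_image_mset not_in_iff)
qed

lemma multiset_fact_image:
  assumes "inj f"
  shows "multiset_fact (image_mset f M) = multiset_fact M"
  unfolding multiset_fact_def
  by (simp add: prod.reindex inj_on_subset[OF assms] count_image_mset_inj[OF assms])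

lemma closed_walks_image:
  assumes "\<pi> permutes {..<n}"
  shows "closed_walks n l (image_mset (map_prod \<pi> \<pi>) M) = map \<pi> ` closed_walks n l M"
proof -
  have inj: "inj \<pi>" using assms by (rule permutes_inj)
  have inj2: "inj (image_mset (map_prod \<pi> \<pi>))"
    using inj by (intro multiset.inj_map prod.inj_map)
  have zip: "mset (zip (last (map \<pi> ws) # map \<pi> ws) (map \<pi> ws)) =
      image_mset (map_prod \<pi> \<pi>) (mset (zip (last ws # ws) ws))" for ws
  proof (cases "ws = []")
    case False
    then have "last (map \<pi> ws) # map \<pi> ws = map \<pi> (last ws # ws)" by (simp add: last_map)
    then have "zip (last (map \<pi> ws) # map \<pi> ws) (map \<pi> ws) = map (map_prod \<pi> \<pi>) (zip (last ws # ws) ws)"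
      by (simp only: zip_map_map map_prod_def)
    then show ?thesis by simp
  qed simp
  have lists: "map \<pi> ws \<in> index_lists n l \<longleftrightarrow> ws \<in> index_lists n l" for ws
    using permutes_in_image[OF assms] by (auto simp: index_lists_def subset_iff)
  have surj: "\<exists>vs. ws = map \<pi> vs" for ws
    by (rule exI[of _ "map (inv_into UNIV \<pi>) ws"]) (simp add: o_def permutes_inverses[OF assms])
  have "ws \<in> closed_walks n l (image_mset (map_prod \<pi> \<pi>) M) \<longleftrightarrow> ws \<in> map \<pi> ` closed_walks n l M" for ws
  proof -
    obtain vs where vs: "ws = map \<pi> vs" using surj by blast
    have "ws \<in> closed_walks n l (image_mset (map_prod \<pi> \<pi>) M) \<longleftrightarrow> vs \<in> closed_walks n l M"
      unfolding vs closed_walks_def mem_Collect_eq zip lists using inj2 by (auto simp: inj_def)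
    also have "\<dots> \<longleftrightarrow> ws \<in> map \<pi> ` closed_walks n l M"
      unfolding vs using inj by (simp add: inj_image_mem_iff inj_map)
    finally show ?thesis .
  qed
  then show ?thesis by blast
qed

lemma card_closed_walks_image:
  assumes "\<pi> permutes {..<n}"
  shows "card (closed_walks n l (image_mset (map_prod \<pi> \<pi>) M)) = card (closed_walks n l M)"
  unfolding closed_walks_image[OF assms]
  by (rule card_image[OF inj_on_subset[OF inj_mapI[OF permutes_inj[OF assms]] subset_UNIV]])

text \<open>The action of a vertex permutation on arrangements: rows and entries move together.
  Restricting to \<open>{..<n}\<close> keeps the result extensional, as \<open>arrangements\<close>
  demands.\<close>

definition relabel :: "nat \<Rightarrow> (nat \<Rightarrow> nat) \<Rightarrow> (nat \<Rightarrow> nat list list) \<Rightarrow> nat \<Rightarrow> nat list list" where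
  "relabel n \<pi> F = (\<lambda>i\<in>{..<n}. map (map \<pi>) (F (inv_into UNIV \<pi> i)))"

lemma relabel_apply:
  assumes "\<pi> permutes {..<n}" "i < n"
  shows "relabel n \<pi> F (\<pi> i) = map (map \<pi>) (F i)"
  using assms permutes_in_image[OF assms(1), of i] by (simp add: relabel_def permutes_inverses)

lemma relabel_inverse:
  assumes "\<pi> permutes {..<n}" "F \<in> arrangements k n d"
  shows "relabel n (inv_into UNIV \<pi>) (relabel n \<pi> F) = F"
proof
  fix i
  have "inv_into UNIV \<pi> permutes {..<n}" using assms(1) by (rule permutes_inv)
  have inv: "inv_into UNIV (inv_into UNIV \<pi>) = \<pi>" using permutes_bij[OF assms(1)] by (rule inv_inv_eq)
  show "relabel n (inv_into UNIV \<pi>) (relabel n \<pi> F) i = F i"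
  proof (cases "i < n")
    case True
    then have "relabel n (inv_into UNIV \<pi>) (relabel n \<pi> F) i = map (map (inv_into UNIV \<pi>)) (map (map \<pi>) (F i))"
      using relabel_apply[OF assms(1) True] by (simp add: relabel_def[of n "inv_into UNIV \<pi>"] inv)
    then show ?thesis by (simp add: o_def permutes_inverses[OF assms(1)])
  next
    case False
    then have "F i = undefined" using assms(2) by (auto simp: arrangements_def PiE_iff extensional_def)
    then show ?thesis using False by (simp add: relabel_def)
  qed
qed

lemma sum_relabel_length:
  assumes "\<pi> permutes {..<n}"
  shows "(\<Sum>i<n. length (relabel n \<pi> F i)) = (\<Sum>i<n. length (F i))"
  by (subst sum.permute[OF assms]) (simp add: relabel_apply[OF assms])

lemma relabel_arrangements:
  assumes "\<pi> permutes {..<n}" "F \<in> arrangements k n d"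
  shows "relabel n \<pi> F \<in> arrangements k n d"
proof -
  have "relabel n \<pi> F \<in> {..<n} \<rightarrow>\<^sub>E lists (index_lists n (k - 1))"
  proof (rule PiE_I)
    fix i assume i: "i \<in> {..<n}"
    then have "inv_into UNIV \<pi> i < n" using permutes_in_image[OF permutes_inv[OF assms(1)]] by simp
    then have "F (inv_into UNIV \<pi> i) \<in> lists (index_lists n (k - 1))"
      using assms(2) by (auto simp: arrangements_def PiE_iff)
    then show "relabel n \<pi> F i \<in> lists (index_lists n (k - 1))"
      using i permutes_in_image[OF assms(1)]
      by (auto simp: relabel_def index_lists_def lists_eq_set subset_iff)
  qed (simp add: relabel_def)
  then show ?thesis using assms(2) sum_relabel_length[OF assms(1)] by (simp add: arrangements_def)
qed

lemma row_arcs_map: "row_arcs (\<pi> i) (map (map \<pi>) gs) = map (map_prod \<pi> \<pi>) (row_arcs i gs)"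
  by (induction gs) (auto simp: row_arcs_def)

lemma image_mset_sum: "finite A \<Longrightarrow> image_mset f (\<Sum>x\<in>A. g x) = (\<Sum>x\<in>A. image_mset f (g x))"
  by (induction A rule: finite_induct) auto

lemma arcs_relabel:
  assumes "\<pi> permutes {..<n}"
  shows "arcs n (relabel n \<pi> F) = image_mset (map_prod \<pi> \<pi>) (arcs n F)"
proof -
  have "arcs n (relabel n \<pi> F) = (\<Sum>i<n. mset (row_arcs (\<pi> i) (relabel n \<pi> F (\<pi> i))))"
    unfolding arcs_def by (subst sum.permute[OF assms]) (simp add: o_def)
  also have "\<dots> = (\<Sum>i<n. image_mset (map_prod \<pi> \<pi>) (mset (row_arcs i (F i))))"
    by (intro sum.cong refl) (simp add: relabel_apply[OF assms] row_arcs_map)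
  finally show ?thesis by (simp add: arcs_def image_mset_sum)
qed

lemma walk_weight_relabel:
  assumes "\<pi> permutes {..<n}"
  shows "walk_weight k n d (relabel n \<pi> F) = walk_weight k n d F"
proof -
  have inj: "inj (map_prod \<pi> \<pi>)" using permutes_inj[OF assms] by (intro prod.inj_map)
  have "(\<Prod>i<n. 1 / fact (length (relabel n \<pi> F i) * (k - 1)) :: real) =
      (\<Prod>i<n. 1 / fact (length (F i) * (k - 1)))"
    by (subst prod.permute[OF assms]) (simp add: relabel_apply[OF assms])
  then show ?thesis
    unfolding walk_weight_def arcs_relabel[OF assms] multiset_fact_image[OF inj]
      card_closed_walks_image[OF assms] by simp
qed

text \<open>The pieces \<open>K\<close>, \<open>e - K\<close> and the complement of \<open>e\<close>
  have equal sizes on both sides, so bijections between them glue to a permutation.\<close>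

lemma exists_permutation:
  assumes "e \<subseteq> {..<n}" "e' \<subseteq> {..<n}" "card e = card e'" "K \<subseteq> e" "K' \<subseteq> e'" "card K = card K'"
  shows "\<exists>\<pi>. \<pi> permutes {..<n::nat} \<and> \<pi> ` e = e' \<and> \<pi> ` K = K'"
proof -
  have fin: "finite e" "finite e'" "finite K" "finite K'"
    using assms by (meson finite_lessThan finite_subset)+
  obtain f where f: "bij_betw f K K'" using finite_same_card_bij[OF fin(3,4) assms(6)] by blast
  have "card (e - K) = card (e' - K')"
    using assms fin by (simp add: card_Diff_subset)
  then obtain g where g: "bij_betw g (e - K) (e' - K')"
    using fin finite_same_card_bij[of "e - K" "e' - K'"] by auto
  have "card ({..<n} - e) = card ({..<n} - e')"
    using assms fin by (simp add: card_Diff_subset)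
  then obtain h where h: "bij_betw h ({..<n} - e) ({..<n} - e')"
    using finite_same_card_bij[of "{..<n} - e" "{..<n} - e'"] by auto
  define \<pi> where "\<pi> = (\<lambda>i. if i \<in> K then f i else if i \<in> e then g i else if i < n then h i else i)"
  have 1: "bij_betw \<pi> K K'" using f by (subst bij_betw_cong[of _ _ f]) (auto simp: \<pi>_def)
  have 2: "bij_betw \<pi> (e - K) (e' - K')" using g by (subst bij_betw_cong[of _ _ g]) (auto simp: \<pi>_def)
  have 3: "bij_betw \<pi> ({..<n} - e) ({..<n} - e')"
    using h assms(4) by (subst bij_betw_cong[of _ _ h]) (auto simp: \<pi>_def)
  have "bij_betw \<pi> (K \<union> (e - K)) (K' \<union> (e' - K'))" by (rule bij_betw_combine[OF 1 2]) auto
  then have 4: "bij_betw \<pi> e e'" using assms(4,5) by (simp add: Un_absorb1)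
  have "bij_betw \<pi> (e \<union> ({..<n} - e)) (e' \<union> ({..<n} - e'))" by (rule bij_betw_combine[OF 4 3]) auto
  then have "bij_betw \<pi> {..<n} {..<n}" using assms(1,2) by (simp add: Un_absorb1)
  then have "\<pi> permutes {..<n}"
    using assms(1,4) by (intro bij_imp_permutes) (auto simp: \<pi>_def)
  then show ?thesis using 1 4 by (auto simp: bij_betw_def)
qed

text \<open>In row \<open>u\<close> the constant list is the index of the diagonal entry at
  \<open>u\<close>; each occurrence contributes \<open>k - 1\<close> arcs from \<open>u\<close> to
  itself.\<close>

definition loops :: "nat \<Rightarrow> (nat \<Rightarrow> nat list list) \<Rightarrow> nat \<Rightarrow> nat" where
  "loops k F u = length (filter (\<lambda>\<gamma>. \<gamma> = replicate (k - 1) u) (F u))"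

text \<open>For a hyperedge with \<open>k\<close> vertices and lists of length \<open>k - 1\<close>,
  the condition says that \<open>u # \<gamma>\<close> is some ordering of the hyperedge, the index
  of an adjacency entry.\<close>

definition hits :: "nat set \<Rightarrow> (nat \<Rightarrow> nat list list) \<Rightarrow> nat \<Rightarrow> nat" where
  "hits e F u = length (filter (\<lambda>\<gamma>. set (u # \<gamma>) = e) (F u))"

text \<open>The hyperedge e is used once at each of its vertices; K collects the vertices at which
  diagonal entries occur, possibly repeatedly.\<close>

definition edge_arrangements :: "nat \<Rightarrow> nat \<Rightarrow> nat \<Rightarrow> nat set \<Rightarrow> nat set \<Rightarrow> (nat \<Rightarrow> nat list list) set" where
  "edge_arrangements k n d e K = {F \<in> arrangements k n d.
     (\<forall>u<n. hits e F u = (if u \<in> e then 1 else 0) \<and> length (F u) = loops k F u + hits e F u) \<and>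
     {u. u < n \<and> loops k F u > 0} = K}"

lemma finite_edge_arrangements [simp]: "finite (edge_arrangements k n d e K)"
  by (rule finite_subset[OF _ finite_arrangements]) (auto simp: edge_arrangements_def)

definition edge_weight :: "nat \<Rightarrow> nat \<Rightarrow> nat \<Rightarrow> nat set \<Rightarrow> nat set \<Rightarrow> real" where
  "edge_weight k n d e K = (\<Sum>F\<in>edge_arrangements k n d e K. walk_weight k n d F)"

lemma loops_relabel:
  assumes "\<pi> permutes {..<n}" "u < n"
  shows "loops k (relabel n \<pi> F) (\<pi> u) = loops k F u"
proof -
  have "map \<pi> \<gamma> = replicate (k - 1) (\<pi> u) \<longleftrightarrow> \<gamma> = replicate (k - 1) u" for \<gamma>
    using inj_map_eq_map[OF permutes_inj[OF assms(1)], of \<gamma> "replicate (k - 1) u"] by simp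
  then show ?thesis
    unfolding loops_def relabel_apply[OF assms] by (simp add: filter_map o_def)
qed

lemma hits_relabel:
  assumes "\<pi> permutes {..<n}" "u < n"
  shows "hits (\<pi> ` e) (relabel n \<pi> F) (\<pi> u) = hits e F u"
proof -
  have "set (\<pi> u # map \<pi> \<gamma>) = \<pi> ` e \<longleftrightarrow> set (u # \<gamma>) = e" for \<gamma>
    using inj_image_eq_iff[OF permutes_inj[OF assms(1)], of "set (u # \<gamma>)" e] by simp
  then show ?thesis
    unfolding hits_def relabel_apply[OF assms] by (simp add: filter_map o_def)
qed

lemma relabel_edge_arrangements:
  assumes "\<pi> permutes {..<n}" "F \<in> edge_arrangements k n d e K"
  shows "relabel n \<pi> F \<in> edge_arrangements k n d (\<pi> ` e) (\<pi> ` K)"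
proof -
  have F: "F \<in> arrangements k n d" and
    hit: "\<And>u. u < n \<Longrightarrow> hits e F u = (if u \<in> e then 1 else 0) \<and> length (F u) = loops k F u + hits e F u" and
    K: "{u. u < n \<and> loops k F u > 0} = K"
    using assms(2) by (auto simp: edge_arrangements_def)
  have img: "\<exists>u<n. v = \<pi> u" if "v < n" for v
    using that permutes_image[OF assms(1)] by (metis imageE lessThan_iff)
  have inj: "inj \<pi>" by (rule permutes_inj[OF assms(1)])
  have "hits (\<pi> ` e) (relabel n \<pi> F) v = (if v \<in> \<pi> ` e then 1 else 0) \<and>
      length (relabel n \<pi> F v) = loops k (relabel n \<pi> F) v + hits (\<pi> ` e) (relabel n \<pi> F) v"
    if "v < n" for v
  proof -
    obtain u where u: "u < n" "v = \<pi> u" using img \<open>v < n\<close> by blast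
    show ?thesis unfolding u(2) hits_relabel[OF assms(1) u(1)] loops_relabel[OF assms(1) u(1)]
      using hit[OF u(1)] inj by (simp add: relabel_apply[OF assms(1) u(1)] inj_image_mem_iff)
  qed
  moreover have "{v. v < n \<and> loops k (relabel n \<pi> F) v > 0} = \<pi> ` K"
  proof (intro Set.set_eqI iffI)
    fix v assume v: "v \<in> {v. v < n \<and> loops k (relabel n \<pi> F) v > 0}"
    then obtain u where u: "u < n" "v = \<pi> u" using img by blast
    then show "v \<in> \<pi> ` K" using v K loops_relabel[OF assms(1) u(1)] by auto
  next
    fix v assume "v \<in> \<pi> ` K"
    then obtain u where u: "u < n" "loops k F u > 0" "v = \<pi> u" using K by auto
    then show "v \<in> {v. v < n \<and> loops k (relabel n \<pi> F) v > 0}"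
      using loops_relabel[OF assms(1) u(1)] permutes_in_image[OF assms(1)] by auto
  qed
  ultimately show ?thesis
    using relabel_arrangements[OF assms(1) F] by (simp add: edge_arrangements_def)
qed

text \<open>Relabelling is a bijection of the arrangements that preserves
  \<open>walk_weight\<close>, with relabelling by the inverse permutation as its inverse.\<close>

lemma edge_weight_permute:
  assumes "\<pi> permutes {..<n}"
  shows "edge_weight k n d (\<pi> ` e) (\<pi> ` K) = edge_weight k n d e K"
  unfolding edge_weight_def
proof (rule sum.reindex_bij_witness[where i = "relabel n \<pi>" and j = "relabel n (inv_into UNIV \<pi>)"])
  note inv = permutes_inv[OF assms]
  have ii: "inv_into UNIV (inv_into UNIV \<pi>) = \<pi>" using permutes_bij[OF assms] by (rule inv_inv_eq)
  have im: "inv_into UNIV \<pi> ` \<pi> ` A = A" for A by (simp add: image_image permutes_inverses[OF assms])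
  have sub: "F \<in> arrangements k n d" if "F \<in> edge_arrangements k n d e K" for F e K
    using that by (simp add: edge_arrangements_def)
  fix F
  show "relabel n \<pi> F \<in> edge_arrangements k n d (\<pi> ` e) (\<pi> ` K)" if "F \<in> edge_arrangements k n d e K"
    by (rule relabel_edge_arrangements[OF assms that])
  show "relabel n (inv_into UNIV \<pi>) (relabel n \<pi> F) = F" if "F \<in> edge_arrangements k n d e K"
    by (rule relabel_inverse[OF assms sub[OF that]])
  show "relabel n (inv_into UNIV \<pi>) F \<in> edge_arrangements k n d e K" if "F \<in> edge_arrangements k n d (\<pi> ` e) (\<pi> ` K)"
    using relabel_edge_arrangements[OF inv that] by (simp add: im)
  show "relabel n \<pi> (relabel n (inv_into UNIV \<pi>) F) = F" if "F \<in> edge_arrangements k n d (\<pi> ` e) (\<pi> ` K)"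
    using relabel_inverse[OF inv sub[OF that]] by (simp add: ii)
  show "walk_weight k n d (relabel n (inv_into UNIV \<pi>) F) = walk_weight k n d F"
    by (rule walk_weight_relabel[OF inv])
qed

text \<open>The two sizes are the only invariants of a nested pair under permutations. Hence the
  coefficients in the moments depend neither on the hyperedge nor on the hypertree beyond its number
  of vertices.\<close>

lemma edge_weight_eq:
  assumes "e \<subseteq> {..<n}" "e' \<subseteq> {..<n}" "card e = card e'" "K \<subseteq> e" "K' \<subseteq> e'" "card K = card K'"
  shows "edge_weight k n d e K = edge_weight k n d e' K'"
proof -
  obtain \<pi> where \<pi>: "\<pi> permutes {..<n}" "\<pi> ` e = e'" "\<pi> ` K = K'"
    using exists_permutation[OF assms] by blast
  show ?thesis using edge_weight_permute[OF \<pi>(1), of k d e K] unfolding \<pi>(2,3) by (rule sym)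
qed

lemma walk_weight_nonneg: "walk_weight k n d F \<ge> 0"
  unfolding walk_weight_def multiset_fact_def by (simp add: prod_nonneg)

lemma edge_weight_nonneg: "edge_weight k n d e K \<ge> 0"
  unfolding edge_weight_def by (intro sum_nonneg walk_weight_nonneg)

section \<open>Positivity through closed Eulerian walks\<close>

lemma finite_closed_walks [simp]: "finite (closed_walks n l M)"
  by (rule finite_subset[OF _ finite_index_lists]) (auto simp: closed_walks_def)

lemma walk_weight_pos:
  assumes "closed_walks n (d * (k - 1)) (arcs n F) \<noteq> {}"
  shows "walk_weight k n d F > 0"
  unfolding walk_weight_def multiset_fact_def using assms
  by (intro mult_pos_pos prod_pos) (auto simp: card_gt_0_iff)

text \<open>Existence of a closed walk that uses each arc exactly as often as \<open>M\<close>
  contains it. Its length is the size of \<open>M\<close> and is therefore left out.\<close>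

definition traversable :: "nat \<Rightarrow> (nat \<times> nat) multiset \<Rightarrow> bool" where
  "traversable n M \<longleftrightarrow> (\<exists>ws. ws \<noteq> [] \<and> set ws \<subseteq> {..<n} \<and> mset (zip (last ws # ws) ws) = M)"

lemma zip_walk_append:
  "mset (zip (i # xs @ ys) (xs @ ys)) = mset (zip (i # xs) xs) + mset (zip (last (i # xs) # ys) ys)"
  by (induction xs arbitrary: i) auto

text \<open>Being the head of an arc puts \<open>v\<close> on the walk, and the closed detour
  \<open>zs\<close> from \<open>v\<close> back to \<open>v\<close> is inserted right after a visit
  of \<open>v\<close>. No rotation of the walk is needed.\<close>

lemma traversable_splice:
  assumes "traversable n M" "v \<in> snd ` set_mset M" "set zs \<subseteq> {..<n}" "zs \<noteq> []" "last zs = v"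
  shows "traversable n (M + mset (zip (v # zs) zs))"
proof -
  obtain ws where ws: "ws \<noteq> []" "set ws \<subseteq> {..<n}" "mset (zip (last ws # ws) ws) = M"
    using assms(1) by (auto simp: traversable_def)
  have "v \<in> set ws" using assms(2) unfolding ws(3)[symmetric] by (auto dest: set_zip_rightD)
  then obtain xs ys where xy: "ws = (xs @ [v]) @ ys" by (metis append.assoc append_Cons append_Nil split_list)
  let ?i = "last ws" and ?ws = "(xs @ [v]) @ zs @ ys"
  \<comment> \<open>If the visit of \<open>v\<close> was the final one, the detour ends there as
    well, so the start of the closed walk is unchanged.\<close>
  have last: "last ?ws = ?i" using assms(4,5) by (cases "ys = []") (auto simp: xy)
  have "mset (zip (?i # ?ws) ?ws) =
      mset (zip (?i # xs @ [v]) (xs @ [v])) + (mset (zip (v # zs) zs) + mset (zip (v # ys) ys))"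
    using zip_walk_append[of ?i "xs @ [v]" "zs @ ys"] zip_walk_append[of v zs ys] assms(4,5) by simp
  also have "\<dots> = M + mset (zip (v # zs) zs)"
    unfolding ws(3)[symmetric] using zip_walk_append[of ?i "xs @ [v]" ys] by (simp add: xy)
  finally show ?thesis unfolding traversable_def using last ws(2) assms(3)
    by (intro exI[of _ ?ws]) (auto simp: xy)
qed

lemma traversable_add_loops:
  assumes "traversable n M" "v \<in> snd ` set_mset M" "v < n"
  shows "traversable n (M + replicate_mset r (v, v))"
proof (induction r)
  case (Suc r)
  have "traversable n (M + replicate_mset r (v, v) + mset (zip (v # [v]) [v]))"
    using assms Suc by (intro traversable_splice) auto
  then show ?case by simp
qed (use assms in simp)

lemma traversable_add_detour:
  assumes "traversable n M" "v \<in> snd ` set_mset M" "v < n" "w < n"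
  shows "traversable n (add_mset (v, w) (add_mset (w, v) M))"
  using traversable_splice[OF assms(1,2), of "[w, v]"] assms(3,4) by simp

text \<open>The complete digraph on \<open>{..<w}\<close> with, in addition, both arcs between
  \<open>w\<close> and each vertex below \<open>j\<close>. The second parameter allows adding one
  pair of opposite arcs at a time; for \<open>w = j = k - 1\<close> this is the complete digraph on
  \<open>{..<k}\<close>.\<close>

definition complete_arcs :: "nat \<Rightarrow> nat \<Rightarrow> (nat \<times> nat) set" where
  "complete_arcs w j = {(a, b). a \<noteq> b \<and> (a < w \<and> b < w \<or> a = w \<and> b < j \<or> b = w \<and> a < j)}"

lemma finite_complete_arcs [simp]: "finite (complete_arcs w j)"
  by (rule finite_subset[of _ "{..w + j} \<times> {..w + j}"]) (auto simp: complete_arcs_def)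

text \<open>Each new pair of opposite arcs is a detour from \<open>j\<close> to the new vertex and
  back. The loops at 0 provide a nonempty walk to begin with.\<close>

lemma traversable_complete:
  assumes "w < n" "j \<le> w" "r > 0"
  shows "traversable n (mset_set (complete_arcs w j) + replicate_mset r (0, 0))"
  using assms(1,2)
proof (induction w arbitrary: j)
  case 0
  have none: "complete_arcs 0 j = {}" using 0 by (auto simp: complete_arcs_def)
  have "traversable n {#(0, 0)#}" unfolding traversable_def using 0 by (intro exI[of _ "[0]"]) auto
  then have "traversable n ({#(0, 0)#} + replicate_mset (r - 1) (0, 0))"
    using 0 by (intro traversable_add_loops) auto
  also have "{#(0, 0)#} + replicate_mset (r - 1) (0, 0) = replicate_mset r (0::nat, 0::nat)"
    using assms(3) by (cases r) auto
  finally show ?case by (simp add: none)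
next
  case (Suc w)
  from Suc.prems(2) show ?case
  proof (induction j)
    case 0
    have "complete_arcs (Suc w) 0 = complete_arcs w w" by (auto simp: complete_arcs_def)
    then show ?case using Suc.IH[of w] Suc.prems by simp
  next
    case (Suc j)
    let ?M = "mset_set (complete_arcs (Suc w) j) + replicate_mset r (0, 0)"
    have j: "j < Suc w" "Suc w < n" using Suc.prems \<open>Suc w < n\<close> by auto
    \<comment> \<open>The detour needs a walk through \<open>j\<close>: vertex 0 is the head of a
      loop, and any other \<open>j\<close> is the head of the arc from 0 that is already
      present.\<close>
    have "j \<in> snd ` set_mset ?M"
    proof (cases "j = 0")
      case True
      then show ?thesis using assms(3) by force
    next
      case False
      then have "(0, j) \<in> complete_arcs (Suc w) j" using j by (auto simp: complete_arcs_def)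
      then show ?thesis by force
    qed
    then have "traversable n (add_mset (j, Suc w) (add_mset (Suc w, j) ?M))"
      using Suc.IH j by (intro traversable_add_detour) auto
    moreover have "complete_arcs (Suc w) (Suc j) =
        insert (j, Suc w) (insert (Suc w, j) (complete_arcs (Suc w) j))"
      using j by (auto simp: complete_arcs_def)
    moreover have "(j, Suc w) \<notin> insert (Suc w, j) (complete_arcs (Suc w) j)"
      "(Suc w, j) \<notin> complete_arcs (Suc w) j"
      using j by (auto simp: complete_arcs_def)
    ultimately show ?case by simp
  qed
qed

lemma count_arcs:
  "count (arcs n F) (a, b) = (if a < n then \<Sum>\<gamma>\<leftarrow>F a. count (mset \<gamma>) b else 0)"
proof -
  have row: "count (mset (row_arcs i gs)) (a, b) = (if a = i then \<Sum>\<gamma>\<leftarrow>gs. count (mset \<gamma>) b else 0)" for i gs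
  proof (induction gs)
    case (Cons \<gamma> gs)
    have "count (mset (map (Pair i) \<gamma>)) (a, b) = (if a = i then count (mset \<gamma>) b else 0)"
      by (induction \<gamma>) auto
    then show ?case using Cons by (simp add: row_arcs_def)
  qed (simp add: row_arcs_def)
  have "count (arcs n F) (a, b) = (\<Sum>i<n. if a = i then \<Sum>\<gamma>\<leftarrow>F i. count (mset \<gamma>) b else 0)"
    by (simp add: arcs_def count_sum row)
  then show ?thesis by simp
qed

lemma size_arcs:
  assumes "F \<in> arrangements k n d"
  shows "size (arcs n F) = d * (k - 1)"
proof -
  have row: "size (mset (row_arcs i (F i))) = length (F i) * (k - 1)" if "i < n" for i
  proof -
    have "\<forall>\<gamma>\<in>set (F i). length \<gamma> = k - 1"
      using assms that by (auto simp: arrangements_def PiE_iff index_lists_def)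
    then have "(\<Sum>\<gamma>\<leftarrow>F i. length \<gamma>) = (\<Sum>\<gamma>\<leftarrow>F i. k - 1)" by (metis (no_types, lifting) map_eq_conv)
    then show ?thesis by (simp add: row_arcs_def length_concat o_def sum_list_triv)
  qed
  have "size (arcs n F) = (\<Sum>i<n. size (mset (row_arcs i (F i))))"
    unfolding arcs_def by (induction n) auto
  also have "\<dots> = (\<Sum>i<n. length (F i) * (k - 1))" using row by (intro sum.cong) auto
  also have "\<dots> = d * (k - 1)" using assms by (simp add: arrangements_def flip: sum_distrib_right)
  finally show ?thesis .
qed

text \<open>No arrangement has negative weight, so one arrangement that admits a closed walk
  suffices.\<close>

lemma edge_weight_pos:
  assumes "k \<ge> 2" "k \<le> n"
  shows "edge_weight k n (k + 2) {..<k} {0, 1} > 0"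
proof -
  \<comment> \<open>Every vertex of the hyperedge lists the others in increasing order, and 0 and 1
    get one diagonal entry each. The arcs are those of the complete digraph on \<open>{..<k}\<close>
    and \<open>k - 1\<close> loops at each of 0 and 1.\<close>
  let ?\<gamma> = "\<lambda>u. filter (\<lambda>v. v \<noteq> u) [0..<k]"
  define F where "F = (\<lambda>u\<in>{..<n}. if u < k then (if u < 2 then [?\<gamma> u, replicate (k - 1) u] else [?\<gamma> u]) else [])"
  have card: "length (?\<gamma> u) = k - 1" if "u < k" for u
  proof -
    have "length (?\<gamma> u) = card (set (?\<gamma> u))" by (rule distinct_card[symmetric]) simp
    also have "set (?\<gamma> u) = {..<k} - {u}" by auto
    finally show ?thesis using that by simp
  qed
  have len: "length (F u) = (if u < k then if u < 2 then 2 else 1 else 0)" if "u < n" for u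
    using that by (simp add: F_def)
  have two: "(\<Sum>u<n. length (F u)) = k + 2"
  proof -
    have "(\<Sum>u<n. length (F u)) = (\<Sum>u<n. (if u < k then 1 else 0) + (if u < 2 then 1 else 0))"
      using assms by (intro sum.cong refl) (auto simp: len)
    also have "\<dots> = card ({..<n} \<inter> {u. u < k}) + card ({..<n} \<inter> {u. u < 2})"
      by (simp add: sum.distrib sum.If_cases)
    also have "{..<n} \<inter> {u. u < k} = {..<k}" using assms by auto
    also have "{..<n} \<inter> {u. u < 2} = {..<2}" using assms by auto
    finally show ?thesis by simp
  qed
  have set_rep: "set (replicate (k - 1) u) = {u}" for u using assms by simp
  have arr: "F \<in> arrangements k n (k + 2)"
    unfolding arrangements_def
  proof (intro CollectI conjI two PiE_I)
    fix u assume "u \<in> {..<n}"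
    then show "F u \<in> lists (index_lists n (k - 1))"
      using assms card[of u] set_rep[of u] by (auto simp: F_def index_lists_def)
  qed (simp add: F_def)
  have ne: "?\<gamma> u \<noteq> replicate (k - 1) u" if "u < k" for u
  proof
    assume "?\<gamma> u = replicate (k - 1) u"
    then have "u \<in> set (?\<gamma> u)" using set_rep[of u] by simp
    then show False by simp
  qed
  have full: "insert u (set (?\<gamma> u)) = {..<k}" if "u < k" for u using that by auto
  have single: "{u} \<noteq> {..<k}" for u
  proof
    assume "{u} = {..<k}"
    then have "card {u} = card {..<k}" by simp
    then show False using assms by simp
  qed
  have loop: "loops k F u = (if u < 2 then 1 else 0)" if "u < n" for u
    using that assms ne[of u] by (auto simp: loops_def F_def)
  have hit: "hits {..<k} F u = (if u \<in> {..<k} then 1 else 0)" if "u < n" for u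
    using that assms full[of u] single[of u] set_rep[of u] by (auto simp: hits_def F_def)
  have "{u. u < n \<and> loops k F u > 0} = {0, 1}" using assms loop by (auto split: if_splits)
  then have mem: "F \<in> edge_arrangements k n (k + 2) {..<k} {0, 1}"
    unfolding edge_arrangements_def using arr hit loop len assms by auto
  \<comment> \<open>The loops at 0 start the walk through the complete digraph; the loops at 1 are
    spliced in afterwards.\<close>
  let ?M = "mset_set (complete_arcs (k - 1) (k - 1)) + replicate_mset (k - 1) (0, 0)"
  have "arcs n F = ?M + replicate_mset (k - 1) (1, 1)"
  proof (rule multiset_eqI)
    fix x :: "nat \<times> nat"
    obtain a b where x: "x = (a, b)" by fastforce
    have c1: "count (mset (?\<gamma> a)) b = (if b < k \<and> b \<noteq> a then 1 else 0)"
    proof -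
      have "mset (?\<gamma> a) = mset_set (set (?\<gamma> a))" by (rule mset_set_set[symmetric]) simp
      then show ?thesis by (simp add: count_mset_set')
    qed
    have c2: "count (mset (replicate (k - 1) a)) b = (if a = b then k - 1 else 0)" by simp
    have c3: "count (mset_set (complete_arcs (k - 1) (k - 1))) (a, b) =
        (if a < k \<and> b < k \<and> a \<noteq> b then 1 else 0)"
    proof -
      obtain p where "k = Suc p" using assms by (cases k) auto
      then have "(a, b) \<in> complete_arcs (k - 1) (k - 1) \<longleftrightarrow> a < k \<and> b < k \<and> a \<noteq> b"
        by (auto simp: complete_arcs_def less_Suc_eq)
      then show ?thesis by (simp add: count_mset_set')
    qed
    have Fa: "(\<Sum>\<gamma>\<leftarrow>F a. count (mset \<gamma>) b) =
        (if a < k \<and> b < k \<and> a \<noteq> b then 1 else 0) + (if a < 2 \<and> a = b then k - 1 else 0)" if "a < n"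
    proof -
      consider "\<not> a < k" | "a < k" "\<not> a < 2" | "a < k" "a < 2" by blast
      then show ?thesis
      proof cases
        case 1
        then have "\<not> a < 2" using assms by simp
        then show ?thesis using 1 that by (simp add: F_def)
      next
        case 2
        then show ?thesis using that c1 by (simp add: F_def)
      next
        case 3
        then have "(\<Sum>\<gamma>\<leftarrow>F a. count (mset \<gamma>) b) = count (mset (?\<gamma> a)) b + count (mset (replicate (k - 1) a)) b"
          using that by (simp add: F_def)
        then show ?thesis unfolding c1 c2 using 3 by simp
      qed
    qed
    have rep: "count (replicate_mset (k - 1) (0::nat, 0::nat)) (a, b) + count (replicate_mset (k - 1) (1::nat, 1::nat)) (a, b) =
        (if a < 2 \<and> a = b then k - 1 else 0)"
      by (auto simp: less_2_cases_iff)
    have "count (?M + replicate_mset (k - 1) (1, 1)) (a, b) =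
        (if a < k \<and> b < k \<and> a \<noteq> b then 1 else 0) + (if a < 2 \<and> a = b then k - 1 else 0)"
      using c3 rep by simp
    then show "count (arcs n F) x = count (?M + replicate_mset (k - 1) (1, 1)) x"
      unfolding x count_arcs using assms Fa by (cases "a < n") auto
  qed
  moreover have "traversable n ?M" using assms by (intro traversable_complete) auto
  moreover have "(0, 1) \<in> complete_arcs (k - 1) (k - 1)" using assms by (auto simp: complete_arcs_def)
  then have "(0, 1) \<in># ?M" by simp
  then have "1 \<in> snd ` set_mset ?M" by (metis imageI snd_conv)
  moreover have "1 < n" using assms by simp
  ultimately have "traversable n (arcs n F)" by (metis traversable_add_loops)
  then obtain ws where ws: "set ws \<subseteq> {..<n}" "mset (zip (last ws # ws) ws) = arcs n F"
    by (auto simp: traversable_def)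
  have "length ws = size (mset (zip (last ws # ws) ws))" by simp
  also have "\<dots> = (k + 2) * (k - 1)" unfolding ws(2) by (rule size_arcs[OF arr])
  finally have "ws \<in> closed_walks n ((k + 2) * (k - 1)) (arcs n F)"
    using ws by (simp add: closed_walks_def index_lists_def)
  then have "0 < walk_weight k n (k + 2) F" by (intro walk_weight_pos) blast
  also have "\<dots> \<le> edge_weight k n (k + 2) {..<k} {0, 1}"
    unfolding edge_weight_def using mem by (intro member_le_sum walk_weight_nonneg) auto
  finally show ?thesis .
qed

section \<open>Arrangements of diagonal entries at one vertex\<close>

definition diagonal_arrangement :: "nat \<Rightarrow> nat \<Rightarrow> nat \<Rightarrow> nat \<Rightarrow> nat \<Rightarrow> nat list list" where
  "diagonal_arrangement k n d c = (\<lambda>i\<in>{..<n}. if i = c then replicate d (replicate (k - 1) c) else [])"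

lemma diagonal_arrangement_mem:
  assumes "c < n"
  shows "diagonal_arrangement k n d c \<in> arrangements k n d"
proof -
  have "(\<Sum>i<n. length (diagonal_arrangement k n d c i)) = (\<Sum>i<n. if i = c then d else 0)"
    by (intro sum.cong) (auto simp: diagonal_arrangement_def)
  then have "(\<Sum>i<n. length (diagonal_arrangement k n d c i)) = d" using assms by simp
  then show ?thesis using assms
    by (auto simp: arrangements_def diagonal_arrangement_def index_lists_def)
qed

text \<open>The prefactor of the only nonempty row cancels against the factorial of the multiplicity
  of the loop, and the only closed walk stays at \<open>c\<close>.\<close>

lemma walk_weight_diagonal:
  assumes "c < n"
  shows "walk_weight k n d (diagonal_arrangement k n d c) = 1"
proof -
  let ?F = "diagonal_arrangement k n d c" and ?l = "d * (k - 1)"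
  have "(\<Prod>i<n. 1 / fact (length (?F i) * (k - 1)) :: real) = (\<Prod>i<n. if i = c then 1 / fact ?l else 1)"
    by (intro prod.cong) (auto simp: diagonal_arrangement_def)
  then have p: "(\<Prod>i<n. 1 / fact (length (?F i) * (k - 1)) :: real) = 1 / fact ?l"
    using assms by simp
  have "arcs n ?F = replicate_mset ?l (c, c)"
  proof (rule multiset_eqI)
    fix x :: "nat \<times> nat"
    obtain a b where x: "x = (a, b)" by fastforce
    show "count (arcs n ?F) x = count (replicate_mset ?l (c, c)) x"
      unfolding x count_arcs using assms
      by (auto simp: diagonal_arrangement_def sum_list_replicate)
  qed
  then have a: "arcs n ?F = replicate_mset ?l (c, c)" .
  have m: "multiset_fact (replicate_mset ?l (c, c)) = fact ?l"
    by (cases "?l = 0") (auto simp: multiset_fact_def)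
  have "closed_walks n ?l (replicate_mset ?l (c, c)) = {replicate ?l c}"
  proof (intro Set.set_eqI iffI)
    fix ws assume ws: "ws \<in> closed_walks n ?l (replicate_mset ?l (c, c))"
    then have l: "length ws = ?l" and z: "mset (zip (last ws # ws) ws) = replicate_mset ?l (c, c)"
      by (auto simp: closed_walks_def index_lists_def)
    have "mset ws = image_mset snd (mset (zip (last ws # ws) ws))"
      by (simp flip: mset_map add: map_snd_zip_take)
    also have "\<dots> = replicate_mset ?l c" unfolding z by simp
    finally have "set ws \<subseteq> {c}" by (metis set_mset_mset set_mset_replicate_mset_subset empty_subsetI order_refl)
    then show "ws \<in> {replicate ?l c}" using l by (metis insert_iff replicate_eqI singletonD subset_iff)
  next
    fix ws assume "ws \<in> {replicate ?l c}"
    then have ws: "ws = replicate ?l c" by simp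
    have "zip (last ws # ws) ws = replicate ?l (c, c)"
    proof (cases "?l = 0")
      case True
      have "ws = []" using ws unfolding True by simp
      then show ?thesis unfolding True by simp
    next
      case False
      then have "last ws # ws = replicate (Suc ?l) c" by (simp add: ws)
      then show ?thesis unfolding ws by (simp only: zip_replicate) simp
    qed
    then show "ws \<in> closed_walks n ?l (replicate_mset ?l (c, c))"
      using assms by (auto simp: closed_walks_def index_lists_def ws)
  qed
  then show ?thesis unfolding walk_weight_def p a m by simp
qed

section \<open>Growing hypertrees\<close>

text \<open>Hypertrees as built up by attaching pendant hyperedges, starting from the vertex r. Every
  hypertree arises in this way from each of its vertices.\<close>

inductive grown :: "nat \<Rightarrow> nat \<Rightarrow> nat set \<Rightarrow> nat set set \<Rightarrow> bool" for k r where
  root: "grown k r {r} {}"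
| attach: "grown k r V E \<Longrightarrow> v \<in> V \<Longrightarrow> e \<inter> V = {v} \<Longrightarrow> finite e \<Longrightarrow> card e = k \<Longrightarrow>
    grown k r (V \<union> e) (insert e E)"

lemma grown_basic:
  assumes "grown k r V E"
  shows "finite V" "finite E" "r \<in> V" "\<And>e. e \<in> E \<Longrightarrow> e \<subseteq> V \<and> finite e \<and> card e = k"
    "\<And>v. v \<in> V \<Longrightarrow> v \<noteq> r \<Longrightarrow> \<exists>e\<in>E. v \<in> e"
  using assms by (induction) auto

lemma attach_new:
  assumes "grown k r V E" "k \<ge> 2" "e \<inter> V = {v}" "card e = k"
  shows "e \<notin> E"
proof
  assume "e \<in> E"
  then have "e \<subseteq> V" using grown_basic(4)[OF assms(1)] by blast
  then have "e = {v}" using assms(3) by auto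
  then show False using assms(2,4) by simp
qed

lemma grown_card:
  assumes "grown k r V E" "k \<ge> 2"
  shows "card V = card E * (k - 1) + 1"
  using assms
proof (induction)
  case (attach V E v e)
  have "card (V \<union> e) + card (V \<inter> e) = card V + card e"
    using card_Un_Int[of V e] grown_basic(1)[OF attach.hyps(1)] attach.hyps by simp
  moreover have "V \<inter> e = {v}" using attach.hyps by blast
  moreover have "e \<notin> E" using attach_new attach by blast
  moreover obtain j where "k = Suc j" using attach.prems by (cases k) auto
  ultimately show ?case using attach grown_basic(2)[OF attach.hyps(1)] by simp
qed auto

definition berge_path :: "nat set set \<Rightarrow> nat list \<Rightarrow> nat set list \<Rightarrow> bool" where
  "berge_path E vs es \<longleftrightarrow> length vs = Suc (length es) \<and> distinct vs \<and> distinct es \<and> set es \<subseteq> E \<and>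
     (\<forall>i<length es. vs ! i \<in> es ! i \<and> vs ! Suc i \<in> es ! i)"

lemma berge_path_snoc:
  assumes "berge_path E vs es" "e \<notin> E" "last vs \<in> e" "v \<in> e" "v \<notin> set vs"
  shows "berge_path (insert e E) (vs @ [v]) (es @ [e])"
proof -
  have "vs \<noteq> []" "length vs = Suc (length es)" using assms by (auto simp: berge_path_def)
  then have "last vs = vs ! length es" by (simp add: last_conv_nth)
  then show ?thesis using assms unfolding berge_path_def
    by (auto simp: nth_append less_Suc_eq)
qed

lemma berge_path_Cons:
  assumes "berge_path E vs es" "e \<notin> E" "hd vs \<in> e" "v \<in> e" "v \<notin> set vs"
  shows "berge_path (insert e E) (v # vs) (e # es)"
  using assms unfolding berge_path_def
  by (cases vs) (auto simp: nth_Cons split: nat.splits)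

lemma berge_path_mono: "berge_path E vs es \<Longrightarrow> E \<subseteq> E' \<Longrightarrow> berge_path E' vs es"
  by (auto simp: berge_path_def)

text \<open>A vertex of the newest hyperedge is reached through the vertex where that hyperedge is
  attached. The paths serve to close a cycle with a further hyperedge.\<close>

lemma grown_berge_path:
  assumes "grown k r V E" "k \<ge> 2" "u \<in> V" "v \<in> V"
  shows "\<exists>vs es. berge_path E vs es \<and> hd vs = u \<and> last vs = v \<and> set vs \<subseteq> V"
  using assms
proof (induction arbitrary: u v)
  case root
  then show ?case by (intro exI[of _ "[r]"] exI[of _ "[]"]) (auto simp: berge_path_def)
next
  case (attach V E a e)
  have new: "e \<notin> E" using attach_new attach by blast
  have a: "a \<in> e" using attach by blast
  have out: "w \<notin> V" if "w \<in> e" "w \<noteq> a" for w using attach that by blast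
  consider "u \<in> V" "v \<in> V" | "u \<in> V" "v \<in> e" "v \<noteq> a" | "v \<in> V" "u \<in> e" "u \<noteq> a"
    | "u \<in> e" "v \<in> e" "u \<noteq> a" "v \<noteq> a"
    using attach by blast
  then show ?case
  proof cases
    case 1
    then show ?thesis using attach.IH[OF attach.prems(1)] berge_path_mono[OF _ subset_insertI]
      by (meson le_supI1)
  next
    case 2
    obtain vs es where "berge_path E vs es" "hd vs = u" "last vs = a" "set vs \<subseteq> V"
      using attach.IH[OF attach.prems(1) 2(1) attach.hyps(2)] by blast
    then show ?thesis using berge_path_snoc[of E vs es e v] new a out[of v] 2
      by (intro exI[of _ "vs @ [v]"] exI[of _ "es @ [e]"]) (auto simp: berge_path_def hd_append)
  next
    case 3
    obtain vs es where "berge_path E vs es" "hd vs = a" "last vs = v" "set vs \<subseteq> V"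
      using attach.IH[OF attach.prems(1) attach.hyps(2) 3(1)] by blast
    then show ?thesis using berge_path_Cons[of E vs es e u] new a out[of u] 3
      by (intro exI[of _ "u # vs"] exI[of _ "e # es"]) (auto simp: berge_path_def)
  next
    case 4
    show ?thesis
    proof (cases "u = v")
      case True
      with 4 show ?thesis by (intro exI[of _ "[u]"] exI[of _ "[]"]) (auto simp: berge_path_def)
    next
      case False
      with 4 show ?thesis by (intro exI[of _ "[u, v]"] exI[of _ "[e]"]) (auto simp: berge_path_def)
    qed
  qed
qed

text \<open>A cycle through the newest hyperedge has two distinct vertices on it, each shared with a
  neighbouring hyperedge of the cycle. The latter is older, so both vertices would be the attachment
  vertex.\<close>

lemma grown_acyclic:
  assumes "grown k r V E" "k \<ge> 2" "length vs = length es" "length es \<ge> 2" "distinct vs" "distinct es"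
    "set es \<subseteq> E" "\<forall>i<length es. vs ! i \<in> es ! i \<and> vs ! (Suc i mod length es) \<in> es ! i"
  shows False
  using assms
proof (induction)
  case root
  then show ?case by simp
next
  case (attach V E v e)
  let ?l = "length es"
  show ?case
  proof (cases "e \<in> set es")
    case False
    then show ?thesis using attach by (simp add: subset_insert)
  next
    case True
    then obtain i where i: "i < ?l" "es ! i = e" by (auto simp: in_set_conv_nth)
    have other: "es ! j \<subseteq> V" if "j < ?l" "j \<noteq> i" for j
    proof -
      have "es ! j \<noteq> e" using that i attach.prems by (metis nth_eq_iff_index_eq)
      then have "es ! j \<in> E" using attach.prems nth_mem[OF that(1)] by blast
      then show ?thesis using grown_basic(4)[OF attach.hyps(1)] by blast
    qed
    \<comment> \<open>The cyclic predecessor of \<open>i\<close>; its hyperedge contains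
      \<open>vs ! i\<close>. The successor \<open>s\<close> plays the same part for the other vertex
      on \<open>e\<close>.\<close>
    define j where "j = (if i = 0 then ?l - 1 else i - 1)"
    have j: "j < ?l" "j \<noteq> i" "Suc j mod ?l = i" using i attach.prems by (auto simp: j_def)
    define s where "s = Suc i mod ?l"
    have s: "s < ?l" "s \<noteq> i" using i attach.prems unfolding s_def
      by (auto simp: mod_Suc)
    have "vs ! i \<in> V" using attach.prems(7) j other[OF j(1,2)] by force
    moreover have "vs ! s \<in> V" using attach.prems(7) s other[OF s] by force
    moreover have "vs ! i \<in> e" "vs ! s \<in> e" using attach.prems(7) i by (auto simp: s_def)
    ultimately have "vs ! i = vs ! s" using attach.hyps(3) by (metis IntI singletonD)
    then show False using s i attach.prems by (metis nth_eq_iff_index_eq)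
  qed
qed

lemma grown_connected:
  assumes "grown k r V E" "v \<in> V"
  shows "(r, v) \<in> {(x, y). \<exists>e\<in>E. x \<in> e \<and> y \<in> e}\<^sup>*"
  using assms
proof (induction arbitrary: v)
  case root
  then show ?case by simp
next
  case (attach V E a e)
  let ?R = "\<lambda>E. {(x, y). \<exists>e\<in>E. x \<in> e \<and> y \<in> (e::nat set)}"
  have mono: "(?R E)\<^sup>* \<subseteq> (?R (insert e E))\<^sup>*" by (intro rtrancl_mono) auto
  show ?case
  proof (cases "v \<in> V")
    case True
    then show ?thesis using attach mono by blast
  next
    case False
    then have "(a, v) \<in> ?R (insert e E)" using attach by blast
    moreover have "(r, a) \<in> (?R (insert e E))\<^sup>*" using attach mono by blast
    ultimately show ?thesis by (rule rtrancl_into_rtrancl[rotated])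
  qed
qed

lemma grown_imp_uniform_hypertree:
  assumes "grown k r {..<nverts H} (edges H)" "k \<ge> 2" "card (edges H) = m"
  shows "H \<in> uniform_hypertrees k m"
proof -
  let ?R = "{(x, y). \<exists>e\<in>edges H. x \<in> e \<and> y \<in> e}"
  have "sym ?R" by (auto simp: sym_def)
  then have "sym (?R\<^sup>*)" by (rule sym_rtrancl)
  then have "connected H"
    unfolding connected_def using grown_connected[OF assms(1)]
    by (metis (no_types, lifting) lessThan_iff rtrancl_trans symD)
  moreover have "\<not> is_cycle H vs es" for vs es
    using grown_acyclic[OF assms(1,2), of vs es] unfolding is_cycle_def by blast
  moreover have "uniform k H"
    unfolding uniform_def using grown_basic(4)[OF assms(1)] by blast
  ultimately show ?thesis using assms(3) by (auto simp: uniform_hypertrees_def hypertree_def)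
qed

text \<open>Otherwise \<open>e\<close> would close a path between \<open>u\<close> and
  \<open>v\<close> inside the grown part to a cycle.\<close>

lemma hypertree_grown_no_chord:
  assumes "hypertree H" "grown k r V E" "k \<ge> 2" "E \<subseteq> edges H" "e \<in> edges H" "e \<notin> E"
    "u \<in> e" "v \<in> e" "u \<in> V" "v \<in> V"
  shows "u = v"
proof (rule ccontr)
  assume "u \<noteq> v"
  obtain vs es where p: "berge_path E vs es" "hd vs = u" "last vs = v"
    using grown_berge_path[OF assms(2,3,9,10)] by blast
  have ne: "es \<noteq> []" "vs \<noteq> []"
    using p \<open>u \<noteq> v\<close> by (auto simp: berge_path_def length_Suc_conv)
  have 0: "vs ! 0 = u" "vs ! length es = v"
    using p ne by (auto simp: hd_conv_nth last_conv_nth berge_path_def)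
  have "is_cycle H vs (es @ [e])"
    unfolding is_cycle_def
  proof (intro conjI allI impI)
    show "2 \<le> length (es @ [e])" using ne by (cases es) auto
    fix i assume "i < length (es @ [e])"
    then consider "i < length es" | "i = length es" by fastforce
    then have "vs ! i \<in> (es @ [e]) ! i \<and> vs ! (Suc i mod length (es @ [e])) \<in> (es @ [e]) ! i"
    proof cases
      case 1
      then show ?thesis using p(1) by (simp add: berge_path_def nth_append)
    next
      case 2
      then show ?thesis using 0 assms(7,8) by simp
    qed
    then show "vs ! i \<in> (es @ [e]) ! i" "vs ! (Suc i mod length (es @ [e])) \<in> (es @ [e]) ! i"
      by auto
  qed (use p(1) assms(4-6) in \<open>auto simp: berge_path_def\<close>)
  then show False using assms(1) by (auto simp: hypertree_def)
qed

lemma rtrancl_crossing: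
  assumes "(a, b) \<in> R\<^sup>*" "a \<in> V" "b \<notin> V"
  shows "\<exists>x y. (x, y) \<in> R \<and> x \<in> V \<and> y \<notin> V"
  using assms
proof (induction rule: rtrancl_induct)
  case (step y z)
  then show ?case by (cases "y \<in> V") auto
qed simp

lemma finite_edges: "uniform k H \<Longrightarrow> finite (edges H)"
  by (rule finite_subset[of _ "Pow {..<nverts H}"]) (auto simp: uniform_def)

text \<open>Take a grown part with the greatest number of hyperedges. If it misses a vertex,
  connectedness gives a hyperedge leaving it, which meets it in one vertex only by acyclicity and so
  could be attached. Once all vertices are covered, a missing hyperedge would be a chord.\<close>

lemma uniform_hypertree_grown:
  assumes "H \<in> uniform_hypertrees k m" "k \<ge> 2" "r < nverts H"
  shows "grown k r {..<nverts H} (edges H)"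
proof -
  have uni: "uniform k H" and ht: "hypertree H" and con: "connected H"
    using assms by (auto simp: uniform_hypertrees_def hypertree_def)
  let ?P = "\<lambda>(V, E). grown k r V E \<and> V \<subseteq> {..<nverts H} \<and> E \<subseteq> edges H"
  have bound: "card (snd p) \<le> card (edges H)" if "?P p" for p
    using that finite_edges[OF uni] by (auto intro: card_mono)
  have "?P ({r}, {})" using assms by (auto intro: grown.root)
  from ex_has_greatest_nat[of ?P _ "\<lambda>p. card (snd p)", OF this] bound
  obtain p where p: "?P p" and maximal: "\<And>q. ?P q \<Longrightarrow> card (snd q) \<le> card (snd p)"
    by (metis (no_types, lifting) le_imp_less_Suc)
  obtain V E where [simp]: "p = (V, E)" by fastforce
  have g: "grown k r V E" and V: "V \<subseteq> {..<nverts H}" and E: "E \<subseteq> edges H" using p by auto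
  have "V = {..<nverts H}"
  proof (rule ccontr)
    assume "V \<noteq> {..<nverts H}"
    then obtain w where w: "w < nverts H" "w \<notin> V" using V by blast
    then have "(r, w) \<in> {(x, y). \<exists>e\<in>edges H. x \<in> e \<and> y \<in> e}\<^sup>*"
      using con assms(3) by (auto simp: connected_def)
    from rtrancl_crossing[OF this grown_basic(3)[OF g] w(2)]
    obtain x y e where xy: "e \<in> edges H" "x \<in> e" "y \<in> e" "x \<in> V" "y \<notin> V" by blast
    have e: "e \<notin> E" using xy grown_basic(4)[OF g] by blast
    have e': "e \<subseteq> {..<nverts H}" "card e = k" using uni xy by (auto simp: uniform_def)
    have "e \<inter> V = {x}"
      using hypertree_grown_no_chord[OF ht g assms(2) E xy(1) e] xy by blast
    then have "grown k r (V \<union> e) (insert e E)"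
      using g xy e' by (intro grown.attach) (auto intro: finite_subset)
    then have "card (snd (V \<union> e, insert e E)) \<le> card E"
      using maximal[of "(V \<union> e, insert e E)"] V E e' xy by auto
    then show False using e grown_basic(2)[OF g] by simp
  qed
  moreover have "E = edges H"
  proof (rule ccontr)
    assume "E \<noteq> edges H"
    then obtain e where e: "e \<in> edges H" "e \<notin> E" using E by blast
    have e': "e \<subseteq> V" "card e = k" using uni e \<open>V = _\<close> by (auto simp: uniform_def)
    have "\<not> card e \<le> Suc 0" using e' assms(2) by simp
    then obtain u v where "u \<in> e" "v \<in> e" "u \<noteq> v"
      using card_le_Suc0_iff_eq[of e] e' by (metis card.infinite le0)
    then show False using hypertree_grown_no_chord[OF ht g assms(2) E e] e' by blast
  qed
  ultimately show ?thesis using g by simp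
qed

lemma sum_edges:
  fixes f :: "nat \<Rightarrow> 'a::comm_semiring_1"
  assumes "uniform k H"
  shows "(\<Sum>e\<in>edges H. \<Sum>v\<in>e. f v) = (\<Sum>v<nverts H. of_nat (degree H v) * f v)"
proof -
  have fin: "finite (edges H)" using assms by (rule finite_edges)
  have "(\<Sum>e\<in>edges H. \<Sum>v\<in>e. f v) = (\<Sum>e\<in>edges H. \<Sum>v<nverts H. if v \<in> e then f v else 0)"
  proof (rule sum.cong[OF refl])
    fix e assume "e \<in> edges H"
    then have "{..<nverts H} \<inter> e = e" using assms by (auto simp: uniform_def)
    then show "sum f e = (\<Sum>v<nverts H. if v \<in> e then f v else 0)"
      using sum.inter_restrict[of "{..<nverts H}" f e] by simp
  qed
  also have "\<dots> = (\<Sum>v<nverts H. \<Sum>e\<in>edges H. if v \<in> e then f v else 0)" by (rule sum.swap)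
  also have "\<dots> = (\<Sum>v<nverts H. of_nat (degree H v) * f v)"
    using fin by (simp add: sum.If_cases degree_def Int_def)
  finally show ?thesis .
qed

text \<open>Peel off the newest hyperedge. Its new vertices lie on no other hyperedge, so the vertex
  condition makes the values there vanish; the condition on the hyperedge then does the same at the
  attachment vertex, and the rest satisfies the conditions on the smaller part.\<close>

lemma grown_flow_zero:
  fixes f :: "nat \<Rightarrow> nat set \<Rightarrow> int"
  assumes "grown k r V E" "k \<ge> 2"
    and "\<And>v. v \<in> V \<Longrightarrow> (\<Sum>e\<in>{e \<in> E. v \<in> e}. f v e) = 0"
    and "\<And>e. e \<in> E \<Longrightarrow> (\<Sum>v\<in>e. f v e) = 0"
  shows "e \<in> E \<Longrightarrow> v \<in> e \<Longrightarrow> f v e = 0"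
  using assms
proof (induction arbitrary: e v)
  case root
  then show ?case by simp
next
  case (attach V E a e e' v')
  have new: "e \<notin> E" using attach_new[OF attach.hyps(1) attach.prems(3) attach.hyps(3,5)] .
  have sub: "e' \<subseteq> V" if "e' \<in> E" for e' using grown_basic(4)[OF attach.hyps(1)] that by blast
  have leaf: "f u e = 0" if "u \<in> e" "u \<noteq> a" for u
  proof -
    have "u \<notin> V" using that attach.hyps(3) by blast
    then have "{e' \<in> insert e E. u \<in> e'} = {e}" using sub that by blast
    then show ?thesis using attach.prems(4)[of u] that by simp
  qed
  have ae: "a \<in> e" using attach.hyps(3) by blast
  have "(\<Sum>v\<in>e. f v e) = f a e"
    using attach.hyps ae by (subst sum.remove[of _ a]) (auto simp: leaf)
  then have fa: "f a e = 0" using attach.prems(5)[of e] by simp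
  have old: "f v' e' = 0" if "e' \<in> E" "v' \<in> e'" for e' v'
  proof (rule attach.IH[OF that attach.prems(3)])
    fix w assume w: "w \<in> V"
    show "(\<Sum>e\<in>{e \<in> E. w \<in> e}. f w e) = 0"
    proof (cases "w \<in> e")
      case True
      then have "w = a" using w attach.hyps(3) by blast
      have "{e' \<in> insert e E. w \<in> e'} = insert e {e' \<in> E. w \<in> e'}" using True by auto
      then have "(\<Sum>e\<in>{e' \<in> insert e E. w \<in> e'}. f w e) = f w e + (\<Sum>e\<in>{e \<in> E. w \<in> e}. f w e)"
        using new grown_basic(2)[OF attach.hyps(1)] by simp
      then show ?thesis using attach.prems(4)[of w] w fa \<open>w = a\<close> by simp
    next
      case False
      then have "{e' \<in> insert e E. w \<in> e'} = {e' \<in> E. w \<in> e'}" by auto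
      then show ?thesis using attach.prems(4)[of w] w by simp
    qed
  qed (use attach.prems(5) in auto)
  show ?case using attach.prems(1,2) leaf fa old by (cases "v' = a") auto
qed

section \<open>Stars and attached hyperedges\<close>

text \<open>Keeping the images of the old vertices lets an induction hold on to a distinguished
  vertex, such as the image of 0.\<close>

lemma attach_embedding:
  assumes bij: "bij_betw \<phi> {..<nverts G} V" and img: "(`) \<phi> ` edges G = E"
    and sub: "\<And>f. f \<in> edges G \<Longrightarrow> f \<subseteq> {..<nverts G}"
    and s: "s < nverts G" and e: "e \<inter> V = {\<phi> s}" "finite e" "card e = k"
  shows "\<exists>\<phi>'. bij_betw \<phi>' {..<nverts (attach_pendant k G s)} (V \<union> e) \<and>
    (`) \<phi>' ` edges (attach_pendant k G s) = insert e E \<and> (\<forall>t<nverts G. \<phi>' t = \<phi> t)"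
proof -
  let ?n = "nverts G" and ?N = "{nverts G..<nverts G + (k - 1)}"
  have "\<phi> s \<in> e" using e by blast
  then have "card (e - {\<phi> s}) = card ?N" using e by simp
  then obtain \<psi> where \<psi>: "bij_betw \<psi> ?N (e - {\<phi> s})"
    using e finite_same_card_bij[of ?N "e - {\<phi> s}"] by auto
  define \<phi>' where "\<phi>' = (\<lambda>t. if t < ?n then \<phi> t else \<psi> t)"
  have old: "\<phi>' t = \<phi> t" if "t < ?n" for t using that by (simp add: \<phi>'_def)
  have "bij_betw \<phi>' {..<?n} V"
    using bij by (subst bij_betw_cong[of _ _ \<phi>]) (auto simp: old)
  moreover have new: "bij_betw \<phi>' ?N (e - {\<phi> s})"
    using \<psi> by (subst bij_betw_cong[of _ _ \<psi>]) (auto simp: \<phi>'_def)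
  moreover have "V \<inter> (e - {\<phi> s}) = {}" using e by blast
  ultimately have "bij_betw \<phi>' ({..<?n} \<union> ?N) (V \<union> (e - {\<phi> s}))"
    by (rule bij_betw_combine)
  moreover have "{..<?n} \<union> ?N = {..<nverts (attach_pendant k G s)}"
    by (auto simp: attach_pendant_def)
  moreover have "\<phi> s \<in> V" using bij s by (auto simp: bij_betw_def)
  then have "V \<union> (e - {\<phi> s}) = V \<union> e" by blast
  moreover have "\<phi>' ` f = \<phi> ` f" if "f \<in> edges G" for f
    using sub[OF that] old by (intro image_cong) auto
  then have "(`) \<phi>' ` edges G = E" using img by (metis (no_types, lifting) image_cong)
  moreover have "\<phi>' ` insert s ?N = e"
    using new old[OF s] \<open>\<phi> s \<in> e\<close> by (auto simp: bij_betw_def)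
  ultimately show ?thesis using old
    by (intro exI[of _ \<phi>']) (auto simp: attach_pendant_def)
qed

lemma attach_pendant_grown:
  assumes "grown k r {..<nverts G} (edges G)" "s < nverts G" "k \<ge> 2"
  shows "grown k r {..<nverts (attach_pendant k G s)} (edges (attach_pendant k G s))"
proof -
  let ?e = "insert s {nverts G..<nverts G + (k - 1)}"
  have "grown k r ({..<nverts G} \<union> ?e) (insert ?e (edges G))"
    using assms by (intro grown.attach[of _ _ _ _ s]) auto
  moreover have "{..<nverts G} \<union> ?e = {..<nverts (attach_pendant k G s)}"
    using assms by (auto simp: attach_pendant_def)
  ultimately show ?thesis by (simp add: attach_pendant_def)
qed

lemma degree_attach_pendant:
  assumes "grown k r {..<nverts G} (edges G)" "s < nverts G" "k \<ge> 2"
  shows "degree (attach_pendant k G s) v =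
    (if v < nverts G then degree G v + (if v = s then 1 else 0)
     else if v < nverts G + (k - 1) then 1 else 0)"
proof -
  let ?e = "insert s {nverts G..<nverts G + (k - 1)}"
  have fin: "finite (edges G)" and sub: "\<And>f. f \<in> edges G \<Longrightarrow> f \<subseteq> {..<nverts G}"
    using grown_basic[OF assms(1)] by blast+
  have "nverts G \<in> ?e"
    using assms(3) unfolding insert_iff atLeastLessThan_iff by linarith
  then have new: "?e \<notin> edges G" using sub by blast
  consider "v < nverts G" "v = s" | "v < nverts G" "v \<noteq> s"
    | "\<not> v < nverts G" "v < nverts G + (k - 1)" | "\<not> v < nverts G" "\<not> v < nverts G + (k - 1)"
    by blast
  then show ?thesis
  proof cases
    case 1
    then have "{f \<in> edges (attach_pendant k G s). v \<in> f} = insert ?e {f \<in> edges G. v \<in> f}"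
      by (auto simp: attach_pendant_def)
    then show ?thesis using 1 fin new by (simp add: degree_def)
  next
    case 2
    then have "{f \<in> edges (attach_pendant k G s). v \<in> f} = {f \<in> edges G. v \<in> f}"
      by (auto simp: attach_pendant_def)
    then show ?thesis using 2 by (simp add: degree_def)
  next
    case 3
    then have "{f \<in> edges (attach_pendant k G s). v \<in> f} = {?e}"
      using sub by (auto simp: attach_pendant_def)
    then show ?thesis using 3 by (simp add: degree_def)
  next
    case 4
    then have none: "{f \<in> edges (attach_pendant k G s). v \<in> f} = {}"
      using assms(2) by (auto simp: attach_pendant_def dest!: sub)
    show ?thesis unfolding degree_def none using 4 by simp
  qed
qed

section \<open>Hyperpaths and starlike hypertrees by successive attachment\<close>

definition single_vertex :: hypergraph where
  "single_vertex = \<lparr>nverts = 1, edges = {}\<rparr>"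

lemma single_vertex_simps [simp]: "nverts single_vertex = 1" "edges single_vertex = {}"
  by (simp_all add: single_vertex_def)

lemma grown_single_vertex: "grown k 0 {..<nverts single_vertex} (edges single_vertex)"
proof -
  have "{..<Suc 0} = {0}" by auto
  then show ?thesis using grown.root[of k 0] by simp
qed

lemma degree_single_vertex [simp]: "degree single_vertex v = 0"
  by (simp add: degree_def)

lemma hyperpath_0: "hyperpath k 0 = single_vertex"
  by (simp add: hyperpath_def single_vertex_def)

lemma hyperpath_Suc:
  "k \<ge> 2 \<Longrightarrow> hyperpath k (Suc r) = attach_pendant k (hyperpath k r) (r * (k - 1))"
proof -
  assume "k \<ge> 2"
  have "{r * (k - 1)..(r + 1) * (k - 1)} =
      insert (r * (k - 1)) {r * (k - 1) + 1..<r * (k - 1) + 1 + (k - 1)}"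
    by auto
  then show ?thesis
    by (simp add: hyperpath_def attach_pendant_def lessThan_Suc)
qed

lemma hyperpath_nverts: "nverts (hyperpath k r) = r * (k - 1) + 1"
  by (simp add: hyperpath_def)

lemma hyperpath_grown:
  "k \<ge> 2 \<Longrightarrow> grown k 0 {..<nverts (hyperpath k r)} (edges (hyperpath k r))"
proof (induction r)
  case 0
  then show ?case using grown_single_vertex by (simp only: hyperpath_0)
next
  case (Suc r)
  then show ?case unfolding hyperpath_Suc[OF Suc.prems]
    by (intro attach_pendant_grown) (auto simp: hyperpath_nverts)
qed

lemma starlike_Nil: "starlike k [] = single_vertex"
  by (simp add: starlike_def single_vertex_def)

lemma starlike_nverts: "nverts (starlike k ns) = sum_list ns * (k - 1) + 1"
  by (simp add: starlike_def)

text \<open>The shift of a leg only depends on the legs before it, so appending a leg leaves the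
  others in place.\<close>

lemma leg_vertex_snoc:
  "i \<le> length ns \<Longrightarrow> leg_vertex k (ns @ xs) i = leg_vertex k ns i"
  by (simp add: leg_vertex_def fun_eq_iff)

lemma edges_starlike_snoc:
  "edges (starlike k (ns @ [l])) = edges (starlike k ns) \<union>
     (\<lambda>e. leg_vertex k ns (length ns) ` e) ` edges (hyperpath k l)"
proof -
  have "(\<Union>i<length ns. (\<lambda>e. leg_vertex k (ns @ [l]) i ` e) ` edges (hyperpath k ((ns @ [l]) ! i))) =
      edges (starlike k ns)"
    by (auto simp: starlike_def leg_vertex_snoc nth_append)
  moreover have "{..<length (ns @ [l])} = insert (length ns) {..<length ns}" by auto
  ultimately show ?thesis
    unfolding starlike_def[of k "ns @ [l]"] by (simp add: leg_vertex_snoc Un_commute)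
qed

lemma leg_vertex_image_first:
  "leg_vertex k ns (length ns) ` {0..k - 1} =
     insert 0 {sum_list ns * (k - 1) + 1..<sum_list ns * (k - 1) + 1 + (k - 1)}"
proof (intro Set.set_eqI iffI)
  fix x assume "x \<in> insert 0 {sum_list ns * (k - 1) + 1..<sum_list ns * (k - 1) + 1 + (k - 1)}"
  then show "x \<in> leg_vertex k ns (length ns) ` {0..k - 1}"
    by (intro image_eqI[of _ _ "if x = 0 then 0 else x - sum_list ns * (k - 1)"])
      (auto simp: leg_vertex_def)
qed (auto simp: leg_vertex_def)

lemma leg_vertex_image_second:
  assumes "k \<ge> 2"
  shows "leg_vertex k ns (length ns) ` {k - 1..2 * (k - 1)} =
     insert ((sum_list ns + 1) * (k - 1))
       {(sum_list ns + 1) * (k - 1) + 1..<(sum_list ns + 1) * (k - 1) + 1 + (k - 1)}"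
proof -
  let ?S = "sum_list ns * (k - 1)"
  have "leg_vertex k ns (length ns) ` {k - 1..2 * (k - 1)} = (\<lambda>t. t + ?S) ` {k - 1..2 * (k - 1)}"
    using assms by (intro image_cong) (auto simp: leg_vertex_def)
  also have "\<dots> = {?S + (k - 1)..?S + 2 * (k - 1)}" by (simp add: add.commute)
  finally show ?thesis by auto
qed

lemma starlike_snoc_1: "starlike k (ns @ [1]) = attach_pendant k (starlike k ns) 0"
proof -
  have "edges (hyperpath k 1) = {{0..k - 1}}" by (simp add: hyperpath_def lessThan_Suc)
  then have "edges (starlike k (ns @ [1])) = edges (attach_pendant k (starlike k ns) 0)"
    unfolding edges_starlike_snoc using leg_vertex_image_first[of k ns]
    by (simp add: attach_pendant_def starlike_nverts)
  then show ?thesis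
    by (intro hypergraph.equality) (simp_all add: attach_pendant_def starlike_nverts)
qed

text \<open>A leg of length 2 is a leg of length 1 with a pendant hyperedge at its far end; the
  attachment vertex is vertex \<open>k - 1\<close> of the leg after the shift.\<close>

lemma starlike_snoc_2:
  assumes "k \<ge> 2"
  shows "starlike k (ns @ [2]) = attach_pendant k (starlike k (ns @ [1])) ((sum_list ns + 1) * (k - 1))"
proof -
  have "{..<2::nat} = {0, 1}" by auto
  then have 2: "edges (hyperpath k 2) = {{0..k - 1}, {k - 1..2 * (k - 1)}}"
    by (simp add: hyperpath_def mult_2)
  have 1: "edges (hyperpath k 1) = {{0..k - 1}}" by (simp add: hyperpath_def lessThan_Suc)
  have "edges (starlike k (ns @ [2])) =
      edges (attach_pendant k (starlike k (ns @ [1])) ((sum_list ns + 1) * (k - 1)))"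
    unfolding edges_starlike_snoc attach_pendant_def hypergraph.simps starlike_nverts 1 2
    using leg_vertex_image_second[OF assms, of ns] by (simp add: insert_commute)
  then show ?thesis
    by (intro hypergraph.equality) (simp_all add: attach_pendant_def starlike_nverts)
qed

lemma starlike_12_base:
  assumes "k \<ge> 2"
  shows "grown k 0 {..<nverts (starlike k [1, 2])} (edges (starlike k [1, 2]))"
    and "degree (starlike k [1, 2]) 0 = 2"
proof -
  have 1: "starlike k [1] = attach_pendant k single_vertex 0"
    using starlike_snoc_1[of k "[]"] by (simp add: starlike_Nil)
  have g1: "grown k 0 {..<nverts (starlike k [1])} (edges (starlike k [1]))"
    unfolding 1 using assms grown_single_vertex by (intro attach_pendant_grown) auto
  have d1: "degree (starlike k [1]) 0 = 1"
    unfolding 1 using grown_single_vertex assms by (subst degree_attach_pendant) auto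
  have 2: "starlike k [1, 1] = attach_pendant k (starlike k [1]) 0"
    using starlike_snoc_1[of k "[1]"] by simp
  have g2: "grown k 0 {..<nverts (starlike k [1, 1])} (edges (starlike k [1, 1]))"
    unfolding 2 using assms g1 by (intro attach_pendant_grown) (auto simp: starlike_nverts)
  have d2: "degree (starlike k [1, 1]) 0 = 2"
    unfolding 2 using g1 d1 assms by (subst degree_attach_pendant) (auto simp: starlike_nverts)
  have 3: "starlike k [1, 2] = attach_pendant k (starlike k [1, 1]) (2 * (k - 1))"
    using starlike_snoc_2[OF assms, of "[1]"] by (simp add: mult_2)
  show "grown k 0 {..<nverts (starlike k [1, 2])} (edges (starlike k [1, 2]))"
    unfolding 3 using assms g2 by (intro attach_pendant_grown) (auto simp: starlike_nverts)
  show "degree (starlike k [1, 2]) 0 = 2"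
    unfolding 3 using g2 d2 assms by (subst degree_attach_pendant) (auto simp: starlike_nverts)
qed

lemma starlike_append_ones:
  assumes "k \<ge> 2" "grown k 0 {..<nverts (starlike k ns)} (edges (starlike k ns))"
  shows "grown k 0 {..<nverts (starlike k (ns @ replicate j 1))} (edges (starlike k (ns @ replicate j 1))) \<and>
    degree (starlike k (ns @ replicate j 1)) 0 = degree (starlike k ns) 0 + j"
proof (induction j)
  case 0
  then show ?case using assms by simp
next
  case (Suc j)
  have *: "starlike k (ns @ replicate (Suc j) 1) = attach_pendant k (starlike k (ns @ replicate j 1)) 0"
    using starlike_snoc_1[of k "ns @ replicate j 1"] by (simp flip: replicate_append_same)
  show ?case unfolding * using Suc assms(1)
    by (auto simp: starlike_nverts degree_attach_pendant intro!: attach_pendant_grown)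
qed

lemma grown_card_edges:
  assumes "grown k r {..<nverts H} (edges H)" "k \<ge> 2" "nverts H = m * (k - 1) + 1"
  shows "card (edges H) = m"
  using grown_card[OF assms(1,2)] assms(2,3) by simp

lemma hyperstar_hypertree:
  assumes "k \<ge> 2"
  shows "hyperstar k m \<in> uniform_hypertrees k m" "degree (hyperstar k m) 0 = m"
    "nverts (hyperstar k m) = m * (k - 1) + 1"
    "grown k 0 {..<nverts (hyperstar k m)} (edges (hyperstar k m))"
proof -
  show n: "nverts (hyperstar k m) = m * (k - 1) + 1"
    by (simp add: hyperstar_def starlike_nverts sum_list_replicate)
  have *: "grown k 0 {..<nverts (hyperstar k m)} (edges (hyperstar k m)) \<and> degree (hyperstar k m) 0 = m"
    using starlike_append_ones[OF assms, of "[]" m] grown_single_vertex[of k]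
    by (simp add: starlike_Nil hyperstar_def)
  then show "degree (hyperstar k m) 0 = m" and "grown k 0 {..<nverts (hyperstar k m)} (edges (hyperstar k m))"
    by auto
  show "hyperstar k m \<in> uniform_hypertrees k m"
    using * grown_imp_uniform_hypertree grown_card_edges[OF _ assms n] assms by blast
qed

lemma starlike_12_hypertree:
  assumes "k \<ge> 2" "m \<ge> 3"
  shows "starlike_12 k m \<in> uniform_hypertrees k m" "degree (starlike_12 k m) 0 = m - 1"
    "nverts (starlike_12 k m) = m * (k - 1) + 1"
proof -
  obtain j where m: "m = j + 3" using assms(2) by (metis add.commute le_Suc_ex)
  show n: "nverts (starlike_12 k m) = m * (k - 1) + 1"
  proof -
    obtain i where "k = i + 2" using assms(1) by (metis add.commute le_Suc_ex)
    then show ?thesis by (simp add: starlike_12_def starlike_nverts sum_list_replicate m algebra_simps)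
  qed
  have *: "grown k 0 {..<nverts (starlike_12 k m)} (edges (starlike_12 k m)) \<and> degree (starlike_12 k m) 0 = 2 + j"
    using starlike_append_ones[OF assms(1) starlike_12_base(1)[OF assms(1)], of j]
      starlike_12_base(2)[OF assms(1)]
    by (simp only: starlike_12_def m) simp
  then show "degree (starlike_12 k m) 0 = m - 1" using m by auto
  show "starlike_12 k m \<in> uniform_hypertrees k m"
    using * grown_imp_uniform_hypertree grown_card_edges[OF _ assms(1) n] assms by blast
qed

lemma hyperpath_hypertree:
  assumes "k \<ge> 2"
  shows "hyperpath k m \<in> uniform_hypertrees k m"
  by (rule grown_imp_uniform_hypertree[OF hyperpath_grown[OF assms] assms
      grown_card_edges[OF hyperpath_grown[OF assms] assms hyperpath_nverts]])

lemma F_tree_hypertree: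
  assumes "k \<ge> 3" "m \<ge> 4"
  shows "F_tree m k \<in> uniform_hypertrees k m"
proof -
  have 2: "k \<ge> 2" using assms by simp
  obtain j where j: "m = j + 4" using assms(2) by (metis add.commute le_Suc_ex)
  obtain i where i: "k = i + 3" using assms(1) by (metis add.commute le_Suc_ex)
  have "k < nverts (hyperpath k (m - 1))" by (simp add: hyperpath_nverts i j algebra_simps)
  then have g: "grown k 0 {..<nverts (F_tree m k)} (edges (F_tree m k))"
    unfolding F_tree_def using hyperpath_grown[OF 2] 2 by (intro attach_pendant_grown) auto
  have "nverts (F_tree m k) = m * (k - 1) + 1"
    by (simp add: F_tree_def attach_pendant_def hyperpath_nverts i j algebra_simps)
  then show ?thesis
    by (rule grown_imp_uniform_hypertree[OF g 2 grown_card_edges[OF g 2]])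
qed

section \<open>Recognising hyperstars\<close>

lemma isomorphic_sym:
  assumes "isomorphic G H" "\<And>e. e \<in> edges G \<Longrightarrow> e \<subseteq> {..<nverts G}"
  shows "isomorphic H G"
proof -
  obtain \<pi> where \<pi>: "bij_betw \<pi> {..<nverts G} {..<nverts H}" "(\<lambda>e. \<pi> ` e) ` edges G = edges H"
    using assms(1) by (auto simp: isomorphic_def)
  let ?\<rho> = "inv_into {..<nverts G} \<pi>"
  have "?\<rho> ` \<pi> ` e = e" if "e \<in> edges G" for e
    using \<pi>(1) assms(2)[OF that] by (simp add: bij_betw_def inv_into_image_cancel)
  then have "(\<lambda>e. ?\<rho> ` e) ` edges H = edges G"
    unfolding \<pi>(2)[symmetric] image_image by simp
  then show ?thesis using bij_betw_inv_into[OF \<pi>(1)] by (auto simp: isomorphic_def)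
qed

lemma hyperstar_Suc: "hyperstar k (Suc m) = attach_pendant k (hyperstar k m) 0"
  using starlike_snoc_1[of k "replicate m 1"] by (simp add: hyperstar_def replicate_append_same)

text \<open>If every hyperedge contains the root, then so does each newly attached one, and since it
  meets the old part in one vertex only, it is attached at the root.\<close>

lemma grown_hyperstar_embedding:
  assumes "grown k r V E" "k \<ge> 2" "\<And>e. e \<in> E \<Longrightarrow> r \<in> e"
  shows "\<exists>\<phi>. bij_betw \<phi> {..<nverts (hyperstar k (card E))} V \<and>
     (`) \<phi> ` edges (hyperstar k (card E)) = E \<and> \<phi> 0 = r"
  using assms
proof (induction)
  case root
  have "{..<Suc 0} = {0}" by auto
  then show ?case by (intro exI[of _ "\<lambda>_. r"]) (auto simp: hyperstar_def starlike_Nil bij_betw_def)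
next
  case (attach V E v e)
  then obtain \<phi> where \<phi>: "bij_betw \<phi> {..<nverts (hyperstar k (card E))} V"
    "(`) \<phi> ` edges (hyperstar k (card E)) = E" "\<phi> 0 = r" by auto
  have "v = r" using attach grown_basic(3)[OF attach.hyps(1)] by (metis IntI insertI1 singletonD)
  have card: "card (insert e E) = Suc (card E)"
    using attach_new[OF attach.hyps(1) attach.prems(1) attach.hyps(3,5)] grown_basic(2)[OF attach.hyps(1)]
    by simp
  have "\<exists>\<phi>'. bij_betw \<phi>' {..<nverts (attach_pendant k (hyperstar k (card E)) 0)} (V \<union> e) \<and>
    (`) \<phi>' ` edges (attach_pendant k (hyperstar k (card E)) 0) = insert e E \<and>
    (\<forall>t<nverts (hyperstar k (card E)). \<phi>' t = \<phi> t)"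
    using hyperstar_hypertree[OF attach.prems(1), of "card E"] attach.hyps \<phi>(3) \<open>v = r\<close>
    by (intro attach_embedding[OF \<phi>(1,2)]) (auto dest: grown_basic(4))
  then show ?case unfolding card hyperstar_Suc using \<phi>(3) hyperstar_hypertree(3)[OF attach.prems(1)]
    by (metis add_gr_0 less_one)
qed

lemma degree_le: "uniform k H \<Longrightarrow> degree H v \<le> card (edges H)"
  unfolding degree_def by (rule card_mono[OF finite_edges]) auto

lemma isomorphic_hyperstar:
  assumes "H \<in> uniform_hypertrees k m" "k \<ge> 2" "c < nverts H" "degree H c = m"
  shows "isomorphic H (hyperstar k m)"
proof -
  have uni: "uniform k H" and card: "card (edges H) = m"
    using assms by (auto simp: uniform_hypertrees_def)
  have "{e \<in> edges H. c \<in> e} = edges H"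
    using assms(4) card finite_edges[OF uni] by (intro card_subset_eq) (auto simp: degree_def)
  then have "c \<in> e" if "e \<in> edges H" for e using that by blast
  from grown_hyperstar_embedding[OF uniform_hypertree_grown[OF assms(1-3)] assms(2) this]
  have "isomorphic (hyperstar k m) H" using card by (auto simp: isomorphic_def)
  then show ?thesis
    by (rule isomorphic_sym) (use grown_basic(4)[OF hyperstar_hypertree(4)[OF assms(2)]] in blast)
qed

section \<open>Hyperpaths\<close>

lemma two_le_degree:
  assumes "uniform k H" "e \<in> edges H" "f \<in> edges H" "e \<noteq> f" "v \<in> e" "v \<in> f"
  shows "2 \<le> degree H v"
proof -
  have "card {e, f} \<le> degree H v"
    unfolding degree_def using assms finite_edges[OF assms(1)] by (intro card_mono) auto
  then show ?thesis using assms(4) by simp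
qed

lemma three_le_degree:
  assumes "uniform k H" "e \<in> edges H" "f \<in> edges H" "g \<in> edges H" "e \<noteq> f" "e \<noteq> g" "f \<noteq> g"
    "v \<in> e" "v \<in> f" "v \<in> g"
  shows "3 \<le> degree H v"
proof -
  have "card {e, f, g} \<le> degree H v"
    unfolding degree_def using assms finite_edges[OF assms(1)] by (intro card_mono) auto
  then show ?thesis using assms(5-7) by simp
qed

lemma transpose_image_same:
  assumes "a \<in> S \<longleftrightarrow> b \<in> S"
  shows "transpose a b ` S = S"
proof -
  have sub: "transpose a b x \<in> S" if "x \<in> S" for x
    using assms that by (cases "x = a \<or> x = b") auto
  have "x \<in> transpose a b ` S" if "x \<in> S" for x
    using sub[OF that] by (metis imageI transpose_involutory)
  then show ?thesis using sub by blast
qed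

text \<open>The hyperedges of the hyperpath with \<open>q = k - 1\<close>; consecutive ones share
  the multiple of \<open>q\<close> between them.\<close>

definition block :: "nat \<Rightarrow> nat \<Rightarrow> nat set" where
  "block q i = {i * q..(i + 1) * q}"

lemma in_block: "v \<in> block q i \<longleftrightarrow> i * q \<le> v \<and> v \<le> (i + 1) * q"
  by (simp add: block_def)

lemma edges_hyperpath: "edges (hyperpath k r) = block (k - 1) ` {..<r}"
  by (simp add: hyperpath_def block_def)

text \<open>The grown part stays a hyperpath that begins at the root, provided the next hyperedge is
  attached to the last one, away from its first vertex. Elsewhere it would raise a joint to degree 3
  or create one branch vertex too many in an earlier hyperedge. The vertex used need not be the
  final one of the numbering, so the two are interchanged. The degree conditions concern all of
  \<open>H\<close> and thus apply at every stage.\<close>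

lemma grown_hyperpath_embedding:
  assumes "grown k r V E" "k \<ge> 2" "uniform k H" "E \<subseteq> edges H"
    and max_degree: "\<And>v. degree H v \<le> 2"
    and branch: "\<And>e. e \<in> edges H \<Longrightarrow> card {v \<in> e. 2 \<le> degree H v} \<le> 2"
    and root: "degree H r \<le> 1"
    and start: "\<And>e. e \<in> edges H \<Longrightarrow> r \<in> e \<Longrightarrow> card {v \<in> e. 2 \<le> degree H v} \<le> 1"
  shows "\<exists>\<phi>. bij_betw \<phi> {..<nverts (hyperpath k (card E))} V \<and>
     (`) \<phi> ` edges (hyperpath k (card E)) = E \<and> \<phi> 0 = r"
  using assms(1-4)
proof (induction)
  case root
  have "{..<Suc 0} = {0}" by auto
  then show ?case by (intro exI[of _ "\<lambda>_. r"]) (auto simp: hyperpath_0 bij_betw_def)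
next
  case (attach V E v e)
  define p where "p = card E"
  define q where "q = k - 1"
  have q: "q > 0" "k - 1 = q" using attach.prems by (auto simp: q_def)
  from attach obtain \<phi> where \<phi>: "bij_betw \<phi> {..<nverts (hyperpath k p)} V"
    "(`) \<phi> ` edges (hyperpath k p) = E" "\<phi> 0 = r" by (auto simp: p_def)
  have N: "nverts (hyperpath k p) = p * q + 1" unfolding hyperpath_nverts q(2) ..
  have inj: "\<phi> a = \<phi> b \<longleftrightarrow> a = b" if "a \<le> p * q" "b \<le> p * q" for a b
    using \<phi>(1) that unfolding N by (auto simp: bij_betw_def inj_on_def)
  have new: "e \<notin> E" using attach_new[OF attach.hyps(1) attach.prems(1) attach.hyps(3,5)] .
  have card: "card (insert e E) = Suc p"
    using new grown_basic(2)[OF attach.hyps(1)] by (simp add: p_def)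
  have eH: "e \<in> edges H" and EH: "E \<subseteq> edges H" using attach.prems by auto
  have ve: "v \<in> e" using attach.hyps(3) by blast
  have blk: "\<phi> ` block q j \<in> E" if "j < p" for j
    using that unfolding \<phi>(2)[symmetric] edges_hyperpath q(2) by blast
  have blk_ne: "\<phi> ` block q j \<noteq> \<phi> ` block q (j + 1)" if "j + 1 < p" for j
  proof
    assume eq: "\<phi> ` block q j = \<phi> ` block q (j + 1)"
    have "(j + 2) * q \<le> p * q" using that by (intro mult_right_mono) auto
    have "\<phi> (j * q) \<in> \<phi> ` block q (j + 1)" unfolding eq[symmetric] by (auto simp: in_block)
    then obtain s where s: "(j + 1) * q \<le> s" "s \<le> (j + 2) * q" "\<phi> (j * q) = \<phi> s"
      by (auto simp: in_block)
    have "j * q \<le> p * q" using that by simp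
    then have "j * q = s" using inj[of "j * q" s] s \<open>(j + 2) * q \<le> p * q\<close> by linarith
    then show False using s(1) q by simp
  qed
  have joint: "2 \<le> degree H (\<phi> ((j + 1) * q))" if "j + 1 < p" for j
  proof (rule two_le_degree[OF attach.prems(2)])
    show "\<phi> ` block q j \<in> edges H" "\<phi> ` block q (j + 1) \<in> edges H"
      using blk[of j] blk[of "j + 1"] that EH by auto
  qed (use blk_ne[OF that] in \<open>auto simp: in_block\<close>)
  obtain t where t: "t \<le> p * q" "\<phi> t = v"
    using \<phi>(1) attach.hyps(2) unfolding N by (auto simp: bij_betw_def less_Suc_eq_le)
  have "\<exists>\<phi>'. bij_betw \<phi>' {..<nverts (hyperpath k p)} V \<and> (`) \<phi>' ` edges (hyperpath k p) = E \<and>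
      \<phi>' 0 = r \<and> \<phi>' (p * q) = v"
  proof (cases "p = 0")
    case True
    then show ?thesis using \<phi> t by auto
  next
    case False
    have "t \<noteq> 0"
    proof
      assume "t = 0"
      moreover have "\<phi> 0 \<in> \<phi> ` block q 0" by (auto simp: in_block)
      ultimately have "2 \<le> degree H r"
        using blk[of 0] False t EH eH new ve \<phi>(3)
        by (intro two_le_degree[OF attach.prems(2), of e "\<phi> ` block q 0"]) auto
      then show False using assms(7) by simp
    qed
    have t_gt: "t > (p - 1) * q"
    proof (rule ccontr)
      assume le: "\<not> t > (p - 1) * q"
      \<comment> \<open>The block that contains \<open>t\<close> other than as its left end;
        subtracting 1 assigns a joint to the block on its left.\<close>
      define j where "j = (t - 1) div q"
      have j1: "j * q < t" using \<open>t \<noteq> 0\<close> div_times_less_eq_dividend[of "t - 1" q] unfolding j_def by linarith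
      have "t - 1 < (j + 1) * q" using q dividend_less_div_times[of q "t - 1"] unfolding j_def by simp
      then have j2: "t \<le> (j + 1) * q" by simp
      have "j * q < (p - 1) * q" using j1 le by linarith
      then have "j < p - 1" by simp
      then have jp: "j + 1 < p" by linarith
      have jp': "(j + 1) * q \<le> p * q" "j * q \<le> p * q"
        by (rule mult_right_mono; use jp in linarith)+
      have vj: "v \<in> \<phi> ` block q j" using j1 j2 t by (intro image_eqI[of _ _ t]) (auto simp: in_block)
      have EHj: "\<phi> ` block q j \<in> edges H" using blk[of j] jp EH by auto
      have deg_v: "2 \<le> degree H v"
        using EHj vj ve eH new blk[of j] jp
        by (intro two_le_degree[OF attach.prems(2), of e "\<phi> ` block q j"]) auto
      show False
      \<comment> \<open>At a joint the new hyperedge is the third one. Any other \<open>t\<close> is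
        a branch vertex of block \<open>j\<close> in addition to the joints of that block.\<close>
      proof (cases "t = (j + 1) * q")
        case True
        then have "v \<in> \<phi> ` block q (j + 1)" using t by (intro image_eqI[of _ _ t]) (auto simp: in_block)
        moreover have E1: "\<phi> ` block q (j + 1) \<in> E" using blk[of "j + 1"] jp by simp
        ultimately have "3 \<le> degree H v"
          using EHj E1 EH vj ve eH new blk[of j] jp blk_ne[OF jp]
          by (intro three_le_degree[OF attach.prems(2), of e "\<phi> ` block q j"
                "\<phi> ` block q (j + 1)"]) auto
        then show False using max_degree[of v] by simp
      next
        case ne: False
        let ?S = "{v \<in> \<phi> ` block q j. 2 \<le> degree H v}"
        have fin: "finite ?S" by (simp add: block_def)
        have d1: "\<phi> ((j + 1) * q) \<noteq> v" using inj[of "(j + 1) * q" t] t jp' ne by auto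
        show False
        \<comment> \<open>The first block has only one joint, but it contains the root, and
          \<open>start\<close> admits only one branch vertex there.\<close>
        proof (cases "j = 0")
          case True
          have "{v, \<phi> ((j + 1) * q)} \<subseteq> ?S"
            using vj deg_v joint[OF jp] by (auto simp: in_block)
          then have "card {v, \<phi> ((j + 1) * q)} \<le> card ?S" using fin by (intro card_mono)
          moreover have "r \<in> \<phi> ` block q j" using True \<phi>(3) by (auto simp: in_block)
          ultimately show False using start[OF EHj] d1 by simp
        next
          case False
          then obtain i where i: "j = i + 1" by (metis Suc_eq_plus1 not0_implies_Suc)
          have d2: "2 \<le> degree H (\<phi> (j * q))" using joint[of i] i jp by simp
          have d3: "\<phi> (j * q) \<noteq> v" using inj[of "j * q" t] t jp' j1 by auto
          have d4: "\<phi> (j * q) \<noteq> \<phi> ((j + 1) * q)" using inj[of "j * q" "(j + 1) * q"] jp' q by auto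
          have "{v, \<phi> ((j + 1) * q), \<phi> (j * q)} \<subseteq> ?S"
            using vj deg_v joint[OF jp] d2 by (auto simp: in_block)
          then have "card {v, \<phi> ((j + 1) * q), \<phi> (j * q)} \<le> card ?S" using fin by (intro card_mono)
          moreover have "card {v, \<phi> ((j + 1) * q), \<phi> (j * q)} = 3" using d1 d3 d4 by auto
          ultimately show False using branch[OF EHj] by simp
        qed
      qed
    qed
    \<comment> \<open>Interchanging \<open>t\<close> with the final vertex fixes every block as a
      set: the last block contains both vertices, the others neither.\<close>
    let ?\<tau> = "transpose t (p * q)"
    have bl: "?\<tau> ` block q j = block q j" if "j < p" for j
    proof (rule transpose_image_same)
      show "t \<in> block q j \<longleftrightarrow> p * q \<in> block q j"
      proof (cases "j + 1 = p")
        case True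
        then have "p - 1 = j" by simp
        then show ?thesis using t_gt t(1) True by (auto simp: in_block)
      next
        case False
        then have "(j + 1) * q \<le> (p - 1) * q" using that by (intro mult_right_mono) auto
        moreover have "(p - 1) * q < p * q" using \<open>p \<noteq> 0\<close> q by simp
        ultimately have "\<not> t \<le> (j + 1) * q" "\<not> p * q \<le> (j + 1) * q" using t_gt by linarith+
        then show ?thesis by (simp only: in_block) simp
      qed
    qed
    have "?\<tau> ` {..<nverts (hyperpath k p)} = {..<nverts (hyperpath k p)}"
      using t(1) by (intro transpose_image_same) (simp add: N)
    then have "bij_betw ?\<tau> {..<nverts (hyperpath k p)} {..<nverts (hyperpath k p)}"
      by (simp add: bij_betw_def)
    from bij_betw_trans[OF this \<phi>(1)]
    have "bij_betw (\<phi> \<circ> ?\<tau>) {..<nverts (hyperpath k p)} V" .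
    moreover have "(`) (\<phi> \<circ> ?\<tau>) ` edges (hyperpath k p) = E"
    proof -
      have "(\<phi> \<circ> ?\<tau>) ` f = \<phi> ` f" if f: "f \<in> edges (hyperpath k p)" for f
      proof -
        obtain j where "j < p" "f = block q j" using f unfolding edges_hyperpath q(2) by blast
        then show ?thesis using bl[of j] by (metis image_comp)
      qed
      then have "(`) (\<phi> \<circ> ?\<tau>) ` edges (hyperpath k p) = (`) \<phi> ` edges (hyperpath k p)"
        by (rule image_cong[OF refl])
      then show ?thesis using \<phi>(2) by simp
    qed
    moreover have "(\<phi> \<circ> ?\<tau>) 0 = r" using \<open>t \<noteq> 0\<close> \<open>p \<noteq> 0\<close> q \<phi>(3) by (simp add: transpose_def)
    moreover have "(\<phi> \<circ> ?\<tau>) (p * q) = v" using t by simp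
    ultimately show ?thesis by blast
  qed
  then obtain \<phi>' where \<phi>': "bij_betw \<phi>' {..<nverts (hyperpath k p)} V"
    "(`) \<phi>' ` edges (hyperpath k p) = E" "\<phi>' 0 = r" "\<phi>' (p * q) = v" by blast
  have "\<exists>\<psi>. bij_betw \<psi> {..<nverts (attach_pendant k (hyperpath k p) (p * q))} (V \<union> e) \<and>
    (`) \<psi> ` edges (attach_pendant k (hyperpath k p) (p * q)) = insert e E \<and>
    (\<forall>t<nverts (hyperpath k p). \<psi> t = \<phi>' t)"
  proof (rule attach_embedding[OF \<phi>'(1,2)])
    show "f \<subseteq> {..<nverts (hyperpath k p)}" if "f \<in> edges (hyperpath k p)" for f
      using grown_basic(4)[OF hyperpath_grown[OF attach.prems(1)] that] by blast
    show "e \<inter> V = {\<phi>' (p * q)}" unfolding \<phi>'(4) by (rule attach.hyps(3))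
  qed (simp_all add: N attach.hyps(4,5))
  then show ?case unfolding card hyperpath_Suc[OF attach.prems(1)] q(2) using \<phi>'(3)
    by (metis N add_gr_0 less_one)
qed

text \<open>A vertex \<open>v\<close> can only lie in the block with index \<open>v div q\<close>
  and, if it is a multiple of \<open>q\<close>, in the preceding one.\<close>

lemma degree_hyperpath:
  assumes "k \<ge> 2"
  shows "degree (hyperpath k m) v \<le> 2"
    and "2 \<le> degree (hyperpath k m) v \<Longrightarrow> (k - 1) dvd v"
proof -
  define q where "q = k - 1"
  have q: "q > 0" using assms by (simp add: q_def)
  let ?b = "\<lambda>i. block q i"
  have idx: "i = v div q \<or> i = v div q - 1 \<and> q dvd v" if "v \<in> ?b i" for i
  proof (cases "v = (i + 1) * q")
    case True
    then have "v div q = i + 1" using q by (metis div_mult_self_is_m)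
    then show ?thesis using True by (metis add_diff_cancel_right' dvd_triv_right)
  next
    case False
    then have "i * q \<le> v" "v < (i + 1) * q" using that by (auto simp: in_block)
    then have "v div q = i" using q by (intro div_nat_eqI) (auto simp: mult.commute)
    then show ?thesis by simp
  qed
  have sub: "{e \<in> edges (hyperpath k m). v \<in> e} \<subseteq> ?b ` {v div q - 1, v div q}"
    using idx unfolding edges_hyperpath q_def[symmetric] by blast
  have "degree (hyperpath k m) v \<le> card (?b ` {v div q - 1, v div q})"
    unfolding degree_def by (rule card_mono[OF _ sub]) auto
  also have "\<dots> \<le> card {v div q - 1, v div q}" by (rule card_image_le) auto
  also have "\<dots> \<le> 2" using card_length[of "[v div q - 1, v div q]"] by simp
  finally show "degree (hyperpath k m) v \<le> 2" .
  show "(k - 1) dvd v" if "2 \<le> degree (hyperpath k m) v"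
  proof (rule ccontr)
    assume "\<not> (k - 1) dvd v"
    then have "{e \<in> edges (hyperpath k m). v \<in> e} \<subseteq> {?b (v div q)}"
      using idx unfolding edges_hyperpath q_def[symmetric] by blast
    then have "degree (hyperpath k m) v \<le> card {?b (v div q)}"
      unfolding degree_def by (intro card_mono) auto
    then show False using that by simp
  qed
qed

lemma hyperpath_branch_vertices:
  assumes "k \<ge> 2" "e \<in> edges (hyperpath k m)"
  shows "card {v \<in> e. 2 \<le> degree (hyperpath k m) v} \<le> 2"
    and "m \<ge> 2 \<Longrightarrow> \<exists>v\<in>e. 2 \<le> degree (hyperpath k m) v"
proof -
  define q where "q = k - 1"
  have q: "q > 0" using assms by (simp add: q_def)
  obtain i where i: "i < m" "e = block q i"
    using assms(2) unfolding edges_hyperpath q_def by blast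
  have "v = i * q \<or> v = (i + 1) * q" if "v \<in> e" "2 \<le> degree (hyperpath k m) v" for v
  proof -
    have "q dvd v" using degree_hyperpath(2)[OF assms(1) that(2)] by (simp add: q_def)
    then obtain c where c: "v = c * q" by (metis dvdE mult.commute)
    then have "i \<le> c" "c \<le> i + 1" using that(1) q unfolding i(2) in_block by (simp_all del: mult_Suc)
    then show ?thesis using c by (metis le_antisym not_less_eq_eq Suc_eq_plus1)
  qed
  then have "{v \<in> e. 2 \<le> degree (hyperpath k m) v} \<subseteq> {i * q, (i + 1) * q}" by blast
  then have "card {v \<in> e. 2 \<le> degree (hyperpath k m) v} \<le> card {i * q, (i + 1) * q}"
    by (intro card_mono) auto
  also have "\<dots> \<le> 2" using card_length[of "[i * q, (i + 1) * q]"] by simp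
  finally show "card {v \<in> e. 2 \<le> degree (hyperpath k m) v} \<le> 2" .
  have uni: "uniform k (hyperpath k m)"
    using hyperpath_hypertree[OF assms(1)] by (simp add: uniform_hypertrees_def)
  have joint: "2 \<le> degree (hyperpath k m) ((j + 1) * q)" if "j + 1 < m" for j
  proof (rule two_le_degree[OF uni])
    show "block q j \<in> edges (hyperpath k m)" "block q (j + 1) \<in> edges (hyperpath k m)"
      using that unfolding edges_hyperpath q_def[symmetric] by auto
    have "j * q \<notin> block q (j + 1)" using q by (simp add: in_block)
    moreover have "j * q \<in> block q j" by (simp add: in_block)
    ultimately show "block q j \<noteq> block q (j + 1)" by blast
  qed (auto simp: in_block)
  assume "m \<ge> 2"
  show "\<exists>v\<in>e. 2 \<le> degree (hyperpath k m) v"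
  proof (cases "i + 1 < m")
    case True
    then show ?thesis using joint[OF True] i(2) by (intro bexI[of _ "(i + 1) * q"]) (auto simp: in_block)
  next
    case False
    then obtain j where "i = j + 1" using \<open>m \<ge> 2\<close> i(1) by (cases i) auto
    then show ?thesis using joint[of j] i by (intro bexI[of _ "(j + 1) * q"]) (auto simp: in_block)
  qed
qed

section \<open>Degree sums of hypertrees\<close>

definition degree_power_sum :: "nat \<Rightarrow> hypergraph \<Rightarrow> real" where
  "degree_power_sum j H = (\<Sum>v<nverts H. real (degree H v) ^ j)"

definition degree_pair_sum :: "hypergraph \<Rightarrow> real" where
  "degree_pair_sum H = (\<Sum>e\<in>edges H. \<Sum>K | K \<subseteq> e \<and> card K = 2. \<Prod>v\<in>K. real (degree H v))"

text \<open>The part of the degree that is free to vary: in a hypertree with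
  \<open>m \<ge> 1\<close> hyperedges all degrees are positive, and the excesses sum to
  \<open>m - 1\<close>.\<close>

definition excess :: "hypergraph \<Rightarrow> nat \<Rightarrow> nat" where
  "excess H v = degree H v - 1"

text \<open>Newton's identity between the second elementary symmetric sum and the first two power
  sums.\<close>

lemma pair_sum_square:
  fixes y :: "'a \<Rightarrow> real"
  assumes "finite A"
  shows "2 * (\<Sum>K | K \<subseteq> A \<and> card K = 2. \<Prod>v\<in>K. y v) = (\<Sum>v\<in>A. y v)\<^sup>2 - (\<Sum>v\<in>A. (y v)\<^sup>2)"
  using assms
proof (induction A)
  case empty
  have "{K. K \<subseteq> {} \<and> card K = 2} = {}" by auto
  then show ?case by simp
next
  case (insert a A)
  let ?P = "\<lambda>A. {K. K \<subseteq> A \<and> card K = 2}"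
  have fin: "finite (?P A)" using insert by simp
  have "?P (insert a A) = ?P A \<union> (\<lambda>b. {a, b}) ` A"
  proof (intro Set.set_eqI iffI)
    fix K assume K: "K \<in> ?P (insert a A)"
    show "K \<in> ?P A \<union> (\<lambda>b. {a, b}) ` A"
    proof (cases "a \<in> K")
      case True
      then obtain b where "K = {a, b}" "a \<noteq> b" using K by (auto simp: card_2_iff)
      then show ?thesis using K by auto
    qed (use K in auto)
  qed (use insert in \<open>auto simp: card_2_iff\<close>)
  moreover have "?P A \<inter> (\<lambda>b. {a, b}) ` A = {}" using insert by auto
  ultimately have "(\<Sum>K\<in>?P (insert a A). \<Prod>v\<in>K. y v) =
      (\<Sum>K\<in>?P A. \<Prod>v\<in>K. y v) + (\<Sum>K\<in>(\<lambda>b. {a, b}) ` A. \<Prod>v\<in>K. y v)"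
    using fin insert by (simp add: sum.union_disjoint)
  also have "(\<Sum>K\<in>(\<lambda>b. {a, b}) ` A. \<Prod>v\<in>K. y v) = (\<Sum>b\<in>A. \<Prod>v\<in>{a, b}. y v)"
    by (subst sum.reindex) (auto simp: inj_on_def doubleton_eq_iff)
  also have "\<dots> = (\<Sum>b\<in>A. y a * y b)"
  proof (rule sum.cong[OF refl])
    fix b assume "b \<in> A"
    then have "a \<noteq> b" using insert.hyps by auto
    then show "(\<Prod>v\<in>{a, b}. y v) = y a * y b" by simp
  qed
  also have "\<dots> = y a * (\<Sum>b\<in>A. y b)" by (simp add: sum_distrib_left)
  finally show ?case using insert by (simp add: power2_eq_square algebra_simps)
qed

lemma sum_square_le_square_sum:
  fixes x :: "'a \<Rightarrow> nat"
  assumes "finite A"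
  shows "(\<Sum>v\<in>A. (x v)\<^sup>2) \<le> (\<Sum>v\<in>A. x v)\<^sup>2"
  using assms by (induction A) (auto simp: power2_eq_square algebra_simps)

text \<open>Single out one positive value \<open>c + 1\<close> and bound the squares of the others
  by the square of their sum \<open>d + 1\<close>. As \<open>s = c + 1 + d\<close>, the claimed
  bound exceeds the sum of these two squares by \<open>2 * c * d\<close>.\<close>

lemma sum_square_bound:
  fixes x :: "'a \<Rightarrow> nat"
  assumes "finite A" "(\<Sum>v\<in>A. x v) = Suc s" "s \<ge> 1" "\<And>v. v \<in> A \<Longrightarrow> x v \<le> s"
  shows "(\<Sum>v\<in>A. (x v)\<^sup>2) \<le> s\<^sup>2 + 1"
proof -
  obtain a where a: "a \<in> A" "x a > 0" using assms(2) by (metis Zero_not_Suc gr0I sum.neutral)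
  have split: "(\<Sum>v\<in>A. x v) = x a + (\<Sum>v\<in>A - {a}. x v)"
    "(\<Sum>v\<in>A. (x v)\<^sup>2) = (x a)\<^sup>2 + (\<Sum>v\<in>A - {a}. (x v)\<^sup>2)"
    using assms(1) a by (auto intro: sum.remove)
  obtain c where c: "x a = Suc c" using a by (cases "x a") auto
  obtain d where d: "s = x a + d" using assms(4)[OF a(1)] le_Suc_ex by blast
  have "(\<Sum>v\<in>A - {a}. x v) = Suc d" using split(1) assms(2) d by simp
  then have "(\<Sum>v\<in>A - {a}. (x v)\<^sup>2) \<le> (Suc d)\<^sup>2"
    using sum_square_le_square_sum[of "A - {a}" x] assms(1) by simp
  then show ?thesis unfolding split(2) d c by (simp add: power2_eq_square algebra_simps)
qed

text \<open>The right side is the chord of a convex function through 0 and 1. Equality at excess 0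
  and 1 makes the bound sharp for hypertrees whose degrees are at most 2.\<close>

lemma power_Suc_ge_linear:
  assumes "x \<ge> 1"
  shows "real (Suc x) ^ j \<ge> 1 + (2 ^ j - 1) * real x"
proof (induction j)
  case (Suc j)
  have "0 \<le> (2 ^ j - 1) * (real x * (real x - 1))" using assms by auto
  then have "1 + (2 ^ Suc j - 1) * real x \<le> real (Suc x) * (1 + (2 ^ j - 1) * real x)"
    by (simp add: algebra_simps)
  also have "\<dots> \<le> real (Suc x) * real (Suc x) ^ j"
    using Suc by (intro mult_left_mono) auto
  finally show ?case by simp
qed simp

section \<open>Excesses in a fixed hypertree\<close>

locale uniform_hypertree =
  fixes k m :: nat and H :: hypergraph
  assumes H: "H \<in> uniform_hypertrees k m" and k: "k \<ge> 2" and m: "m \<ge> 1"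
begin

lemma uni: "uniform k H" and card_edges: "card (edges H) = m"
  using H by (auto simp: uniform_hypertrees_def)

lemma edge: "e \<in> edges H \<Longrightarrow> e \<subseteq> {..<nverts H} \<and> finite e \<and> card e = k"
  using uni by (auto simp: uniform_def intro: finite_subset)

lemma fin_edges: "finite (edges H)" by (rule finite_edges[OF uni])

lemma grown: "r < nverts H \<Longrightarrow> grown k r {..<nverts H} (edges H)"
  by (rule uniform_hypertree_grown[OF H k])

lemma nverts_pos: "nverts H > 0"
proof -
  have "edges H \<noteq> {}" using card_edges m by auto
  then obtain e where e: "e \<in> edges H" by blast
  then have "e \<noteq> {}" using edge k by fastforce
  then show ?thesis using edge[OF e] by auto
qed

lemma nverts: "nverts H = m * (k - 1) + 1"
  using grown_card[OF grown[OF nverts_pos] k] card_edges by simp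

lemma degree_pos:
  assumes "v < nverts H"
  shows "degree H v \<ge> 1"
proof -
  have "1 * 1 \<le> m * (k - 1)" using m k by (intro mult_le_mono) auto
  then have "2 \<le> nverts H" unfolding nverts by simp
  \<comment> \<open>Rooting the tree at a vertex other than \<open>v\<close> makes \<open>v\<close>
    a vertex that entered with some hyperedge.\<close>
  define r where "r = (if v = 0 then 1 else 0 :: nat)"
  have r: "r < nverts H" "r \<noteq> v" using \<open>2 \<le> nverts H\<close> by (auto simp: r_def)
  then obtain e where "e \<in> edges H" "v \<in> e"
    using grown_basic(5)[OF grown[OF r(1)], of v] assms by auto
  then have "{e \<in> edges H. v \<in> e} \<noteq> {}" by blast
  then show ?thesis unfolding degree_def using fin_edges by (simp add: Suc_le_eq card_gt_0_iff)
qed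

lemma degree_excess: "v < nverts H \<Longrightarrow> degree H v = Suc (excess H v)"
  using degree_pos[of v] by (simp add: excess_def)

text \<open>The degrees sum to \<open>k * m\<close>, and subtracting the number
  \<open>m * (k - 1) + 1\<close> of vertices leaves \<open>m - 1\<close>.\<close>

lemma sum_excess: "(\<Sum>v<nverts H. excess H v) = m - 1"
proof -
  have "(\<Sum>v<nverts H. degree H v) = (\<Sum>e\<in>edges H. card e)"
    using sum_edges[OF uni, of "\<lambda>_. 1 :: nat"] by simp
  also have "\<dots> = k * m" using edge by (simp add: card_edges)
  finally have 1: "(\<Sum>v<nverts H. degree H v) = k * m" .
  have "(\<Sum>v<nverts H. degree H v) = (\<Sum>v<nverts H. excess H v) + nverts H"
    by (simp add: degree_excess sum_Suc)
  moreover obtain i where "k = Suc i" using k by (cases k) auto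
  moreover obtain j where "m = Suc j" using m by (cases m) auto
  ultimately show ?thesis using 1 by (simp add: nverts algebra_simps)
qed

lemma sum_excess_real: "(\<Sum>v<nverts H. real (excess H v)) = real (m - 1)"
  unfolding sum_excess[symmetric] by simp

lemma excess_le: "v < nverts H \<Longrightarrow> excess H v \<le> m - 1"
  using degree_le[OF uni, of v] card_edges by (simp add: excess_def)

lemma degree_power_sum_2:
  "degree_power_sum 2 H = real (nverts H + 2 * (m - 1) + (\<Sum>v<nverts H. (excess H v)\<^sup>2))"
proof -
  have "degree_power_sum 2 H = (\<Sum>v<nverts H. real (1 + 2 * excess H v + (excess H v)\<^sup>2))"
    unfolding degree_power_sum_def
    by (intro sum.cong refl) (simp add: degree_excess power2_eq_square algebra_simps)
  also have "\<dots> = real (\<Sum>v<nverts H. 1 + 2 * excess H v + (excess H v)\<^sup>2)" by simp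
  also have "(\<Sum>v<nverts H. 1 + 2 * excess H v + (excess H v)\<^sup>2) =
      nverts H + 2 * (\<Sum>v<nverts H. excess H v) + (\<Sum>v<nverts H. (excess H v)\<^sup>2)"
    by (simp add: sum_Suc sum.distrib sum_distrib_left)
  finally show ?thesis unfolding sum_excess .
qed

lemma sum_excess_square_le: "(\<Sum>v<nverts H. (excess H v)\<^sup>2) \<le> (m - 1)\<^sup>2"
  using sum_square_le_square_sum[of "{..<nverts H}" "excess H"] by (simp add: sum_excess)

lemma sum_excess_square_split:
  assumes "c < nverts H"
  shows "(\<Sum>v<nverts H. (excess H v)\<^sup>2) \<ge> (excess H c)\<^sup>2 + (m - 1 - excess H c)"
proof -
  have "(\<Sum>v\<in>{..<nverts H} - {c}. excess H v) \<le> (\<Sum>v\<in>{..<nverts H} - {c}. (excess H v)\<^sup>2)"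
    by (intro sum_mono) (simp add: power2_eq_square)
  moreover have "(\<Sum>v\<in>{..<nverts H} - {c}. excess H v) = m - 1 - excess H c"
    using assms sum.remove[of "{..<nverts H}" c "excess H"] sum_excess by simp
  ultimately show ?thesis
    using assms sum.remove[of "{..<nverts H}" c "\<lambda>v. (excess H v)\<^sup>2"] by simp
qed

lemma degree_power_sum_ge:
  "degree_power_sum j H \<ge> real (nverts H) + (2 ^ j - 1) * real (m - 1)"
proof -
  have "real (nverts H) + (2 ^ j - 1) * real (m - 1) = (\<Sum>v<nverts H. 1 + (2 ^ j - 1) * real (excess H v))"
    by (simp add: sum.distrib sum_excess_real flip: sum_distrib_left)
  also have "\<dots> \<le> degree_power_sum j H"
    unfolding degree_power_sum_def
  proof (rule sum_mono)
    fix v assume "v \<in> {..<nverts H}"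
    then show "1 + (2 ^ j - 1) * real (excess H v) \<le> real (degree H v) ^ j"
      using power_Suc_ge_linear[of "excess H v" j]
      by (cases "excess H v = 0") (auto simp: degree_excess)
  qed
  finally show ?thesis .
qed

lemma degree_power_sum_eq:
  assumes "\<And>v. degree H v \<le> 2"
  shows "degree_power_sum j H = real (nverts H) + (2 ^ j - 1) * real (m - 1)"
proof -
  have "real (nverts H) + (2 ^ j - 1) * real (m - 1) = (\<Sum>v<nverts H. 1 + (2 ^ j - 1) * real (excess H v))"
    by (simp add: sum.distrib sum_excess_real flip: sum_distrib_left)
  also have "\<dots> = degree_power_sum j H"
    unfolding degree_power_sum_def
  proof (rule sum.cong[OF refl])
    fix v assume v: "v \<in> {..<nverts H}"
    then have "excess H v = 0 \<or> excess H v = 1" using assms[of v] by (auto simp: excess_def)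
    then show "1 + (2 ^ j - 1) * real (excess H v) = real (degree H v) ^ j"
      using v by (auto simp: degree_excess)
  qed
  finally show ?thesis by simp
qed

definition edge_excess :: "nat set \<Rightarrow> real" where
  "edge_excess e = (\<Sum>v\<in>e. real (excess H v))"

text \<open>By \<open>pair_sum_square\<close>, on a finite \<open>e\<close> this is twice the sum of
  the products of excesses over the pairs in \<open>e\<close>.\<close>

definition pair_excess :: "nat set \<Rightarrow> real" where
  "pair_excess e = (edge_excess e)\<^sup>2 - (\<Sum>v\<in>e. (real (excess H v))\<^sup>2)"

lemma sum_edge_excess:
  "(\<Sum>e\<in>edges H. edge_excess e) = (\<Sum>v<nverts H. (real (excess H v))\<^sup>2) + real (m - 1)"
proof -
  have "(\<Sum>e\<in>edges H. edge_excess e) = (\<Sum>v<nverts H. real (degree H v) * real (excess H v))"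
    unfolding edge_excess_def using sum_edges[OF uni, of "\<lambda>v. real (excess H v)"] by simp
  also have "\<dots> = (\<Sum>v<nverts H. (real (excess H v))\<^sup>2 + real (excess H v))"
    by (intro sum.cong refl) (simp add: degree_excess power2_eq_square algebra_simps)
  finally show ?thesis by (simp add: sum.distrib sum_excess_real)
qed

text \<open>Write each degree as 1 plus the excess and expand the products. The constant part counts
  pairs, and in the linear part every vertex of a hyperedge occurs in \<open>k - 1\<close>
  pairs.\<close>

lemma degree_pair_sum_eq:
  "2 * degree_pair_sum H = real m * (real k)\<^sup>2 - real m * real k +
     2 * (real k - 1) * (\<Sum>e\<in>edges H. edge_excess e) + (\<Sum>e\<in>edges H. pair_excess e)"
proof -
  have "2 * (\<Sum>K | K \<subseteq> e \<and> card K = 2. \<Prod>v\<in>K. real (degree H v)) =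
      ((real k)\<^sup>2 - real k) + 2 * (real k - 1) * edge_excess e + pair_excess e" if "e \<in> edges H" for e
  proof -
    have e: "finite e" "card e = k" "e \<subseteq> {..<nverts H}" using edge[OF that] by auto
    have "real (degree H v) = 1 + real (excess H v)" if "v \<in> e" for v
      using degree_excess[of v] e(3) that by auto
    then have 1: "(\<Sum>v\<in>e. real (degree H v)) = real k + edge_excess e"
      and 2: "(\<Sum>v\<in>e. (real (degree H v))\<^sup>2) = real k + 2 * edge_excess e + (\<Sum>v\<in>e. (real (excess H v))\<^sup>2)"
      using e by (simp_all add: sum.distrib edge_excess_def power2_sum sum_distrib_left)
    show ?thesis unfolding pair_sum_square[OF e(1)] 1 2 pair_excess_def
      by (simp add: power2_eq_square algebra_simps)
  qed
  then have "2 * degree_pair_sum H = (\<Sum>e\<in>edges H. ((real k)\<^sup>2 - real k) +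
      2 * (real k - 1) * edge_excess e + pair_excess e)"
    unfolding degree_pair_sum_def by (simp add: sum_distrib_left)
  also have "\<dots> = real m * ((real k)\<^sup>2 - real k) +
      2 * (real k - 1) * (\<Sum>e\<in>edges H. edge_excess e) + (\<Sum>e\<in>edges H. pair_excess e)"
    by (simp add: sum.distrib card_edges flip: sum_distrib_left)
  finally show ?thesis by (simp add: algebra_simps)
qed

lemma edge_excess_card:
  assumes "\<And>v. degree H v \<le> 2" "e \<in> edges H"
  shows "edge_excess e = real (card {v \<in> e. 2 \<le> degree H v})"
    and "pair_excess e = (edge_excess e)\<^sup>2 - edge_excess e"
proof -
  have fin: "finite e" using edge assms(2) by blast
  have ex: "excess H v = (if 2 \<le> degree H v then 1 else 0)" for v
    using assms(1)[of v] by (auto simp: excess_def)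
  then show "edge_excess e = real (card {v \<in> e. 2 \<le> degree H v})"
    unfolding edge_excess_def using fin by (simp add: if_distrib[of real] sum.If_cases Int_def cong: if_cong)
  have "(real (excess H v))\<^sup>2 = real (excess H v)" for v by (simp add: ex)
  then show "pair_excess e = (edge_excess e)\<^sup>2 - edge_excess e"
    unfolding pair_excess_def edge_excess_def by (simp only:)
qed

lemma sum_edge_excess_max_degree_2:
  assumes "\<And>v. degree H v \<le> 2"
  shows "(\<Sum>e\<in>edges H. edge_excess e) = 2 * real (m - 1)"
proof -
  have "(real (excess H v))\<^sup>2 = real (excess H v)" for v
    using assms[of v] by (cases "excess H v = 0") (auto simp: excess_def power2_eq_square)
  then show ?thesis unfolding sum_edge_excess by (simp only: sum_excess_real)
qed

text \<open>With \<open>t\<close> branch vertices a hyperedge contributes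
  \<open>t * (t - 1) = (t - 1) * (t - 2) + 2 * t - 2\<close>, and the sum of all \<open>t\<close> is
  \<open>2 * (m - 1)\<close>. In this form the variable part is nonnegative and vanishes exactly
  when \<open>t\<close> is 1 or 2 on every hyperedge.\<close>

lemma sum_pair_excess_max_degree_2:
  assumes "\<And>v. degree H v \<le> 2"
  shows "(\<Sum>e\<in>edges H. pair_excess e) =
    2 * real m - 4 + (\<Sum>e\<in>edges H. (edge_excess e - 1) * (edge_excess e - 2))"
proof -
  have "(\<Sum>e\<in>edges H. pair_excess e) =
      (\<Sum>e\<in>edges H. (edge_excess e - 1) * (edge_excess e - 2) + 2 * edge_excess e - 2)"
    using edge_excess_card(2)[OF assms] by (intro sum.cong refl) (simp add: power2_eq_square algebra_simps)
  also have "\<dots> = (\<Sum>e\<in>edges H. (edge_excess e - 1) * (edge_excess e - 2)) +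
      2 * (\<Sum>e\<in>edges H. edge_excess e) - 2 * real m"
    by (simp add: sum.distrib sum_subtractf card_edges flip: sum_distrib_left)
  finally show ?thesis using m
    unfolding sum_edge_excess_max_degree_2[OF assms] by (simp add: of_nat_diff)
qed

text \<open>Every vertex other than \<open>w\<close> pairs with its parent in the tree rooted at \<open>w\<close>, and
  the parent has positive excess.\<close>

lemma sum_pair_excess_ge:
  assumes "w < nverts H" "excess H w \<ge> 1"
  shows "(\<Sum>e\<in>edges H. pair_excess e) \<ge> 2 * real (m - 1 - excess H w)"
proof -
  have *: "(\<Sum>e\<in>E. pair_excess e) \<ge> 2 * (\<Sum>u\<in>V - {w}. real (excess H u))"
    if "grown k w V E" "E \<subseteq> edges H" for V E
    using that
  proof (induction)
    case root
    then show ?case by simp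
  next
    case (attach V E v e)
    let ?x = "\<lambda>v. real (excess H v)"
    have new: "e \<notin> E" using attach_new[OF attach.hyps(1) k attach.hyps(3,5)] .
    have fin: "finite V" "finite E" using grown_basic[OF attach.hyps(1)] by auto
    have wV: "w \<in> V" using grown_basic(3)[OF attach.hyps(1)] .
    have ve: "v \<in> e" using attach.hyps(3) by blast
    \<comment> \<open>Unless it is the root, the attachment vertex also lies on the hyperedge with
      which it entered.\<close>
    have "excess H v \<ge> 1"
    proof (cases "v = w")
      case False
      then obtain f where "f \<in> E" "v \<in> f" using grown_basic(5)[OF attach.hyps(1,2)] by blast
      then have "2 \<le> degree H v"
        using new ve attach.prems by (intro two_le_degree[OF uni, of e f]) auto
      then show ?thesis by (simp add: excess_def)
    qed (use assms in simp)
    then have xv: "?x v \<ge> 1" by simp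
    define s where "s = (\<Sum>u\<in>e - {v}. ?x u)"
    have "s \<ge> 0" unfolding s_def by (intro sum_nonneg) auto
    have "(\<Sum>u\<in>e - {v}. (excess H u)\<^sup>2) \<le> (\<Sum>u\<in>e - {v}. excess H u)\<^sup>2"
      using attach.hyps(4) by (intro sum_square_le_square_sum) auto
    then have "real (\<Sum>u\<in>e - {v}. (excess H u)\<^sup>2) \<le> real ((\<Sum>u\<in>e - {v}. excess H u)\<^sup>2)"
      by (rule of_nat_mono)
    then have sq: "(\<Sum>u\<in>e - {v}. (?x u)\<^sup>2) \<le> s\<^sup>2" by (simp add: s_def)
    have "edge_excess e = ?x v + s" "(\<Sum>u\<in>e. (?x u)\<^sup>2) = (?x v)\<^sup>2 + (\<Sum>u\<in>e - {v}. (?x u)\<^sup>2)"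
      using sum.remove[OF attach.hyps(4) ve] by (simp_all add: edge_excess_def s_def)
    then have "pair_excess e = 2 * ?x v * s + (s\<^sup>2 - (\<Sum>u\<in>e - {v}. (?x u)\<^sup>2))"
      by (simp add: pair_excess_def power2_sum)
    moreover have "2 * 1 * s \<le> 2 * ?x v * s" using xv \<open>s \<ge> 0\<close> by (intro mult_right_mono) auto
    ultimately have pe: "pair_excess e \<ge> 2 * s" using sq by linarith
    have "V \<union> e - {w} = (V - {w}) \<union> (e - {v})" "(V - {w}) \<inter> (e - {v}) = {}"
      using attach.hyps(2,3) wV by blast+
    then have "(\<Sum>u\<in>V \<union> e - {w}. ?x u) = (\<Sum>u\<in>V - {w}. ?x u) + s"
      unfolding s_def using fin attach.hyps(4) by (simp add: sum.union_disjoint)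
    then show ?case using attach pe new fin by simp
  qed
  have "(\<Sum>u\<in>{..<nverts H} - {w}. excess H u) = m - 1 - excess H w"
    using assms(1) sum.remove[of "{..<nverts H}" w "excess H"] sum_excess by simp
  then show ?thesis using *[OF grown[OF assms(1)]] by (simp flip: of_nat_sum)
qed

text \<open>The numbers of branch vertices per hyperedge sum to \<open>2 * (m - 1) < 2 * m\<close>,
  so some hyperedge has at most one. It has a vertex that is not a branch vertex, and from there the
  hyperpath is grown.\<close>

lemma isomorphic_hyperpath:
  assumes "m \<ge> 2" and max_degree: "\<And>v. degree H v \<le> 2"
    and branch: "\<And>e. e \<in> edges H \<Longrightarrow> card {v \<in> e. 2 \<le> degree H v} \<le> 2"
  shows "isomorphic H (hyperpath k m)"
proof -
  have "\<exists>e\<in>edges H. edge_excess e < 2"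
  proof (rule ccontr)
    assume "\<not> ?thesis"
    then have "(\<Sum>e\<in>edges H. 2) \<le> (\<Sum>e\<in>edges H. edge_excess e)" by (intro sum_mono) auto
    then show False using m by (simp add: sum_edge_excess_max_degree_2[OF max_degree] card_edges of_nat_diff)
  qed
  then obtain e where e: "e \<in> edges H" "card {v \<in> e. 2 \<le> degree H v} \<le> 1"
    using edge_excess_card(1)[OF max_degree] by fastforce
  have "{v \<in> e. 2 \<le> degree H v} \<noteq> e" using e(2) edge[OF e(1)] k by auto
  then obtain r where r: "r \<in> e" "degree H r \<le> 1" by fastforce
  have only: "f = e" if "f \<in> edges H" "r \<in> f" for f
    using two_le_degree[OF uni that(1) e(1) _ that(2) r(1)] r(2) by fastforce
  have "r < nverts H" using edge[OF e(1)] r by auto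
  then have "\<exists>\<phi>. bij_betw \<phi> {..<nverts (hyperpath k (card (edges H)))} {..<nverts H} \<and>
     (`) \<phi> ` edges (hyperpath k (card (edges H))) = edges H \<and> \<phi> 0 = r"
    using e(2) only r(2)
    by (intro grown_hyperpath_embedding[OF grown k uni order_refl max_degree branch]) auto
  then have "isomorphic (hyperpath k m) H" unfolding card_edges by (auto simp: isomorphic_def)
  then show ?thesis
    by (rule isomorphic_sym) (use grown_basic(4)[OF hyperpath_grown[OF k]] in blast)
qed

text \<open>The number of branch vertices is an integer, and none lies strictly between 1 and
  2.\<close>

lemma edge_excess_quadratic_nonneg:
  assumes "\<And>v. degree H v \<le> 2" "e \<in> edges H"
  shows "0 \<le> (edge_excess e - 1) * (edge_excess e - 2)"
proof -
  define t where "t = card {v \<in> e. 2 \<le> degree H v}"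
  have "t = 0 \<or> t = 1 \<or> t \<ge> 2" by linarith
  then show ?thesis unfolding edge_excess_card(1)[OF assms] t_def[symmetric] by auto
qed

end

section \<open>Degrees in the second smallest hypertree and the extremal degree sums\<close>

lemma F_tree_eq_attach: "F_tree m k = attach_pendant k (hyperpath k (m - 1)) k"
  by (simp add: F_tree_def)

text \<open>As \<open>m \<ge> 4\<close>, the underlying hyperpath has hyperedges on both sides of
  its second one. The ends of the latter are thus branch vertices already, and the attachment vertex
  becomes a third; no other hyperedge has more than two.\<close>

lemma F_tree_degrees:
  assumes k: "k \<ge> 3" and m: "m \<ge> 4"
  shows "degree (F_tree m k) v \<le> 2"
    and "e \<in> edges (F_tree m k) \<Longrightarrow> e \<noteq> {k - 1..2 * (k - 1)} \<Longrightarrow>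
      card {v \<in> e. 2 \<le> degree (F_tree m k) v} \<in> {1, 2}"
    and "{k - 1..2 * (k - 1)} \<in> edges (F_tree m k)"
    and "card {v \<in> {k - 1..2 * (k - 1)}. 2 \<le> degree (F_tree m k) v} = 3"
proof -
  let ?P = "hyperpath k (m - 1)"
  let ?new = "insert k {nverts ?P..<nverts ?P + (k - 1)}"
  have k2: "k \<ge> 2" using k by simp
  define q where "q = k - 1"
  have q: "k - 1 = q" "k = q + 1" "q \<ge> 2" using k by (auto simp: q_def)
  have n: "nverts ?P = (m - 1) * q + 1" by (simp only: hyperpath_nverts q(1))
  have "3 * q \<le> (m - 1) * q" using m by (intro mult_right_mono) auto
  then have kn: "k < nverts ?P" "2 * q < nverts ?P" unfolding n using q by linarith+
  \<comment> \<open>For \<open>k \<ge> 3\<close> vertex \<open>k\<close> is not a joint of the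
    hyperpath, so the attachment raises its degree to 2 only.\<close>
  have "\<not> (k - 1) dvd k"
  proof
    assume "(k - 1) dvd k"
    then have "q dvd q + 1" using q by simp
    then have "q dvd 1" by (metis dvd_add_right_iff dvd_refl)
    then show False using q(3) by simp
  qed
  then have dk: "degree ?P k \<le> 1" using degree_hyperpath(2)[OF k2, of "m - 1" k] by fastforce
  have deg: "degree (F_tree m k) v = (if v < nverts ?P then degree ?P v + (if v = k then 1 else 0)
     else if v < nverts ?P + (k - 1) then 1 else 0)" for v
    unfolding F_tree_eq_attach by (rule degree_attach_pendant[OF hyperpath_grown[OF k2] kn(1) k2])
  show "degree (F_tree m k) v \<le> 2"
    unfolding deg using degree_hyperpath(1)[OF k2, of "m - 1" v] dk by auto
  have second: "block q 1 = {k - 1..2 * (k - 1)}" unfolding block_def q(1) by (simp add: mult_2)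
  have "block q 1 \<in> edges ?P" unfolding edges_hyperpath q(1) using m by auto
  then show in_F: "{k - 1..2 * (k - 1)} \<in> edges (F_tree m k)"
    unfolding second F_tree_eq_attach attach_pendant_def by simp
  have k_block: "k \<in> block q 1" unfolding in_block using q by simp
  have uF: "uniform k (F_tree m k)"
    using F_tree_hypertree[OF k m] by (simp add: uniform_hypertrees_def)
  have uP: "uniform k ?P" using hyperpath_hypertree[OF k2] by (simp add: uniform_hypertrees_def)
  have subP: "f \<subseteq> {..<nverts ?P}" if "f \<in> edges ?P" for f using uP that by (auto simp: uniform_def)
  have new: "?new \<notin> edges ?P"
  proof
    assume "?new \<in> edges ?P"
    moreover have "nverts ?P \<in> ?new" using k by (cases "nverts ?P = k") auto
    ultimately show False using subP by blast
  qed
  have dFk: "2 \<le> degree (F_tree m k) k"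
  proof (rule two_le_degree[OF uF])
    show "?new \<in> edges (F_tree m k)" by (simp add: F_tree_eq_attach attach_pendant_def)
    show "block q 1 \<in> edges (F_tree m k)" using in_F second by simp
    show "?new \<noteq> block q 1" using new \<open>block q 1 \<in> edges ?P\<close> by metis
  qed (use k_block in auto)
  have degP: "2 \<le> degree (F_tree m k) v \<longleftrightarrow> 2 \<le> degree ?P v"
    if "v < nverts ?P" "v \<noteq> k" for v
    using that by (simp add: deg)
  show "card {v \<in> e. 2 \<le> degree (F_tree m k) v} \<in> {1, 2}"
    if e: "e \<in> edges (F_tree m k)" "e \<noteq> {k - 1..2 * (k - 1)}"
  proof (cases "e = ?new")
    case True
    have "{v \<in> e. 2 \<le> degree (F_tree m k) v} = {k}"
    proof (intro Set.set_eqI iffI)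
      fix v assume "v \<in> {v \<in> e. 2 \<le> degree (F_tree m k) v}"
      then show "v \<in> {k}" using True kn by (auto simp: deg split: if_splits)
    qed (use True dFk in auto)
    then show ?thesis by simp
  next
    case False
    then have eP: "e \<in> edges ?P" using e by (auto simp: F_tree_eq_attach attach_pendant_def)
    then obtain i where i: "e = block q i" unfolding edges_hyperpath q(1) by blast
    have "k \<notin> e"
    proof
      assume "k \<in> e"
      then have ki: "i * q \<le> q + 1" "q + 1 \<le> (i + 1) * q" unfolding i in_block using q by auto
      have "i \<noteq> 0" using ki q by (intro notI) auto
      moreover have "i < 2"
      proof (rule ccontr)
        assume "\<not> i < 2"
        then have "2 * q \<le> i * q" by (intro mult_right_mono) auto
        then show False using ki q by linarith
      qed
      ultimately have "i = 1" by simp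
      then show False using e(2) i second by simp
    qed
    have "(v \<in> e \<and> 2 \<le> degree (F_tree m k) v) = (v \<in> e \<and> 2 \<le> degree ?P v)" for v
      using degP[of v] subP[OF eP] \<open>k \<notin> e\<close> by auto
    then have eq: "{v \<in> e. 2 \<le> degree (F_tree m k) v} = {v \<in> e. 2 \<le> degree ?P v}" by simp
    have "finite e" unfolding i block_def by simp
    moreover have "{v \<in> e. 2 \<le> degree ?P v} \<noteq> {}"
      using hyperpath_branch_vertices(2)[OF k2 eP] m by fastforce
    ultimately have "card {v \<in> e. 2 \<le> degree ?P v} \<noteq> 0" by simp
    then show ?thesis using hyperpath_branch_vertices(1)[OF k2 eP] unfolding eq by fastforce
  qed
  have joints: "{q, 2 * q} \<subseteq> block q 1" using q by (auto simp: in_block)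
  have blk: "block q 0 \<in> edges ?P" "block q 2 \<in> edges ?P"
    unfolding edges_hyperpath q(1) using m by auto
  have mem: "0 \<in> block q 0" "0 \<notin> block q 1" "0 \<notin> block q 2" "q \<in> block q 0" "q \<notin> block q 2"
    "2 * q \<in> block q 2" using q by (auto simp: in_block)
  have "2 \<le> degree ?P q" "2 \<le> degree ?P (2 * q)"
    using two_le_degree[OF uP blk(1) \<open>block q 1 \<in> edges ?P\<close>, of q]
      two_le_degree[OF uP blk(2) \<open>block q 1 \<in> edges ?P\<close>, of "2 * q"] mem joints by auto
  then have dj: "2 \<le> degree (F_tree m k) q" "2 \<le> degree (F_tree m k) (2 * q)"
    using degP[of q] degP[of "2 * q"] kn q by auto
  have "{v \<in> block q 1. 2 \<le> degree (F_tree m k) v} = {q, k, 2 * q}"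
  proof (intro Set.set_eqI iffI)
    fix v assume v: "v \<in> {v \<in> block q 1. 2 \<le> degree (F_tree m k) v}"
    show "v \<in> {q, k, 2 * q}"
    proof (cases "v = k")
      case False
      have bd: "q \<le> v" "v \<le> 2 * q" using v by (auto simp: in_block)
      then have "2 \<le> degree ?P v" using degP[of v] v False kn by auto
      then have "q dvd v" using degree_hyperpath(2)[OF k2, of "m - 1" v] q(1) by simp
      then obtain c where c: "v = c * q" by (metis dvdE mult.commute)
      then have "1 * q \<le> c * q" "c * q \<le> 2 * q" using bd by auto
      then have "1 \<le> c" "c \<le> 2" using q(3) by (simp_all only: mult_le_cancel2)
      then have "c = 1 \<or> c = 2" by linarith
      then show ?thesis using c by auto
    qed simp
  qed (use dj dFk k_block joints in auto)
  moreover have "card {q, k, 2 * q} = 3" using q k by auto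
  ultimately show "card {v \<in> {k - 1..2 * (k - 1)}. 2 \<le> degree (F_tree m k) v} = 3"
    unfolding second by simp
qed

text \<open>By \<open>degree_power_sum_2\<close> only the sum of squared excesses matters. It is
  largest when one vertex carries the whole excess \<open>m - 1\<close>, which characterises the
  hyperstar; otherwise \<open>sum_square_bound\<close> applies, and its bound is attained by the
  excesses \<open>m - 2\<close> and 1.\<close>

theorem degree_square_sum_extremal:
  assumes k: "k \<ge> 2" and m: "m \<ge> 1" and H: "H \<in> uniform_hypertrees k m"
  shows "degree_power_sum 2 H \<le> degree_power_sum 2 (hyperstar k m)"
    and "m \<ge> 3 \<Longrightarrow> degree_power_sum 2 (starlike_12 k m) < degree_power_sum 2 (hyperstar k m)"
    and "m \<ge> 3 \<Longrightarrow> \<not> isomorphic H (hyperstar k m) \<Longrightarrow>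
      degree_power_sum 2 H \<le> degree_power_sum 2 (starlike_12 k m)"
proof -
  interpret H: uniform_hypertree k m H using assms by unfold_locales
  interpret S: uniform_hypertree k m "hyperstar k m"
    using k m hyperstar_hypertree(1)[OF k] by unfold_locales
  have HS: "nverts H = nverts (hyperstar k m)" by (simp only: H.nverts S.nverts)
  have 0: "excess (hyperstar k m) 0 = m - 1" by (simp add: excess_def hyperstar_hypertree(2)[OF k])
  have "(m - 1)\<^sup>2 \<le> (\<Sum>v<nverts (hyperstar k m). (excess (hyperstar k m) v)\<^sup>2)"
    using S.sum_excess_square_split[OF S.nverts_pos] unfolding 0 by simp
  then have S: "(\<Sum>v<nverts (hyperstar k m). (excess (hyperstar k m) v)\<^sup>2) = (m - 1)\<^sup>2"
    using S.sum_excess_square_le by simp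
  show "degree_power_sum 2 H \<le> degree_power_sum 2 (hyperstar k m)"
    unfolding H.degree_power_sum_2 S.degree_power_sum_2 S HS of_nat_le_iff
    using H.sum_excess_square_le unfolding HS by (rule add_left_mono)
  assume m3: "m \<ge> 3"
  interpret T: uniform_hypertree k m "starlike_12 k m"
    using k m starlike_12_hypertree(1)[OF k m3] by unfold_locales
  have HT: "nverts H = nverts (starlike_12 k m)" by (simp only: H.nverts T.nverts)
  \<comment> \<open>Here \<open>s = m - 2\<close> is the largest excess possible in a hypertree
    other than the hyperstar.\<close>
  obtain s where s: "m = Suc (Suc s)" "s \<ge> 1" using m3 by (metis Suc_le_D Suc_le_mono numeral_3_eq_3 One_nat_def)
  have 0: "excess (starlike_12 k m) 0 = s"
    using starlike_12_hypertree(2)[OF k m3] s(1) unfolding excess_def by simp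
  have sum: "(\<Sum>v<nverts (starlike_12 k m). excess (starlike_12 k m) v) = Suc s"
    using T.sum_excess s by simp
  have lower: "s\<^sup>2 + 1 \<le> (\<Sum>v<nverts (starlike_12 k m). (excess (starlike_12 k m) v)\<^sup>2)"
    using T.sum_excess_square_split[OF T.nverts_pos] s unfolding 0 by simp
  have bound: "(\<Sum>v<nverts G. (excess G v)\<^sup>2) \<le> s\<^sup>2 + 1"
    if "uniform_hypertree k m G" "\<not> isomorphic G (hyperstar k m)" for G
  proof -
    interpret G: uniform_hypertree k m G by (rule that)
    show ?thesis
    proof (rule sum_square_bound)
      show "(\<Sum>v<nverts G. excess G v) = Suc s" using G.sum_excess s by simp
      fix v assume v: "v \<in> {..<nverts G}"
      have "degree G v \<noteq> m" using isomorphic_hyperstar[OF G.H k, of v] that(2) v by auto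
      then show "excess G v \<le> s"
        using degree_le[OF G.uni, of v] by (simp add: excess_def G.card_edges s)
    qed (use s in auto)
  qed
  \<comment> \<open>The centre has excess \<open>s\<close> out of a total of \<open>s + 1\<close>,
    so every other excess is at most 1. This bounds the sum without a proof that the hypertree is
    not a hyperstar.\<close>
  have upper: "(\<Sum>v<nverts (starlike_12 k m). (excess (starlike_12 k m) v)\<^sup>2) \<le> s\<^sup>2 + 1"
  proof (rule sum_square_bound)
    show "(\<Sum>v<nverts (starlike_12 k m). excess (starlike_12 k m) v) = Suc s" by (rule sum)
    fix v assume v: "v \<in> {..<nverts (starlike_12 k m)}"
    show "excess (starlike_12 k m) v \<le> s"
    proof (cases "v = 0")
      case False
      have "excess (starlike_12 k m) 0 + excess (starlike_12 k m) v \<le> Suc s"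
        using False v T.nverts_pos unfolding sum[symmetric]
        by (subst sum.remove[of _ 0]) (simp_all add: member_le_sum)
      then show ?thesis using 0 s by simp
    qed (use 0 in simp)
  qed (use s in auto)
  have T: "(\<Sum>v<nverts (starlike_12 k m). (excess (starlike_12 k m) v)\<^sup>2) = s\<^sup>2 + 1"
    using lower upper by simp
  show "degree_power_sum 2 (starlike_12 k m) < degree_power_sum 2 (hyperstar k m)"
    unfolding T.degree_power_sum_2 S.degree_power_sum_2 S T
    unfolding HS[symmetric] HT[symmetric] of_nat_less_iff
    using s by (simp add: power2_eq_square)
  assume "\<not> isomorphic H (hyperstar k m)"
  then show "degree_power_sum 2 H \<le> degree_power_sum 2 (starlike_12 k m)"
    unfolding T.degree_power_sum_2 H.degree_power_sum_2 T HT of_nat_le_iff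
    using bound[OF H.uniform_hypertree_axioms] unfolding HT by (intro add_left_mono)
qed

text \<open>For degrees at most 2 the power sums are minimal and fixed, and the pair sum is governed
  by the numbers of branch vertices per hyperedge. A vertex of degree at least 3 is dealt with
  separately: it makes the pair sum at least as large as in \<open>F_tree\<close>.\<close>

theorem degree_sums_extremal:
  assumes k: "k \<ge> 3" and m: "m \<ge> 1" and H: "H \<in> uniform_hypertrees k m"
  shows "degree_power_sum j (hyperpath k m) \<le> degree_power_sum j H"
    and "degree_pair_sum (hyperpath k m) \<le> degree_pair_sum H"
    and "m \<ge> 4 \<Longrightarrow> degree_power_sum j (F_tree m k) = degree_power_sum j (hyperpath k m)"
    and "m \<ge> 4 \<Longrightarrow> degree_pair_sum (F_tree m k) = degree_pair_sum (hyperpath k m) + 1"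
    and "m \<ge> 4 \<Longrightarrow> \<not> isomorphic H (hyperpath k m) \<Longrightarrow> degree_pair_sum (F_tree m k) \<le> degree_pair_sum H"
proof -
  have k2: "k \<ge> 2" using k by simp
  interpret H: uniform_hypertree k m H using H k2 m by unfold_locales
  interpret P: uniform_hypertree k m "hyperpath k m"
    using hyperpath_hypertree[OF k2] k2 m by unfold_locales
  note P2 = degree_hyperpath(1)[OF k2]
  \<comment> \<open>Twice the pair sum without the quadratic terms, evaluated for degrees at most
    2.\<close>
  define base where "base = real m * (real k)\<^sup>2 - real m * real k + 4 * (real k - 1) * real (m - 1)"
  have P_base: "2 * degree_pair_sum (hyperpath k m) = base + (\<Sum>e\<in>edges (hyperpath k m). P.pair_excess e)"
    unfolding P.degree_pair_sum_eq P.sum_edge_excess_max_degree_2[OF P2] base_def by simp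
  \<comment> \<open>With two or more hyperedges, each hyperedge of the hyperpath has one or two
    branch vertices, so the variable part vanishes.\<close>
  have P_value: "2 * degree_pair_sum (hyperpath k m) = base + (2 * real m - 4)" if "m \<ge> 2"
  proof -
    have "(P.edge_excess e - 1) * (P.edge_excess e - 2) = 0" if e: "e \<in> edges (hyperpath k m)" for e
    proof -
      have "finite e" using P.edge[OF e] by blast
      moreover have "{v \<in> e. 2 \<le> degree (hyperpath k m) v} \<noteq> {}"
        using hyperpath_branch_vertices(2)[OF k2 e \<open>m \<ge> 2\<close>] by blast
      ultimately have "card {v \<in> e. 2 \<le> degree (hyperpath k m) v} \<noteq> 0" by simp
      then have "card {v \<in> e. 2 \<le> degree (hyperpath k m) v} \<in> {1, 2}"
        using hyperpath_branch_vertices(1)[OF k2 e] by fastforce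
      then show ?thesis unfolding P.edge_excess_card(1)[OF P2 e] by auto
    qed
    then have "(\<Sum>e\<in>edges (hyperpath k m). (P.edge_excess e - 1) * (P.edge_excess e - 2)) = 0"
      by (intro sum.neutral ballI)
    then show ?thesis unfolding P_base P.sum_pair_excess_max_degree_2[OF P2] by simp
  qed
  show "degree_power_sum j (hyperpath k m) \<le> degree_power_sum j H"
    unfolding P.degree_power_sum_eq[OF P2]
    using H.degree_power_sum_ge[of j] by (simp add: H.nverts P.nverts)
  \<comment> \<open>With \<open>x \<ge> 2\<close> the excess of \<open>w\<close>, the lower bound on
    the pair terms falls short of \<open>2 * (m - 1)\<close> by \<open>2 * x\<close>. The linear
    terms compensate: since \<open>x^2 - x \<ge> x\<close>, the edge excesses sum to at least
    \<open>2 * (m - 1) + x\<close>, which gains at least \<open>2 * (k - 1) * x\<close>. For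
    \<open>m \<ge> 4\<close> the resulting bound is the value of \<open>F_tree\<close>.\<close>
  have H_big: "2 * degree_pair_sum H \<ge> base + 2 * real (m - 1)"
    if w: "\<not> degree H w \<le> 2" "w < nverts H" for w
  proof -
    define x where "x = excess H w"
    have x: "x \<ge> 2" using w by (simp add: x_def excess_def)
    have xm: "x \<le> m - 1" using H.excess_le[OF w(2)] by (simp add: x_def)
    have pe: "(\<Sum>e\<in>edges H. H.pair_excess e) \<ge> 2 * (real (m - 1) - real x)"
      using H.sum_pair_excess_ge[OF w(2)] x xm by (simp add: x_def of_nat_diff)
    have "real (x\<^sup>2 + (m - 1 - x)) \<le> real (\<Sum>v<nverts H. (excess H v)\<^sup>2)"
      using H.sum_excess_square_split[OF w(2)] by (intro of_nat_mono) (simp add: x_def)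
    then have sq: "(real x)\<^sup>2 + (real (m - 1) - real x) \<le> (\<Sum>v<nverts H. (real (excess H v))\<^sup>2)"
      using xm by (simp add: of_nat_diff)
    have "real x * 1 \<le> real x * (real x - 1)" using x by (intro mult_left_mono) auto
    then have xx: "real x \<le> (real x)\<^sup>2 - real x" by (simp add: power2_eq_square algebra_simps)
    have "2 * real (m - 1) + real x \<le> (\<Sum>e\<in>edges H. H.edge_excess e)"
      using sq xx unfolding H.sum_edge_excess by linarith
    then have "2 * (real k - 1) * (2 * real (m - 1) + real x) \<le>
        2 * (real k - 1) * (\<Sum>e\<in>edges H. H.edge_excess e)"
      using k by (intro mult_left_mono) auto
    moreover have "1 * real x \<le> (real k - 1) * real x" using k by (intro mult_right_mono) auto
    ultimately have "4 * (real k - 1) * real (m - 1) + 2 * real x \<le>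
        2 * (real k - 1) * (\<Sum>e\<in>edges H. H.edge_excess e)"
      by (simp add: algebra_simps)
    then have "(real m * (real k)\<^sup>2 - real m * real k) +
        (4 * (real k - 1) * real (m - 1) + 2 * real x) + 2 * (real (m - 1) - real x) \<le> 2 * degree_pair_sum H"
      unfolding H.degree_pair_sum_eq using pe by (intro add_mono order_refl)
    then show ?thesis unfolding base_def by (simp add: algebra_simps)
  qed
  have H_small: "2 * degree_pair_sum H =
      base + (2 * real m - 4) + (\<Sum>e\<in>edges H. (H.edge_excess e - 1) * (H.edge_excess e - 2))"
    if "\<And>v. degree H v \<le> 2"
    unfolding H.degree_pair_sum_eq H.sum_edge_excess_max_degree_2[OF that]
      H.sum_pair_excess_max_degree_2[OF that] base_def by simp
  have max_degree: "degree H v \<le> 2" if "\<And>w. w < nverts H \<Longrightarrow> degree H w \<le> 2" for v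
  proof (cases "v < nverts H")
    case False
    then have none: "{e \<in> edges H. v \<in> e} = {}" using H.edge by auto
    show ?thesis unfolding degree_def none by simp
  qed (use that in simp)
  show "degree_pair_sum (hyperpath k m) \<le> degree_pair_sum H"
  proof (cases "m \<ge> 2")
    case True
    show ?thesis
    proof (cases "\<forall>v<nverts H. degree H v \<le> 2")
      case big: False
      then show ?thesis using H_big P_value[OF True] True by (force simp: of_nat_diff)
    next
      case False: True
      then have d: "degree H v \<le> 2" for v using max_degree by blast
      have "0 \<le> (\<Sum>e\<in>edges H. (H.edge_excess e - 1) * (H.edge_excess e - 2))"
        using H.edge_excess_quadratic_nonneg[OF d] by (intro sum_nonneg)
      then show ?thesis using H_small[OF d] P_value[OF True] by linarith
    qed
  next
    case False
    \<comment> \<open>A single hyperedge has no excess at all, so both sides agree.\<close>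
    then have "m = 1" using m by simp
    have one: "2 * degree_pair_sum G = (real k)\<^sup>2 - real k"
      if "uniform_hypertree k m G" for G
    proof -
      interpret G: uniform_hypertree k m G by (rule that)
      have "excess G v = 0" for v
        using degree_le[OF G.uni, of v] \<open>m = 1\<close> by (simp add: excess_def G.card_edges)
      then have "G.edge_excess e = 0" "G.pair_excess e = 0" for e
        by (simp_all add: G.edge_excess_def G.pair_excess_def)
      then show ?thesis unfolding G.degree_pair_sum_eq by (simp add: \<open>m = 1\<close>)
    qed
    then show ?thesis
      using one[OF H.uniform_hypertree_axioms] one[OF P.uniform_hypertree_axioms] by linarith
  qed
  assume m4: "m \<ge> 4"
  interpret F: uniform_hypertree k m "F_tree m k"
    using F_tree_hypertree[OF k m4] k2 m by unfold_locales
  note F2 = F_tree_degrees(1)[OF k m4]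
  show "degree_power_sum j (F_tree m k) = degree_power_sum j (hyperpath k m)"
    unfolding P.degree_power_sum_eq[OF P2] F.degree_power_sum_eq[OF F2]
    by (simp add: F.nverts P.nverts)
  let ?e = "{k - 1..2 * (k - 1)}"
  \<comment> \<open>Only the second hyperedge contributes, namely
    \<open>(3 - 1) * (3 - 2) = 2\<close>. This is the gap between the doubled pair sums, hence a gap
    of 1.\<close>
  have "(\<Sum>e\<in>edges (F_tree m k). (F.edge_excess e - 1) * (F.edge_excess e - 2)) =
      (F.edge_excess ?e - 1) * (F.edge_excess ?e - 2) +
      (\<Sum>e\<in>edges (F_tree m k) - {?e}. (F.edge_excess e - 1) * (F.edge_excess e - 2))"
    by (rule sum.remove[OF F.fin_edges F_tree_degrees(3)[OF k m4]])
  also have "(\<Sum>e\<in>edges (F_tree m k) - {?e}. (F.edge_excess e - 1) * (F.edge_excess e - 2)) = 0"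
  proof (rule sum.neutral, rule ballI)
    fix e assume "e \<in> edges (F_tree m k) - {?e}"
    then have e: "e \<in> edges (F_tree m k)" "e \<noteq> ?e" by auto
    then show "(F.edge_excess e - 1) * (F.edge_excess e - 2) = 0"
      using F_tree_degrees(2)[OF k m4 e] unfolding F.edge_excess_card(1)[OF F2 e(1)] by auto
  qed
  also have "F.edge_excess ?e = 3"
    unfolding F.edge_excess_card(1)[OF F2 F_tree_degrees(3)[OF k m4]] F_tree_degrees(4)[OF k m4] by simp
  finally have F_value: "2 * degree_pair_sum (F_tree m k) = base + (2 * real m - 2)"
    unfolding F.degree_pair_sum_eq F.sum_edge_excess_max_degree_2[OF F2]
      F.sum_pair_excess_max_degree_2[OF F2] base_def by simp
  then show "degree_pair_sum (F_tree m k) = degree_pair_sum (hyperpath k m) + 1"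
    using P_value m4 by simp
  assume niso: "\<not> isomorphic H (hyperpath k m)"
  show "degree_pair_sum (F_tree m k) \<le> degree_pair_sum H"
  proof (cases "\<forall>v<nverts H. degree H v \<le> 2")
    case False
    then show ?thesis using H_big F_value m4 by (force simp: of_nat_diff)
  next
    case True
    then have d: "degree H v \<le> 2" for v using max_degree by blast
    \<comment> \<open>With degrees at most 2, a hypertree that is not a hyperpath has a hyperedge
      with three or more branch vertices, and this contributes at least 2.\<close>
    obtain e where e: "e \<in> edges H" "3 \<le> card {v \<in> e. 2 \<le> degree H v}"
      using H.isomorphic_hyperpath[OF _ d] niso m4 by fastforce
    have "3 \<le> H.edge_excess e" using e(2) unfolding H.edge_excess_card(1)[OF d e(1)] by simp
    then have "2 * 1 \<le> (H.edge_excess e - 1) * (H.edge_excess e - 2)" by (intro mult_mono) auto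
    also have "\<dots> \<le> (\<Sum>e\<in>edges H. (H.edge_excess e - 1) * (H.edge_excess e - 2))"
      using H.edge_excess_quadratic_nonneg[OF d] e(1) H.fin_edges by (intro member_le_sum) auto
    finally show ?thesis using H_small[OF d] F_value by linarith
  qed
qed

section \<open>Contributing arrangements\<close>

text \<open>The heads of the arcs are the vertices of \<open>ws\<close>, the tails are the same list
  rotated by one place.\<close>

lemma closed_walks_balanced:
  assumes "closed_walks n l M \<noteq> {}"
  shows "image_mset fst M = image_mset snd M"
proof -
  obtain ws where ws: "mset (zip (last ws # ws) ws) = M" using assms by (auto simp: closed_walks_def)
  have "image_mset snd M = mset ws"
    unfolding ws[symmetric] by (simp flip: mset_map add: map_snd_zip_take)
  moreover have "image_mset fst M = mset (take (length ws) (last ws # ws))"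
    unfolding ws[symmetric] by (simp flip: mset_map add: map_fst_zip_take)
  moreover have "mset (take (length ws) (last ws # ws)) = mset ws"
  proof (cases ws rule: rev_cases)
    case (snoc vs v)
    then have "take (length ws) (last ws # ws) = v # vs" by simp
    then show ?thesis using snoc by simp
  qed simp
  ultimately show ?thesis by simp
qed

lemma walk_invariant_set:
  assumes "\<forall>(a, b)\<in>set (zip (i # ws) ws). a \<in> S \<longleftrightarrow> b \<in> S" "x \<in> set ws"
  shows "x \<in> S \<longleftrightarrow> i \<in> S"
  using assms by (induction ws arbitrary: i) auto

lemma in_arcs_iff: "(a, b) \<in># arcs n F \<longleftrightarrow> a < n \<and> (\<exists>\<gamma>\<in>set (F a). b \<in> set \<gamma>)"
proof -
  have "(\<Sum>\<gamma>\<leftarrow>gs. count (mset \<gamma>) b) = 0 \<longleftrightarrow> (\<forall>\<gamma>\<in>set gs. b \<notin> set \<gamma>)" for gs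
    by (induction gs) (auto simp: count_mset_0_iff)
  then have "count (arcs n F) (a, b) = 0 \<longleftrightarrow> \<not> (a < n \<and> (\<exists>\<gamma>\<in>set (F a). b \<in> set \<gamma>))"
    unfolding count_arcs by simp
  then show ?thesis unfolding count_eq_zero_iff by blast
qed

text \<open>A closed walk is connected: if no arc joins \<open>S\<close> to its complement and some
  arc lies in \<open>S\<close>, then the walk never leaves \<open>S\<close>. This confines the
  diagonal entries of a contributing arrangement.\<close>

lemma closed_walk_arcs_subset:
  assumes "ws \<in> closed_walks n l (arcs n F)" "(a, b) \<in># arcs n F" "b \<in> S"
    and "\<And>i j. (i, j) \<in># arcs n F \<Longrightarrow> i \<in> S \<longleftrightarrow> j \<in> S"
    and "(i, j) \<in># arcs n F"
  shows "i \<in> S"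
proof -
  have z: "mset (zip (last ws # ws) ws) = arcs n F" using assms(1) by (auto simp: closed_walks_def)
  then have sz: "x \<in> set (zip (last ws # ws) ws) \<longleftrightarrow> x \<in># arcs n F" for x by (metis set_mset_mset)
  have inv: "\<forall>(a, b)\<in>set (zip (last ws # ws) ws). a \<in> S \<longleftrightarrow> b \<in> S"
    using assms(4) by (auto simp: sz)
  have mem: "j \<in> set ws" if "(i, j) \<in># arcs n F" for i j
    using that unfolding sz[symmetric] by (rule set_zip_rightD)
  have "j \<in> S"
    using walk_invariant_set[OF inv mem[OF assms(2)]] walk_invariant_set[OF inv mem[OF assms(5)]] assms(3)
    by simp
  then show ?thesis using assms(4,5) by simp
qed

text \<open>Sorts the lists of a row into copies of the loop list \<open>l\<close> and lists
  belonging to a hyperedge. The assumption on \<open>set (i # l)\<close> keeps the classes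
  disjoint.\<close>

lemma sum_list_classify:
  fixes f :: "nat list \<Rightarrow> nat"
  assumes "finite E" "set (i # l) \<notin> E" "\<forall>\<gamma>\<in>set gs. \<gamma> = l \<or> set (i # \<gamma>) \<in> E"
    and "\<And>\<gamma>. \<gamma> \<in> set gs \<Longrightarrow> \<gamma> \<noteq> l \<Longrightarrow> f \<gamma> = h (set (i # \<gamma>))"
  shows "(\<Sum>\<gamma>\<leftarrow>gs. f \<gamma>) = length (filter (\<lambda>\<gamma>. \<gamma> = l) gs) * f l +
    (\<Sum>e\<in>E. length (filter (\<lambda>\<gamma>. set (i # \<gamma>) = e) gs) * h e)"
  using assms(3,4)
proof (induction gs)
  case (Cons \<gamma> gs)
  have IH: "(\<Sum>\<gamma>\<leftarrow>gs. f \<gamma>) = length (filter (\<lambda>\<gamma>. \<gamma> = l) gs) * f l +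
    (\<Sum>e\<in>E. length (filter (\<lambda>\<gamma>. set (i # \<gamma>) = e) gs) * h e)"
    using Cons by simp
  have "(\<Sum>e\<in>E. length (filter (\<lambda>\<gamma>. set (i # \<gamma>) = e) (\<gamma> # gs)) * h e) =
      (\<Sum>e\<in>E. (if e = set (i # \<gamma>) then h e else 0) + length (filter (\<lambda>\<gamma>. set (i # \<gamma>) = e) gs) * h e)"
    by (intro sum.cong refl) auto
  also have "\<dots> = (if set (i # \<gamma>) \<in> E then h (set (i # \<gamma>)) else 0) +
      (\<Sum>e\<in>E. length (filter (\<lambda>\<gamma>. set (i # \<gamma>) = e) gs) * h e)"
    unfolding sum.distrib using assms(1) by (subst sum.delta) auto
  finally have E: "(\<Sum>e\<in>E. length (filter (\<lambda>\<gamma>. set (i # \<gamma>) = e) (\<gamma> # gs)) * h e) = \<dots>" .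
  show ?case
  proof (cases "\<gamma> = l")
    case True
    have "(if set (i # \<gamma>) \<in> E then h (set (i # \<gamma>)) else 0) = 0" using True assms(2) by simp
    then show ?thesis unfolding E using IH True by simp
  next
    case False
    then have "set (i # \<gamma>) \<in> E" "f \<gamma> = h (set (i # \<gamma>))" using Cons.prems by auto
    then show ?thesis unfolding E using IH False by simp
  qed
qed simp

lemma length_filter_disj:
  assumes "\<And>x. \<not> (P x \<and> Q x)"
  shows "length (filter (\<lambda>x. P x \<or> Q x) xs) = length (filter P xs) + length (filter Q xs)"
  using assms by (induction xs) auto

lemma count_fst_arcs:
  assumes "F \<in> arrangements k n d" "v < n"
  shows "count (image_mset fst (arcs n F)) v = (k - 1) * length (F v)"
proof -
  have row: "image_mset fst (mset (row_arcs i gs)) = replicate_mset (\<Sum>\<gamma>\<leftarrow>gs. length \<gamma>) i" for i gs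
    by (induction gs) (auto simp: row_arcs_def o_def image_mset_const_eq multiset.map_comp intro!: multiset_eqI)
  have "\<forall>\<gamma>\<in>set (F v). length \<gamma> = k - 1"
    using assms by (auto simp: arrangements_def PiE_iff index_lists_def)
  then have "(\<Sum>\<gamma>\<leftarrow>F v. length \<gamma>) = (\<Sum>\<gamma>\<leftarrow>F v. k - 1)" by (metis (no_types, lifting) map_eq_conv)
  then have len: "(\<Sum>\<gamma>\<leftarrow>F v. length \<gamma>) = (k - 1) * length (F v)" by (simp add: sum_list_triv)
  have "count (image_mset fst (arcs n F)) v =
      (\<Sum>i<n. if v = i then \<Sum>\<gamma>\<leftarrow>F i. length \<gamma> else 0)"
    unfolding arcs_def by (simp add: image_mset_sum count_sum row eq_commute)
  then show ?thesis using assms(2) len by simp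
qed

lemma count_snd_arcs:
  "count (image_mset snd (arcs n F)) v = (\<Sum>i<n. \<Sum>\<gamma>\<leftarrow>F i. count (mset \<gamma>) v)"
proof -
  have row: "count (image_mset snd (mset (row_arcs i gs))) v = (\<Sum>\<gamma>\<leftarrow>gs. count (mset \<gamma>) v)" for i gs
    by (induction gs) (auto simp: row_arcs_def o_def multiset.map_comp)
  show ?thesis unfolding arcs_def by (simp add: image_mset_sum count_sum row)
qed

section \<open>Supported arrangements on a hypertree\<close>

context uniform_hypertree
begin

abbreviation "n \<equiv> nverts H"

lemma not_edge_singleton: "{i} \<notin> edges H"
  using edge[of "{i}"] k by auto

lemma not_edge_loop: "set (i # replicate (k - 1) i) \<notin> edges H"
  using not_edge_singleton[of i] k by simp

text \<open>All chosen entries of the tensor are diagonal or adjacency entries, the only ones that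
  can be nonzero.\<close>

definition supported :: "(nat \<Rightarrow> nat list list) \<Rightarrow> bool" where
  "supported F \<longleftrightarrow> (\<forall>i<n. \<forall>\<gamma>\<in>set (F i). \<gamma> = replicate (k - 1) i \<or> set (i # \<gamma>) \<in> edges H)"

lemma A_alpha_Cons:
  assumes "length \<gamma> = k - 1"
  shows "A_alpha \<alpha> k H (i # \<gamma>) = (if \<gamma> = replicate (k - 1) i then \<alpha> * real (degree H i)
    else if set (i # \<gamma>) \<in> edges H then (1 - \<alpha>) / fact (k - 1) else 0)"
proof -
  have "replicate k i = i # replicate (k - 1) i" using k by (cases k) auto
  then have "i # \<gamma> = replicate k i \<longleftrightarrow> \<gamma> = replicate (k - 1) i" by simp
  then show ?thesis using not_edge_loop[of i]
    unfolding A_alpha_def degree_tensor_def adjacency_tensor_def by auto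
qed

lemma row_lists:
  assumes "F \<in> arrangements k n d" "i < n" "\<gamma> \<in> set (F i)"
  shows "length \<gamma> = k - 1" "set \<gamma> \<subseteq> {..<n}"
  using assms by (auto simp: arrangements_def PiE_iff index_lists_def)

lemma row_weight_supported:
  assumes "\<forall>\<gamma>\<in>set gs. length \<gamma> = k - 1 \<and> (\<gamma> = replicate (k - 1) i \<or> set (i # \<gamma>) \<in> edges H)"
  shows "row_weight (A_alpha \<alpha> k H) i gs =
    (\<alpha> * real (degree H i)) ^ length (filter (\<lambda>\<gamma>. \<gamma> = replicate (k - 1) i) gs) *
    ((1 - \<alpha>) / fact (k - 1)) ^ (length gs - length (filter (\<lambda>\<gamma>. \<gamma> = replicate (k - 1) i) gs))"
  using assms
proof (induction gs)
  case (Cons \<gamma> gs)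
  let ?f = "length (filter (\<lambda>\<gamma>. \<gamma> = replicate (k - 1) i) gs)"
  have le: "?f \<le> length gs" by (rule length_filter_le)
  have step: "row_weight (A_alpha \<alpha> k H) i (\<gamma> # gs) =
      A_alpha \<alpha> k H (i # \<gamma>) * row_weight (A_alpha \<alpha> k H) i gs"
    by (simp add: row_weight_def)
  show ?case
  proof (cases "\<gamma> = replicate (k - 1) i")
    case True
    then show ?thesis unfolding step using Cons A_alpha_Cons[of \<gamma> \<alpha> i] by simp
  next
    case False
    then show ?thesis unfolding step using Cons A_alpha_Cons[of \<gamma> \<alpha> i] le by (simp add: Suc_diff_le)
  qed
qed (simp add: row_weight_def)

lemma weight_supported:
  assumes "F \<in> arrangements k n d" "supported F"
  shows "(\<Prod>i<n. row_weight (A_alpha \<alpha> k H) i (F i)) =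
    (\<Prod>i<n. (\<alpha> * real (degree H i)) ^ loops k F i) *
    ((1 - \<alpha>) / fact (k - 1)) ^ (\<Sum>i<n. length (F i) - loops k F i)"
proof -
  have "row_weight (A_alpha \<alpha> k H) i (F i) = (\<alpha> * real (degree H i)) ^ loops k F i *
      ((1 - \<alpha>) / fact (k - 1)) ^ (length (F i) - loops k F i)" if "i < n" for i
    unfolding loops_def using assms that row_lists[OF assms(1) that]
    by (intro row_weight_supported) (auto simp: supported_def)
  then show ?thesis by (simp add: prod.distrib power_sum)
qed

lemma weight_unsupported:
  assumes "F \<in> arrangements k n d" "\<not> supported F"
  shows "(\<Prod>i<n. row_weight (A_alpha \<alpha> k H) i (F i)) = 0"
proof -
  obtain i \<gamma> where i: "i < n" "\<gamma> \<in> set (F i)" "\<gamma> \<noteq> replicate (k - 1) i" "set (i # \<gamma>) \<notin> edges H"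
    using assms(2) by (auto simp: supported_def)
  have "A_alpha \<alpha> k H (i # \<gamma>) = 0"
    unfolding A_alpha_Cons[OF row_lists(1)[OF assms(1) i(1,2)]] using i(3,4) by (simp only: if_False)
  then have "0 \<in> set (map (\<lambda>\<gamma>. A_alpha \<alpha> k H (i # \<gamma>)) (F i))" using i(2) by force
  then have "row_weight (A_alpha \<alpha> k H) i (F i) = 0"
    unfolding row_weight_def by (simp only: prod_list_zero_iff)
  then show ?thesis using i(1) by (intro prod_zero) auto
qed

text \<open>Since \<open>i # \<gamma>\<close> has \<open>k\<close> entries and covers
  \<open>k\<close> vertices, nothing is repeated: each other vertex of the hyperedge occurs
  once.\<close>

lemma edge_entry:
  assumes "length \<gamma> = k - 1" "set (i # \<gamma>) \<in> edges H"
  shows "count (mset \<gamma>) v = (if v \<in> set (i # \<gamma>) \<and> v \<noteq> i then 1 else 0)"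
proof -
  have "card (set (i # \<gamma>)) = length (i # \<gamma>)" using edge[OF assms(2)] assms(1) k by simp
  then have "distinct (i # \<gamma>)" by (rule card_distinct)
  then have "distinct \<gamma>" "i \<notin> set \<gamma>" by auto
  moreover from this have "mset \<gamma> = mset_set (set \<gamma>)" by (simp add: mset_set_set)
  ultimately show ?thesis by (auto simp: count_mset_set')
qed

lemma hits_outside: "u \<notin> e \<Longrightarrow> hits e F u = 0"
  by (auto simp: hits_def filter_empty_conv)

definition total_hits :: "(nat \<Rightarrow> nat list list) \<Rightarrow> nat set \<Rightarrow> nat" where
  "total_hits F e = (\<Sum>u<n. hits e F u)"

lemma total_hits_edge:
  assumes "e \<in> edges H"
  shows "total_hits F e = (\<Sum>u\<in>e. hits e F u)"
  unfolding total_hits_def using edge[OF assms]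
  by (intro sum.mono_neutral_right) (auto simp: hits_outside)

lemma length_row:
  assumes "supported F" "u < n"
  shows "length (F u) = loops k F u + (\<Sum>e\<in>edges H. hits e F u)"
proof -
  have "(\<Sum>\<gamma>\<leftarrow>F u. 1) = loops k F u * 1 + (\<Sum>e\<in>edges H. hits e F u * 1)"
    unfolding loops_def hits_def
    by (rule sum_list_classify[OF fin_edges not_edge_loop])
      (use assms in \<open>simp_all add: supported_def\<close>)
  then show ?thesis by (simp add: sum_list_triv)
qed

text \<open>On a hypertree the balance of the arc multiset at every vertex is a flow problem on a forest,
  which only has the trivial solution.\<close>

lemma hits_balanced:
  assumes F: "F \<in> arrangements k n d" "supported F" and ne: "closed_walks n l (arcs n F) \<noteq> {}"
    and e: "e \<in> edges H" "v \<in> e"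
  shows "k * hits e F v = total_hits F e"
proof -
  \<comment> \<open>Up to the factor \<open>k\<close>, the deviation of the hits at \<open>v\<close>
    from their mean over the hyperedge; its sum over a hyperedge is 0 by definition.\<close>
  define f where "f = (\<lambda>v e. int k * int (hits e F v) - int (total_hits F e))"
  have "f v e = 0"
  proof (rule grown_flow_zero[OF grown[OF nverts_pos] k _ _ e])
    fix e assume e: "e \<in> edges H"
    have "(\<Sum>v\<in>e. f v e) = int k * int (\<Sum>v\<in>e. hits e F v) - int (card e) * int (total_hits F e)"
      unfolding f_def by (simp add: sum_subtractf sum_distrib_left)
    then show "(\<Sum>v\<in>e. f v e) = 0" using edge[OF e] total_hits_edge[OF e] by simp
  next
    fix v assume "v \<in> {..<n}"
    then have v: "v < n" by simp
    have row: "(\<Sum>\<gamma>\<leftarrow>F i. count (mset \<gamma>) v) = loops k F i * (if i = v then k - 1 else 0) +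
        (\<Sum>e\<in>edges H. hits e F i * (if v \<in> e \<and> v \<noteq> i then 1 else 0))" if i: "i < n" for i
    proof -
      have "count (mset (replicate (k - 1) i)) v = (if i = v then k - 1 else 0)" by simp
      moreover have "count (mset \<gamma>) v = (if v \<in> set (i # \<gamma>) \<and> v \<noteq> i then 1 else 0)"
        if "\<gamma> \<in> set (F i)" "\<gamma> \<noteq> replicate (k - 1) i" for \<gamma>
        using that F(2) i row_lists(1)[OF F(1) i] by (intro edge_entry) (auto simp: supported_def)
      ultimately show ?thesis
        using sum_list_classify[OF fin_edges not_edge_loop[of i], of "F i" "\<lambda>\<gamma>. count (mset \<gamma>) v"
            "\<lambda>e. if v \<in> e \<and> v \<noteq> i then 1 else 0"] F(2) i
        by (simp add: supported_def loops_def hits_def del: set_simps)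
    qed
    have inner: "(\<Sum>i<n. hits e F i * (if v \<in> e \<and> v \<noteq> i then 1 else 0)) =
        (if v \<in> e then total_hits F e - hits e F v else 0)" for e
    proof (cases "v \<in> e")
      case True
      have "(\<Sum>i<n. hits e F i * (if v \<in> e \<and> v \<noteq> i then 1 else 0)) =
          (\<Sum>i\<in>{..<n} - {v}. hits e F i)"
        using True v by (subst sum.remove[of _ v]) (auto intro!: sum.cong)
      then show ?thesis using True v unfolding total_hits_def by (simp add: sum_diff1_nat)
    qed simp
    \<comment> \<open>Arcs leaving \<open>v\<close> on the left, arcs entering \<open>v\<close> on
      the right. A use of \<open>e\<close> at any of its other vertices sends exactly one arc to
      \<open>v\<close>.\<close>
    have "(k - 1) * length (F v) = (\<Sum>i<n. \<Sum>\<gamma>\<leftarrow>F i. count (mset \<gamma>) v)"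
      using closed_walks_balanced[OF ne] count_fst_arcs[OF F(1) v] count_snd_arcs[of n F v] by simp
    also have "\<dots> = (\<Sum>i<n. loops k F i * (if i = v then k - 1 else 0)) +
        (\<Sum>i<n. \<Sum>e\<in>edges H. hits e F i * (if v \<in> e \<and> v \<noteq> i then 1 else 0))"
      using row by (simp add: sum.distrib)
    also have "(\<Sum>i<n. loops k F i * (if i = v then k - 1 else 0)) = loops k F v * (k - 1)"
      using v by (simp add: if_distrib cong: if_cong)
    also have "(\<Sum>i<n. \<Sum>e\<in>edges H. hits e F i * (if v \<in> e \<and> v \<noteq> i then 1 else 0)) =
        (\<Sum>e\<in>edges H. if v \<in> e then total_hits F e - hits e F v else 0)"
      by (subst sum.swap) (simp only: inner)
    also have "\<dots> = (\<Sum>e\<in>{e \<in> edges H. v \<in> e}. total_hits F e - hits e F v)"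
      using fin_edges by (simp add: sum.If_cases Int_def)
    finally have bal: "(k - 1) * length (F v) =
        loops k F v * (k - 1) + (\<Sum>e\<in>{e \<in> edges H. v \<in> e}. total_hits F e - hits e F v)" .
    have "(\<Sum>e\<in>edges H. hits e F v) = (\<Sum>e\<in>{e \<in> edges H. v \<in> e}. hits e F v)"
      using fin_edges by (intro sum.mono_neutral_right) (auto simp: hits_outside)
    then have len: "length (F v) = loops k F v + (\<Sum>e\<in>{e \<in> edges H. v \<in> e}. hits e F v)"
      using length_row[OF F(2) v] by simp
    have le: "hits e F v \<le> total_hits F e" for e
      unfolding total_hits_def using v by (intro member_le_sum) auto
    \<comment> \<open>The loops at \<open>v\<close> cancel, since they leave and enter it equally
      often.\<close>
    have "(k - 1) * (\<Sum>e\<in>{e \<in> edges H. v \<in> e}. hits e F v) =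
        (\<Sum>e\<in>{e \<in> edges H. v \<in> e}. total_hits F e - hits e F v)"
      using bal unfolding len by (simp add: algebra_simps)
    then have "int ((k - 1) * (\<Sum>e\<in>{e \<in> edges H. v \<in> e}. hits e F v)) =
        int (\<Sum>e\<in>{e \<in> edges H. v \<in> e}. total_hits F e - hits e F v)" by simp
    then have "(int k - 1) * (\<Sum>e\<in>{e \<in> edges H. v \<in> e}. int (hits e F v)) =
        (\<Sum>e\<in>{e \<in> edges H. v \<in> e}. int (total_hits F e) - int (hits e F v))"
      using k le by (simp add: of_nat_diff)
    then show "(\<Sum>e\<in>{e \<in> edges H. v \<in> e}. f v e) = 0"
      unfolding f_def by (simp add: sum_subtractf sum_distrib_left algebra_simps)
  qed
  then have "int (k * hits e F v) = int (total_hits F e)" by (simp add: f_def)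
  then show ?thesis by (simp only: of_nat_eq_iff)
qed

lemma sum_length:
  assumes "F \<in> arrangements k n d" "supported F"
  shows "d = (\<Sum>u<n. loops k F u) + (\<Sum>e\<in>edges H. total_hits F e)"
proof -
  have "d = (\<Sum>u<n. length (F u))" using assms(1) by (simp add: arrangements_def)
  also have "\<dots> = (\<Sum>u<n. loops k F u) + (\<Sum>u<n. \<Sum>e\<in>edges H. hits e F u)"
    using length_row[OF assms(2)] by (simp add: sum.distrib)
  also have "(\<Sum>u<n. \<Sum>e\<in>edges H. hits e F u) = (\<Sum>e\<in>edges H. total_hits F e)"
    unfolding total_hits_def by (rule sum.swap)
  finally show ?thesis .
qed

text \<open>A hyperedge in use occurs at all of its \<open>k\<close> vertices equally often, so two
  hyperedges, or one used twice, would take \<open>2 * k\<close> entries. Connectedness of the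
  closed walk places the remaining diagonal entries at one vertex or on the hyperedge.\<close>

lemma arrangement_cases:
  assumes F: "F \<in> arrangements k n d" "supported F" and ne: "closed_walks n l (arcs n F) \<noteq> {}"
    and d: "1 \<le> d" "d < 2 * k"
  shows "(\<exists>c<n. F = diagonal_arrangement k n d c) \<or>
    (\<exists>e\<in>edges H. \<exists>K\<subseteq>e. F \<in> edge_arrangements k n d e K)"
proof -
  obtain ws where ws: "ws \<in> closed_walks n l (arcs n F)" using ne by blast
  have nonempty: "set \<gamma> \<noteq> {}" if "i < n" "\<gamma> \<in> set (F i)" for i \<gamma>
    using row_lists(1)[OF F(1) that] k by auto
  show ?thesis
  proof (cases "\<forall>e\<in>edges H. total_hits F e = 0")
    case True
    have loop: "\<gamma> = replicate (k - 1) i" if "i < n" "\<gamma> \<in> set (F i)" for i \<gamma>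
    proof (rule ccontr)
      assume "\<gamma> \<noteq> replicate (k - 1) i"
      then have e: "set (i # \<gamma>) \<in> edges H" using F(2) that by (auto simp: supported_def)
      then have "total_hits F (set (i # \<gamma>)) = 0" using True by blast
      then have "hits (set (i # \<gamma>)) F i = 0" unfolding total_hits_def using that(1) by simp
      then show False using that(2) by (auto simp: hits_def filter_empty_conv)
    qed
    have "\<exists>c<n. F c \<noteq> []"
    proof (rule ccontr)
      assume "\<not> ?thesis"
      then have "(\<Sum>u<n. length (F u)) = 0" by simp
      then show False using F(1) d(1) by (simp add: arrangements_def)
    qed
    then obtain c where c: "c < n" "F c \<noteq> []" by blast
    then obtain \<gamma> where \<gamma>: "\<gamma> \<in> set (F c)" by (metis list.set_sel(1))
    have arc_loop: "i = j" if "(i, j) \<in># arcs n F" for i j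
      using that loop unfolding in_arcs_iff by (metis in_set_replicate)
    have loop_arc: "(i, i) \<in># arcs n F" if i: "i < n" "F i \<noteq> []" for i
    proof -
      have hd: "hd (F i) \<in> set (F i)" using i(2) by simp
      then have "i \<in> set (hd (F i))" using loop[OF i(1) hd] k by simp
      then show ?thesis using i(1) hd unfolding in_arcs_iff by blast
    qed
    \<comment> \<open>All arcs are loops, so \<open>{c}\<close> is closed under them and the walk
      cannot reach another vertex.\<close>
    have only: "F i = []" if "i < n" "i \<noteq> c" for i
    proof (rule ccontr)
      assume "F i \<noteq> []"
      note loop_arc[OF that(1) this]
      then have "i \<in> {c}"
        by (rule closed_walk_arcs_subset[OF ws loop_arc[OF c] singletonI, rotated])
          (use arc_loop in auto)
      then show False using that(2) by simp
    qed
    have "(\<Sum>u<n. length (F u)) = length (F c)"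
      using c only by (subst sum.remove[of _ c]) auto
    then have "length (F c) = d" using F(1) by (simp add: arrangements_def)
    then have Fc: "F c = replicate d (replicate (k - 1) c)"
      by (rule replicate_eqI) (rule loop[OF c(1)])
    have "F = diagonal_arrangement k n d c"
    proof
      fix i
      show "F i = diagonal_arrangement k n d c i"
      proof (cases "i < n")
        case False
        then have "F i = undefined" using F(1) by (auto simp: arrangements_def PiE_iff extensional_def)
        then show ?thesis using False by (simp add: diagonal_arrangement_def)
      qed (use only Fc in \<open>auto simp: diagonal_arrangement_def\<close>)
    qed
    then show ?thesis using c(1) by blast
  next
    case False
    then obtain e where e: "e \<in> edges H" "total_hits F e > 0" by auto
    have ge: "total_hits F g \<ge> k" if g: "g \<in> edges H" "total_hits F g > 0" for g
    proof -
      have "g \<noteq> {}" using edge[OF g(1)] k by auto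
      then obtain u where "u \<in> g" by blast
      then have eq: "k * hits g F u = total_hits F g" by (rule hits_balanced[OF F ne g(1)])
      then have "1 \<le> hits g F u" using g(2) by (cases "hits g F u") auto
      then have "k * 1 \<le> k * hits g F u" by (rule mult_le_mono2)
      then show ?thesis unfolding eq by simp
    qed
    have le: "(\<Sum>g\<in>edges H. total_hits F g) < 2 * k" using sum_length[OF F] d(2) by linarith
    have other: "total_hits F g = 0" if g: "g \<in> edges H" "g \<noteq> e" for g
    proof (rule ccontr)
      assume "total_hits F g \<noteq> 0"
      then have "k + k \<le> total_hits F e + total_hits F g"
        using ge[OF e] ge[OF g(1)] by linarith
      also have "\<dots> = (\<Sum>g\<in>{e, g}. total_hits F g)" using g(2) by simp
      also have "\<dots> \<le> (\<Sum>g\<in>edges H. total_hits F g)"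
        using fin_edges e(1) g(1) by (intro sum_mono2) auto
      finally show False using le by simp
    qed
    have "total_hits F e \<le> (\<Sum>g\<in>edges H. total_hits F g)"
      using fin_edges e(1) by (intro member_le_sum) auto
    then have lt: "total_hits F e < k * 2" using le by linarith
    have one: "hits e F u = 1" if "u \<in> e" for u
    proof -
      have eq: "k * hits e F u = total_hits F e" by (rule hits_balanced[OF F ne e(1) that])
      then have "k * hits e F u < k * 2" using lt by simp
      then have "hits e F u < 2" by simp
      moreover have "hits e F u \<noteq> 0" using eq e(2) by (intro notI) simp
      ultimately show ?thesis by simp
    qed
    have zero: "hits g F u = 0" if "g \<in> edges H" "g \<noteq> e" "u < n" for g u
      using other[OF that(1,2)] that(3) by (simp add: total_hits_def)
    have kind: "\<gamma> = replicate (k - 1) i \<or> set (i # \<gamma>) = e" if "i < n" "\<gamma> \<in> set (F i)" for i \<gamma>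
    proof (rule ccontr)
      assume no: "\<not> ?thesis"
      then have "set (i # \<gamma>) \<in> edges H" using F(2) that by (auto simp: supported_def)
      then have "hits (set (i # \<gamma>)) F i = 0" using zero no that(1) by blast
      then show False using that(2) by (auto simp: hits_def filter_empty_conv)
    qed
    have len: "length (F u) = loops k F u + hits e F u" if "u < n" for u
    proof -
      have "(\<Sum>g\<in>edges H. hits g F u) = hits e F u"
        using fin_edges e(1) zero[OF _ _ that] by (subst sum.remove[of _ e]) auto
      then show ?thesis using length_row[OF F(2) that] by simp
    qed
    define K where "K = {u. u < n \<and> loops k F u > 0}"
    \<comment> \<open>Loops stay at their vertex and all other arcs run inside \<open>e\<close>, so
      the walk cannot leave \<open>e\<close>; hence all diagonal entries sit on
      \<open>e\<close>.\<close>
    have arc_e: "i \<in> e \<longleftrightarrow> j \<in> e" if ij: "(i, j) \<in># arcs n F" for i j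
    proof -
      obtain \<gamma> where \<gamma>: "i < n" "\<gamma> \<in> set (F i)" "j \<in> set \<gamma>" using ij unfolding in_arcs_iff by blast
      from kind[OF \<gamma>(1,2)] show ?thesis
      proof
        assume "\<gamma> = replicate (k - 1) i"
        then show ?thesis using \<gamma>(3) by auto
      next
        assume "set (i # \<gamma>) = e"
        then show ?thesis using \<gamma>(3) by auto
      qed
    qed
    have "e \<noteq> {}" using edge[OF e(1)] k by auto
    then obtain u where u: "u \<in> e" by blast
    have un: "u < n" using u edge[OF e(1)] by auto
    have "filter (\<lambda>\<gamma>. set (u # \<gamma>) = e) (F u) \<noteq> []" using one[OF u] by (auto simp: hits_def)
    then obtain \<gamma> where \<gamma>: "\<gamma> \<in> set (F u)" "set (u # \<gamma>) = e" by (auto simp: filter_empty_conv)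
    obtain b where b: "b \<in> set \<gamma>" using nonempty[OF un \<gamma>(1)] by (meson equals0I)
    have ub: "(u, b) \<in># arcs n F" "b \<in> e" using un b \<gamma> unfolding in_arcs_iff by auto
    have "K \<subseteq> e"
    proof
      fix i assume "i \<in> K"
      then have i: "i < n" "loops k F i > 0" by (auto simp: K_def)
      then have "filter (\<lambda>\<gamma>. \<gamma> = replicate (k - 1) i) (F i) \<noteq> []" by (auto simp: loops_def)
      then have "replicate (k - 1) i \<in> set (F i)" by (auto simp: filter_empty_conv)
      then have "(i, i) \<in># arcs n F" using i(1) k unfolding in_arcs_iff
        by (intro conjI bexI[of _ "replicate (k - 1) i"]) auto
      then show "i \<in> e" by (rule closed_walk_arcs_subset[OF ws ub, rotated]) (rule arc_e)
    qed
    moreover have "F \<in> edge_arrangements k n d e K"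
      unfolding edge_arrangements_def using F(1) len one hits_outside K_def by auto
    ultimately show ?thesis using e(1) by blast
  qed
qed

text \<open>Loops and hits are disjoint kinds of lists, and together they already account for the
  length of the row, so there is no list of a third kind.\<close>

lemma edge_arrangements_supported:
  assumes "F \<in> edge_arrangements k n d e K" "e \<in> edges H"
  shows "supported F"
  unfolding supported_def
proof (intro allI impI ballI)
  fix i \<gamma> assume i: "i < n" "\<gamma> \<in> set (F i)"
  let ?P = "\<lambda>\<gamma>. \<gamma> = replicate (k - 1) i" and ?Q = "\<lambda>\<gamma>. set (i # \<gamma>) = e"
  have excl: "\<not> (?P \<gamma> \<and> ?Q \<gamma>)" for \<gamma> using not_edge_loop[of i] assms(2) by blast
  have "length (F i) = length (filter ?P (F i)) + length (filter ?Q (F i))"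
    using assms(1) i(1) by (simp add: edge_arrangements_def loops_def hits_def)
  also have "\<dots> = length (filter (\<lambda>\<gamma>. ?P \<gamma> \<or> ?Q \<gamma>) (F i))"
    by (rule length_filter_disj[symmetric]) (rule excl)
  finally have "length (filter (\<lambda>\<gamma>. ?P \<gamma> \<or> ?Q \<gamma>) (F i)) = length (F i)" by simp
  then have "?P \<gamma> \<or> ?Q \<gamma>"
    using length_filter_less[OF i(2), of "\<lambda>\<gamma>. ?P \<gamma> \<or> ?Q \<gamma>"] by linarith
  then show "\<gamma> = replicate (k - 1) i \<or> set (i # \<gamma>) \<in> edges H" using assms(2) by blast
qed

end

section \<open>Spectral moments\<close>

context uniform_hypertree
begin

lemma diagonal_inj:
  assumes "d \<ge> 1" "c < n" "c' < n" "diagonal_arrangement k n d c = diagonal_arrangement k n d c'"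
  shows "c = c'"
proof (rule ccontr)
  assume "c \<noteq> c'"
  then have "diagonal_arrangement k n d c' c = []" using assms(2) by (simp add: diagonal_arrangement_def)
  moreover have "length (diagonal_arrangement k n d c c) = d" using assms(2) by (simp add: diagonal_arrangement_def)
  ultimately show False using assms(1,4) by simp
qed

lemma diagonal_not_edge_arrangement:
  assumes "e \<in> edges H"
  shows "diagonal_arrangement k n d c \<notin> edge_arrangements k n d e K"
proof
  assume F: "diagonal_arrangement k n d c \<in> edge_arrangements k n d e K"
  have "\<not> e \<subseteq> {c}"
  proof
    assume "e \<subseteq> {c}"
    then have "card e \<le> card {c}" by (intro card_mono) auto
    then show False using edge[OF assms] k by simp
  qed
  then obtain u where u: "u \<in> e" "u \<noteq> c" by blast
  then have "u < n" using edge[OF assms] by auto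
  then have "hits e (diagonal_arrangement k n d c) u = 0"
    using u(2) by (simp add: hits_def diagonal_arrangement_def)
  then show False using F u(1) \<open>u < n\<close> by (auto simp: edge_arrangements_def)
qed

text \<open>Both sets can be read off from \<open>F\<close>: the rows of \<open>e\<close> are those
  with an entry that is not a loop, and \<open>K\<close> consists of the rows with a loop.\<close>

lemma edge_arrangements_disjoint:
  assumes "e \<in> edges H" "e' \<in> edges H" "F \<in> edge_arrangements k n d e K" "F \<in> edge_arrangements k n d e' K'"
  shows "e = e'" "K = K'"
proof -
  have "u \<in> e \<longleftrightarrow> u \<in> e'" if "u < n" for u
  proof -
    have "hits e F u = hits e' F u" using assms(3,4) that by (simp add: edge_arrangements_def)
    then show ?thesis using assms(3,4) that by (auto simp: edge_arrangements_def split: if_splits)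
  qed
  then show "e = e'" using edge[OF assms(1)] edge[OF assms(2)] by auto
  show "K = K'" using assms(3,4) by (auto simp: edge_arrangements_def)
qed

lemma weight_diagonal:
  assumes "c < n"
  shows "(\<Prod>i<n. row_weight T i (diagonal_arrangement k n d c i)) = T (c # replicate (k - 1) c) ^ d"
proof -
  have "(\<Prod>i<n. row_weight T i (diagonal_arrangement k n d c i)) =
      (\<Prod>i<n. if i = c then T (c # replicate (k - 1) c) ^ d else 1)"
    by (intro prod.cong) (auto simp: diagonal_arrangement_def row_weight_def prod_list_replicate)
  then show ?thesis using assms by simp
qed

lemma sum_hits_edge_arrangement:
  assumes "F \<in> edge_arrangements k n d e K" "e \<in> edges H"
  shows "(\<Sum>i<n. length (F i) - loops k F i) = k" "(\<Sum>i<n. loops k F i) + k = d"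
proof -
  have "(\<Sum>i<n. hits e F i) = (\<Sum>i<n. if i \<in> e then 1 else 0)"
    using assms(1) by (intro sum.cong) (auto simp: edge_arrangements_def)
  also have "\<dots> = card ({..<n} \<inter> e)" by (simp add: sum.If_cases)
  also have "{..<n} \<inter> e = e" using edge[OF assms(2)] by blast
  finally have k: "(\<Sum>i<n. hits e F i) = k" using edge[OF assms(2)] by simp
  have "(\<Sum>i<n. length (F i) - loops k F i) = (\<Sum>i<n. hits e F i)"
    using assms(1) by (intro sum.cong) (auto simp: edge_arrangements_def)
  then show "(\<Sum>i<n. length (F i) - loops k F i) = k" using k by simp
  have "d = (\<Sum>i<n. length (F i))" using assms(1) by (auto simp: edge_arrangements_def arrangements_def)
  also have "\<dots> = (\<Sum>i<n. loops k F i + hits e F i)"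
    using assms(1) by (intro sum.cong) (auto simp: edge_arrangements_def)
  finally show "(\<Sum>i<n. loops k F i) + k = d" using k by (simp add: sum.distrib)
qed

text \<open>Unsupported arrangements contain a zero entry, and supported ones outside the two
  families admit no closed walk. On an edge arrangement the adjacency entries contribute the same
  factor, whatever the hyperedge.\<close>

lemma moment_sum:
  assumes d: "1 \<le> d" "d < 2 * k"
  shows "(\<Sum>F\<in>arrangements k n d. (\<Prod>i<n. row_weight (A_alpha \<alpha> k H) i (F i)) * walk_weight k n d F) =
    (\<Sum>c<n. (\<alpha> * real (degree H c)) ^ d) + ((1 - \<alpha>) / fact (k - 1)) ^ k *
    (\<Sum>e\<in>edges H. \<Sum>K\<in>Pow e. \<Sum>F\<in>edge_arrangements k n d e K.
       (\<Prod>i<n. (\<alpha> * real (degree H i)) ^ loops k F i) * walk_weight k n d F)"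
proof -
  let ?w = "\<lambda>F. (\<Prod>i<n. row_weight (A_alpha \<alpha> k H) i (F i)) * walk_weight k n d F"
  let ?D = "diagonal_arrangement k n d ` {..<n}"
  let ?B = "\<lambda>e. \<Union>K\<in>Pow e. edge_arrangements k n d e K"
  have fin: "finite (?B e)" if "e \<in> edges H" for e using edge[OF that] by auto
  have sub: "edge_arrangements k n d e K \<subseteq> arrangements k n d" for e K
    by (auto simp: edge_arrangements_def)
  have zero: "?w F = 0" if F: "F \<in> arrangements k n d" "F \<notin> ?D \<union> (\<Union>e\<in>edges H. ?B e)" for F
  proof (cases "supported F")
    case True
    have "closed_walks n (d * (k - 1)) (arcs n F) = {}"
    proof (rule ccontr)
      assume "closed_walks n (d * (k - 1)) (arcs n F) \<noteq> {}"
      from arrangement_cases[OF F(1) True this d] show False using F(2) by blast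
    qed
    then show ?thesis by (simp add: walk_weight_def)
  next
    case False
    then show ?thesis using weight_unsupported[OF F(1)] by simp
  qed
  have "(\<Sum>F\<in>arrangements k n d. ?w F) = (\<Sum>F\<in>?D \<union> (\<Union>e\<in>edges H. ?B e). ?w F)"
  proof (rule sum.mono_neutral_right[OF finite_arrangements])
    show "?D \<union> (\<Union>e\<in>edges H. ?B e) \<subseteq> arrangements k n d"
    proof (rule Un_least)
      show "?D \<subseteq> arrangements k n d" using diagonal_arrangement_mem by auto
      show "(\<Union>e\<in>edges H. ?B e) \<subseteq> arrangements k n d" by (intro UN_least sub)
    qed
    show "\<forall>F\<in>arrangements k n d - (?D \<union> (\<Union>e\<in>edges H. ?B e)). ?w F = 0"
      by (rule ballI, rule zero) (simp_all only: Diff_iff not_False_eq_True)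
  qed
  also have "\<dots> = (\<Sum>F\<in>?D. ?w F) + (\<Sum>F\<in>(\<Union>e\<in>edges H. ?B e). ?w F)"
  proof (rule sum.union_disjoint)
    show "finite (\<Union>e\<in>edges H. ?B e)" by (rule finite_UN_I[OF fin_edges fin])
    have "F \<notin> ?D" if "F \<in> (\<Union>e\<in>edges H. ?B e)" for F
    proof
      assume "F \<in> ?D"
      then obtain c where "F = diagonal_arrangement k n d c" by blast
      then show False using that by (elim UN_E) (simp only: diagonal_not_edge_arrangement)
    qed
    then show "?D \<inter> (\<Union>e\<in>edges H. ?B e) = {}" by blast
  qed simp
  also have "(\<Sum>F\<in>?D. ?w F) = (\<Sum>c<n. ?w (diagonal_arrangement k n d c))"
  proof (subst sum.reindex)
    show "inj_on (diagonal_arrangement k n d) {..<n}"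
      by (rule inj_onI) (rule diagonal_inj[OF d(1)], simp_all)
  qed (simp only: o_def)
  also have "\<dots> = (\<Sum>c<n. (\<alpha> * real (degree H c)) ^ d)"
    by (intro sum.cong refl) (simp add: weight_diagonal walk_weight_diagonal A_alpha_Cons)
  also have "(\<Sum>F\<in>(\<Union>e\<in>edges H. ?B e). ?w F) = (\<Sum>e\<in>edges H. \<Sum>F\<in>?B e. ?w F)"
  proof (rule sum.UNION_disjoint[OF fin_edges])
    show "\<forall>e\<in>edges H. finite (?B e)" using fin by blast
    have "e = e'" if "e \<in> edges H" "e' \<in> edges H" "F \<in> ?B e" "F \<in> ?B e'" for e e' F
      using that(3,4) by (elim UN_E) (rule edge_arrangements_disjoint(1)[OF that(1,2)])
    then show "\<forall>e\<in>edges H. \<forall>e'\<in>edges H. e \<noteq> e' \<longrightarrow> ?B e \<inter> ?B e' = {}"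
      by (metis disjoint_iff)
  qed
  also have "\<dots> = (\<Sum>e\<in>edges H. \<Sum>K\<in>Pow e. \<Sum>F\<in>edge_arrangements k n d e K. ?w F)"
  proof (rule sum.cong[OF refl])
    fix e assume e: "e \<in> edges H"
    show "(\<Sum>F\<in>?B e. ?w F) = (\<Sum>K\<in>Pow e. \<Sum>F\<in>edge_arrangements k n d e K. ?w F)"
    proof (rule sum.UNION_disjoint)
      show "finite (Pow e)" using edge[OF e] by simp
      show "\<forall>K\<in>Pow e. \<forall>K'\<in>Pow e. K \<noteq> K' \<longrightarrow> edge_arrangements k n d e K \<inter> edge_arrangements k n d e K' = {}"
        using edge_arrangements_disjoint(2)[OF e e] by (metis disjoint_iff)
    qed simp
  qed
  also have "\<dots> = (\<Sum>e\<in>edges H. \<Sum>K\<in>Pow e. \<Sum>F\<in>edge_arrangements k n d e K.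
      ((1 - \<alpha>) / fact (k - 1)) ^ k * ((\<Prod>i<n. (\<alpha> * real (degree H i)) ^ loops k F i) * walk_weight k n d F))"
  proof (intro sum.cong[OF refl])
    fix e K F assume e: "e \<in> edges H" and F: "F \<in> edge_arrangements k n d e K"
    have arr: "F \<in> arrangements k n d" using F sub by blast
    show "?w F = ((1 - \<alpha>) / fact (k - 1)) ^ k *
        ((\<Prod>i<n. (\<alpha> * real (degree H i)) ^ loops k F i) * walk_weight k n d F)"
      unfolding weight_supported[OF arr edge_arrangements_supported[OF F e]]
        sum_hits_edge_arrangement(1)[OF F e] by (simp only: mult_ac)
  qed
  also have "\<dots> = ((1 - \<alpha>) / fact (k - 1)) ^ k * (\<Sum>e\<in>edges H. \<Sum>K\<in>Pow e. \<Sum>F\<in>edge_arrangements k n d e K.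
      (\<Prod>i<n. (\<alpha> * real (degree H i)) ^ loops k F i) * walk_weight k n d F)"
    by (simp only: sum_distrib_left)
  finally show ?thesis .
qed

lemma k_le_n: "k \<le> n"
proof -
  have "1 * (k - 1) \<le> m * (k - 1)" using m by (intro mult_right_mono) auto
  then show ?thesis unfolding nverts by linarith
qed

text \<open>As \<open>k \<le> n\<close>, the set \<open>{..<k}\<close> can serve as a model
  hyperedge, whether or not it is one of \<open>H\<close>.\<close>

lemma edge_weight_edge:
  assumes "e \<in> edges H" "K \<subseteq> e" "K' \<subseteq> {..<k}" "card K = card K'"
  shows "edge_weight k n d e K = edge_weight k n d {..<k} K'"
  using edge[OF assms(1)] assms k_le_n by (intro edge_weight_eq) auto

lemma loop_support:
  assumes "F \<in> edge_arrangements k n d e K"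
  shows "(\<Sum>i<n. loops k F i) = (\<Sum>i\<in>K. loops k F i)"
    and "(\<Prod>i<n. x i ^ loops k F i) = (\<Prod>i\<in>K. (x i :: real) ^ loops k F i)"
    and "\<And>i. i \<in> K \<Longrightarrow> 1 \<le> loops k F i"
    and "finite K"
proof -
  have K: "{u. u < n \<and> loops k F u > 0} = K" using assms by (auto simp: edge_arrangements_def)
  show "(\<Sum>i<n. loops k F i) = (\<Sum>i\<in>K. loops k F i)"
    using K by (intro sum.mono_neutral_right) auto
  show "(\<Prod>i<n. x i ^ loops k F i) = (\<Prod>i\<in>K. x i ^ loops k F i)"
    using K by (intro prod.mono_neutral_right) auto
  show "1 \<le> loops k F i" if "i \<in> K" for i using that K by auto
  show "finite K" using K by (auto intro: finite_subset[of _ "{..<n}"])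
qed

text \<open>An edge arrangement of order 2 has \<open>k\<close> entries from its hyperedge, which
  leaves no room for diagonal ones. For \<open>k > 2\<close> there are no such arrangements, and the
  weight is an empty sum.\<close>

theorem spectral_moment_2:
  "spectral_moment \<alpha> k 2 H = real ((k - 1) ^ (n - 1)) *
    (\<alpha>\<^sup>2 * degree_power_sum 2 H + real m * (((1 - \<alpha>) / fact (k - 1)) ^ k * edge_weight k n 2 {..<k} {}))"
proof -
  have inner: "(\<Sum>K\<in>Pow e. \<Sum>F\<in>edge_arrangements k n 2 e K.
      (\<Prod>i<n. (\<alpha> * real (degree H i)) ^ loops k F i) * walk_weight k n 2 F) = edge_weight k n 2 {..<k} {}"
    if e: "e \<in> edges H" for e
  proof -
    have no_loops: "K = {} \<and> (\<Prod>i<n. (\<alpha> * real (degree H i)) ^ loops k F i) = 1"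
      if F: "F \<in> edge_arrangements k n 2 e K" for F K
    proof -
      have "(\<Sum>i<n. loops k F i) = 0" using sum_hits_edge_arrangement(2)[OF F e] k by linarith
      then have "\<forall>i<n. loops k F i = 0" by simp
      then show ?thesis using F by (auto simp: edge_arrangements_def)
    qed
    have "(\<Sum>K\<in>Pow e. \<Sum>F\<in>edge_arrangements k n 2 e K.
        (\<Prod>i<n. (\<alpha> * real (degree H i)) ^ loops k F i) * walk_weight k n 2 F) =
        (\<Sum>K\<in>Pow e. edge_weight k n 2 e K)"
      unfolding edge_weight_def using no_loops by (intro sum.cong refl) auto
    also have "\<dots> = (\<Sum>K\<in>{{}}. edge_weight k n 2 e K)"
    proof (rule sum.mono_neutral_right)
      show "finite (Pow e)" using edge[OF e] by simp
      show "\<forall>K\<in>Pow e - {{}}. edge_weight k n 2 e K = 0"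
      proof
        fix K assume "K \<in> Pow e - {{}}"
        then have none: "edge_arrangements k n 2 e K = {}" using no_loops by blast
        show "edge_weight k n 2 e K = 0" unfolding edge_weight_def none by simp
      qed
    qed simp
    also have "\<dots> = edge_weight k n 2 {..<k} {}" using edge_weight_edge[OF e, of "{}" "{}"] by simp
    finally show ?thesis .
  qed
  have "(\<Sum>c<n. (\<alpha> * real (degree H c)) ^ 2) = \<alpha>\<^sup>2 * degree_power_sum 2 H"
    by (simp add: degree_power_sum_def power_mult_distrib sum_distrib_left)
  moreover have "(\<Sum>e\<in>edges H. \<Sum>K\<in>Pow e. \<Sum>F\<in>edge_arrangements k n 2 e K.
      (\<Prod>i<n. (\<alpha> * real (degree H i)) ^ loops k F i) * walk_weight k n 2 F) =
      real m * edge_weight k n 2 {..<k} {}"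
    using inner by (simp add: card_edges)
  moreover have "2 < 2 * k" using k by simp
  ultimately show ?thesis
    unfolding spectral_moment_def
    using tensor_trace_expansion[OF k, of 2 n "A_alpha \<alpha> k H"] moment_sum[of 2 \<alpha>] by simp
qed

text \<open>Two diagonal entries accompany the hyperedge: both at one vertex, or one at each of two
  vertices. The first case gives a squared degree for every incidence, hence the sum of cubes
  because a vertex lies on as many hyperedges as its degree; the second gives the pair sum.\<close>

theorem spectral_moment_add_2:
  assumes "k \<ge> 3"
  shows "spectral_moment \<alpha> k (k + 2) H = real ((k - 1) ^ (n - 1)) *
    (\<alpha> ^ (k + 2) * degree_power_sum (k + 2) H + ((1 - \<alpha>) / fact (k - 1)) ^ k * \<alpha>\<^sup>2 *
      (edge_weight k n (k + 2) {..<k} {0} * degree_power_sum 3 H +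
       edge_weight k n (k + 2) {..<k} {0, 1} * degree_pair_sum H))"
proof -
  let ?x = "\<lambda>i. \<alpha> * real (degree H i)"
  let ?c1 = "edge_weight k n (k + 2) {..<k} {0}" and ?c2 = "edge_weight k n (k + 2) {..<k} {0, 1}"
  let ?S = "\<lambda>e K. \<Sum>F\<in>edge_arrangements k n (k + 2) e K. (\<Prod>i<n. ?x i ^ loops k F i) * walk_weight k n (k + 2) F"
  have one: "?S e {u} = \<alpha>\<^sup>2 * (real (degree H u))\<^sup>2 * ?c1" if e: "e \<in> edges H" "u \<in> e" for e u
  proof -
    have "(\<Prod>i<n. ?x i ^ loops k F i) = (?x u)\<^sup>2" if F: "F \<in> edge_arrangements k n (k + 2) e {u}" for F
    proof -
      have "loops k F u = 2" using sum_hits_edge_arrangement(2)[OF F e(1)] loop_support(1)[OF F] by simp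
      then show ?thesis using loop_support(2)[OF F, of ?x] by simp
    qed
    then have "?S e {u} = (?x u)\<^sup>2 * edge_weight k n (k + 2) e {u}"
      unfolding edge_weight_def by (simp add: sum_distrib_left)
    also have "edge_weight k n (k + 2) e {u} = ?c1"
      using e k by (intro edge_weight_edge) auto
    finally show ?thesis by (simp add: power_mult_distrib)
  qed
  have two: "?S e K = \<alpha>\<^sup>2 * (\<Prod>v\<in>K. real (degree H v)) * ?c2"
    if e: "e \<in> edges H" "K \<subseteq> e" "card K = 2" for e K
  proof -
    have "(\<Prod>i<n. ?x i ^ loops k F i) = (\<Prod>i\<in>K. ?x i)" if F: "F \<in> edge_arrangements k n (k + 2) e K" for F
    proof -
      have s: "(\<Sum>i\<in>K. loops k F i) = 2"
        using sum_hits_edge_arrangement(2)[OF F e(1)] loop_support(1)[OF F] by simp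
      have "loops k F i = 1" if i: "i \<in> K" for i
      proof (rule ccontr)
        assume "loops k F i \<noteq> 1"
        then have gt: "1 < loops k F i" using loop_support(3)[OF F i] by simp
        have "(\<Sum>i\<in>K. 1) < (\<Sum>i\<in>K. loops k F i)"
          using loop_support(3)[OF F] i gt
          by (intro sum_strict_mono_ex1[OF loop_support(4)[OF F]] ballI bexI[of _ i])
        then show False using s e(3) by simp
      qed
      then show ?thesis using loop_support(2)[OF F, of ?x] by simp
    qed
    then have "?S e K = (\<Prod>i\<in>K. ?x i) * edge_weight k n (k + 2) e K"
      unfolding edge_weight_def by (simp add: sum_distrib_left)
    also have "edge_weight k n (k + 2) e K = ?c2"
      using e k by (intro edge_weight_edge) auto
    finally show ?thesis using e(3) by (simp add: prod.distrib)
  qed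
  have other: "?S e K = 0" if e: "e \<in> edges H" "K \<subseteq> e" "card K \<noteq> 1" "card K \<noteq> 2" for e K
  proof -
    have "edge_arrangements k n (k + 2) e K = {}"
    proof (rule ccontr)
      assume "edge_arrangements k n (k + 2) e K \<noteq> {}"
      then obtain F where F: "F \<in> edge_arrangements k n (k + 2) e K" by blast
      have s: "(\<Sum>i\<in>K. loops k F i) = 2"
        using sum_hits_edge_arrangement(2)[OF F e(1)] loop_support(1)[OF F] by simp
      have "(\<Sum>i\<in>K. 1) \<le> (\<Sum>i\<in>K. loops k F i)" by (intro sum_mono loop_support(3)[OF F])
      then have "card K \<le> 2" using s by simp
      moreover have "card K \<noteq> 0" using s loop_support(4)[OF F] by auto
      ultimately show False using e(3,4) by linarith
    qed
    then show ?thesis by simp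
  qed
  have inner: "(\<Sum>K\<in>Pow e. ?S e K) = \<alpha>\<^sup>2 * ?c1 * (\<Sum>u\<in>e. (real (degree H u))\<^sup>2) +
      \<alpha>\<^sup>2 * ?c2 * (\<Sum>K | K \<subseteq> e \<and> card K = 2. \<Prod>v\<in>K. real (degree H v))" if e: "e \<in> edges H" for e
  proof -
    let ?K1 = "(\<lambda>u. {u}) ` e" and ?K2 = "{K. K \<subseteq> e \<and> card K = 2}"
    have fin: "finite e" using edge[OF e] by simp
    have "(\<Sum>K\<in>Pow e. ?S e K) = (\<Sum>K\<in>?K1 \<union> ?K2. ?S e K)"
    proof (rule sum.mono_neutral_right)
      show "\<forall>K\<in>Pow e - (?K1 \<union> ?K2). ?S e K = 0"
      proof
        fix K assume K: "K \<in> Pow e - (?K1 \<union> ?K2)"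
        then have "card K \<noteq> 1" by (auto simp: card_1_singleton_iff)
        then show "?S e K = 0" using other[OF e] K by blast
      qed
    qed (use fin in auto)
    also have "\<dots> = (\<Sum>K\<in>?K1. ?S e K) + (\<Sum>K\<in>?K2. ?S e K)"
      using fin by (intro sum.union_disjoint) auto
    also have "(\<Sum>K\<in>?K1. ?S e K) = (\<Sum>u\<in>e. ?S e {u})"
      by (subst sum.reindex) auto
    also have "\<dots> = (\<Sum>u\<in>e. \<alpha>\<^sup>2 * ?c1 * (real (degree H u))\<^sup>2)"
      by (rule sum.cong[OF refl]) (simp only: one[OF e], simp only: mult_ac)
    also have "(\<Sum>K\<in>?K2. ?S e K) = (\<Sum>K\<in>?K2. \<alpha>\<^sup>2 * ?c2 * (\<Prod>v\<in>K. real (degree H v)))"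
      by (rule sum.cong[OF refl]) (simp only: two[OF e] mem_Collect_eq, simp only: mult_ac)
    finally show ?thesis by (simp only: sum_distrib_left)
  qed
  have cube: "(\<Sum>e\<in>edges H. \<Sum>u\<in>e. (real (degree H u))\<^sup>2) = degree_power_sum 3 H"
    using sum_edges[OF uni, of "\<lambda>u. (real (degree H u))\<^sup>2"]
    by (simp add: degree_power_sum_def power3_eq_cube power2_eq_square mult.assoc)
  have total: "(\<Sum>e\<in>edges H. \<Sum>K\<in>Pow e. ?S e K) =
      \<alpha>\<^sup>2 * (?c1 * degree_power_sum 3 H + ?c2 * degree_pair_sum H)"
    unfolding degree_pair_sum_def cube[symmetric] using inner
    by (simp add: sum.distrib sum_distrib_left distrib_left mult.assoc)
  have diag: "(\<Sum>c<n. ?x c ^ (k + 2)) = \<alpha> ^ (k + 2) * degree_power_sum (k + 2) H"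
    unfolding degree_power_sum_def sum_distrib_left by (intro sum.cong refl) (rule power_mult_distrib)
  \<comment> \<open>This is where \<open>k \<ge> 3\<close> enters: it keeps the order below
    \<open>2 * k\<close>.\<close>
  have d: "1 \<le> k + 2" "k + 2 < 2 * k" using assms by auto
  show ?thesis
    unfolding spectral_moment_def tensor_trace_expansion[OF k d(1)] moment_sum[OF d] diag total
    by (simp only: mult.assoc)
qed

end

section \<open>Comparison of the spectral moments\<close>

theorem theorem7p3:
  fixes \<alpha> :: real and k m :: nat
  assumes "0 < \<alpha>" and "\<alpha> < 1" and "1 \<le> m"
  shows
    "(2 \<le> k \<longrightarrow>
       (hyperstar k m \<in> uniform_hypertrees k m \<and>
        (\<forall>H\<in>uniform_hypertrees k m.
           spectral_moment \<alpha> k 2 H \<le> spectral_moment \<alpha> k 2 (hyperstar k m))) \<and>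
       (3 \<le> m \<longrightarrow>
         starlike_12 k m \<in> uniform_hypertrees k m \<and>
         spectral_moment \<alpha> k 2 (starlike_12 k m) < spectral_moment \<alpha> k 2 (hyperstar k m) \<and>
         (\<forall>H\<in>uniform_hypertrees k m. \<not> isomorphic H (hyperstar k m) \<longrightarrow>
            spectral_moment \<alpha> k 2 H \<le> spectral_moment \<alpha> k 2 (starlike_12 k m)))) \<and>
     (3 \<le> k \<longrightarrow>
       (hyperpath k m \<in> uniform_hypertrees k m \<and>
        (\<forall>H\<in>uniform_hypertrees k m.
           spectral_moment \<alpha> k (k + 2) (hyperpath k m) \<le> spectral_moment \<alpha> k (k + 2) H)) \<and>
       (4 \<le> m \<longrightarrow>
         F_tree m k \<in> uniform_hypertrees k m \<and>
         spectral_moment \<alpha> k (k + 2) (hyperpath k m) < spectral_moment \<alpha> k (k + 2) (F_tree m k) \<and>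
         (\<forall>H\<in>uniform_hypertrees k m. \<not> isomorphic H (hyperpath k m) \<longrightarrow>
            spectral_moment \<alpha> k (k + 2) (F_tree m k) \<le> spectral_moment \<alpha> k (k + 2) H)))"
proof -
  have nv: "nverts H = m * (k - 1) + 1" if "2 \<le> k" "H \<in> uniform_hypertrees k m" for H
  proof -
    interpret uniform_hypertree k m H using that assms(3) by unfold_locales
    show ?thesis by (rule nverts)
  qed
  \<comment> \<open>All competitors have the same number of vertices, so the factors and weights
    below are common constants.\<close>
  define N where "N = m * (k - 1) + 1"
  define P where "P = real ((k - 1) ^ (N - 1))"
  have P: "P > 0" if "2 \<le> k" using that by (simp add: P_def)
  define c where "c = real m * (((1 - \<alpha>) / fact (k - 1)) ^ k * edge_weight k N 2 {..<k} {})"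
  have two: "spectral_moment \<alpha> k 2 H = P * (\<alpha>\<^sup>2 * degree_power_sum 2 H + c)"
    if "2 \<le> k" "H \<in> uniform_hypertrees k m" for H
  proof -
    interpret uniform_hypertree k m H using that assms(3) by unfold_locales
    show ?thesis unfolding spectral_moment_2 nv[OF that] N_def P_def c_def ..
  qed
  have le2: "spectral_moment \<alpha> k 2 G \<le> spectral_moment \<alpha> k 2 H"
    if "2 \<le> k" "G \<in> uniform_hypertrees k m" "H \<in> uniform_hypertrees k m"
      "degree_power_sum 2 G \<le> degree_power_sum 2 H" for G H
    unfolding two[OF that(1,2)] two[OF that(1,3)] using P[OF that(1)] that(4) assms(1)
    by (intro mult_left_mono add_right_mono) auto
  have less2: "spectral_moment \<alpha> k 2 G < spectral_moment \<alpha> k 2 H"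
    if "2 \<le> k" "G \<in> uniform_hypertrees k m" "H \<in> uniform_hypertrees k m"
      "degree_power_sum 2 G < degree_power_sum 2 H" for G H
    unfolding two[OF that(1,2)] two[OF that(1,3)] using P[OF that(1)] that(4) assms(1)
    by (intro mult_strict_left_mono add_strict_right_mono) auto
  define \<beta> where "\<beta> = ((1 - \<alpha>) / fact (k - 1)) ^ k * \<alpha>\<^sup>2"
  define c1 where "c1 = edge_weight k N (k + 2) {..<k} {0}"
  define c2 where "c2 = edge_weight k N (k + 2) {..<k} {0, 1}"
  have "\<beta> > 0" unfolding \<beta>_def using assms by (intro mult_pos_pos zero_less_power divide_pos_pos) auto
  \<comment> \<open>The sign of \<open>c1\<close> suffices: the cubes of the degrees only enter
    through weak inequalities or equalities.\<close>
  have "c1 \<ge> 0" unfolding c1_def by (rule edge_weight_nonneg)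
  have c2: "c2 > 0" if "3 \<le> k"
  proof -
    have "1 * (k - 1) \<le> m * (k - 1)" using assms(3) by (intro mult_right_mono) auto
    then have "k \<le> N" unfolding N_def by linarith
    then show ?thesis unfolding c2_def using that by (intro edge_weight_pos) simp
  qed
  have add2: "spectral_moment \<alpha> k (k + 2) H = P * (\<alpha> ^ (k + 2) * degree_power_sum (k + 2) H +
      \<beta> * (c1 * degree_power_sum 3 H + c2 * degree_pair_sum H))"
    if "3 \<le> k" "H \<in> uniform_hypertrees k m" for H
  proof -
    have k2: "2 \<le> k" using that(1) by simp
    interpret uniform_hypertree k m H using that(2) k2 assms(3) by unfold_locales
    show ?thesis unfolding spectral_moment_add_2[OF that(1)] nv[OF k2 that(2)] N_def P_def \<beta>_def c1_def c2_def ..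
  qed
  have le_add2: "spectral_moment \<alpha> k (k + 2) G \<le> spectral_moment \<alpha> k (k + 2) H"
    if "3 \<le> k" "G \<in> uniform_hypertrees k m" "H \<in> uniform_hypertrees k m"
      "\<And>j. degree_power_sum j G \<le> degree_power_sum j H" "degree_pair_sum G \<le> degree_pair_sum H" for G H
  proof -
    have "2 \<le> k" using that(1) by simp
    then show ?thesis
      unfolding add2[OF that(1,2)] add2[OF that(1,3)]
      using P c2[OF that(1)] \<open>c1 \<ge> 0\<close> \<open>\<beta> > 0\<close> that(4,5) assms(1)
      by (intro mult_left_mono add_mono) auto
  qed
  have less_add2: "spectral_moment \<alpha> k (k + 2) G < spectral_moment \<alpha> k (k + 2) H"
    if "3 \<le> k" "G \<in> uniform_hypertrees k m" "H \<in> uniform_hypertrees k m"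
      "\<And>j. degree_power_sum j G = degree_power_sum j H" "degree_pair_sum G < degree_pair_sum H" for G H
  proof -
    have "2 \<le> k" using that(1) by simp
    then show ?thesis
      unfolding add2[OF that(1,2)] add2[OF that(1,3)] that(4)
      using P c2[OF that(1)] \<open>\<beta> > 0\<close> that(5)
      by (intro mult_strict_left_mono add_strict_left_mono) auto
  qed
  show ?thesis
  proof (intro conjI impI ballI)
    assume k: "2 \<le> k"
    show star: "hyperstar k m \<in> uniform_hypertrees k m" by (rule hyperstar_hypertree(1)[OF k])
    show "spectral_moment \<alpha> k 2 H \<le> spectral_moment \<alpha> k 2 (hyperstar k m)"
      if "H \<in> uniform_hypertrees k m" for H
      by (rule le2[OF k that star degree_square_sum_extremal(1)[OF k assms(3) that]])
    assume m: "3 \<le> m"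
    show s12: "starlike_12 k m \<in> uniform_hypertrees k m" by (rule starlike_12_hypertree(1)[OF k m])
    show "spectral_moment \<alpha> k 2 (starlike_12 k m) < spectral_moment \<alpha> k 2 (hyperstar k m)"
      by (rule less2[OF k s12 star degree_square_sum_extremal(2)[OF k assms(3) star m]])
    show "spectral_moment \<alpha> k 2 H \<le> spectral_moment \<alpha> k 2 (starlike_12 k m)"
      if "H \<in> uniform_hypertrees k m" "\<not> isomorphic H (hyperstar k m)" for H
      by (rule le2[OF k that(1) s12 degree_square_sum_extremal(3)[OF k assms(3) that(1) m that(2)]])
  next
    assume k: "3 \<le> k"
    then have k2: "2 \<le> k" by simp
    show path: "hyperpath k m \<in> uniform_hypertrees k m" by (rule hyperpath_hypertree[OF k2])
    show "spectral_moment \<alpha> k (k + 2) (hyperpath k m) \<le> spectral_moment \<alpha> k (k + 2) H"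
      if "H \<in> uniform_hypertrees k m" for H
      by (rule le_add2[OF k path that degree_sums_extremal(1,2)[OF k assms(3) that]])
    assume m: "4 \<le> m"
    show F: "F_tree m k \<in> uniform_hypertrees k m" by (rule F_tree_hypertree[OF k m])
    \<comment> \<open>As all power sums of degrees agree, the strict inequality rests on the pair
      sum and on \<open>c2 > 0\<close> alone.\<close>
    note same = degree_sums_extremal(3)[OF k assms(3) path m]
    have "degree_pair_sum (hyperpath k m) < degree_pair_sum (F_tree m k)"
      using degree_sums_extremal(4)[OF k assms(3) path m] by simp
    then show "spectral_moment \<alpha> k (k + 2) (hyperpath k m) < spectral_moment \<alpha> k (k + 2) (F_tree m k)"
      by (rule less_add2[OF k path F same[symmetric]])
    show "spectral_moment \<alpha> k (k + 2) (F_tree m k) \<le> spectral_moment \<alpha> k (k + 2) H"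
      if H: "H \<in> uniform_hypertrees k m" "\<not> isomorphic H (hyperpath k m)" for H
    proof (rule le_add2[OF k F H(1)])
      show "degree_power_sum j (F_tree m k) \<le> degree_power_sum j H" for j
        unfolding same by (rule degree_sums_extremal(1)[OF k assms(3) H(1)])
      show "degree_pair_sum (F_tree m k) \<le> degree_pair_sum H"
        by (rule degree_sums_extremal(5)[OF k assms(3) H(1) m H(2)])
    qed
  qed
qed

end
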